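(* Let $\mathbb F$ be a field, $A\in\mathbb F^{k\times k}$ and $r$ a positive integer. There is an algorithm that, after a precomputation on $A$ and $r$ using $\tilde O\!\left(\binom{k}{\downarrow r}4^k\right)$ $\mathbb F$-operations, answers each query of the following form using $\tilde O\!\left(\binom{k}{\downarrow r}^3\right)$ $\mathbb F$-operations: given a matrix $F(t)\in\mathbb F[t]^{k\times k}$ whose entries are polynomials of degree less than $r$ with $F(0)=A$, output $\operatorname{hc}(F(t))\bmod t^r$.
   Context: $\operatorname{hc}(A)=\sum_{\sigma\in S_k,\ c(\sigma)=1}\prod_{i=1}^k A_{i,\sigma(i)}$, where $c(\sigma)$ is the number of cycles of $\sigma$. $\binom{k}{\downarrow r}=\sum_{0\le i\le r}\binom{k}{i}$. $\tilde O(f)$ denotes $O(f\cdot\operatorname{polylog}(f))$. Operation counts are measured in arithmetic operations over $\mathbb F$.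
   Formalization: The query bound is proved for r at most a times binom(k,↓r), for any fixed a, with constants depending on a; with no such limit it fails (k=2, r→∞ needs about r operations, while binom(2,↓r)^3 is at most 64). *)

theory Defs
  imports
    "HOL-Library.Landau_Symbols"
    "HOL-Library.Nat_Bijection"
    "HOL-Combinatorics.Orbits"
    "HOL-Computational_Algebra.Polynomial"
    "Jordan_Normal_Form.Matrix"
begin

text \<open>Rows and columns are indexed by $0, \ldots, k-1$. Fixed points count as cycles.\<close>

definition cycle_count :: "nat \<Rightarrow> (nat \<Rightarrow> nat) \<Rightarrow> nat" where
  "cycle_count k \<sigma> = card (orbit \<sigma> ` {..<k})"

definition hc :: "'a::comm_ring_1 mat \<Rightarrow> 'a" where
  "hc A = (\<Sum>\<sigma> | \<sigma> permutes {..<dim_row A} \<and> cycle_count (dim_row A) \<sigma> = 1.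
             \<Prod>i<dim_row A. A $$ (i, \<sigma> i))"

definition binom_le :: "nat \<Rightarrow> nat \<Rightarrow> nat" where
  "binom_le k r = (\<Sum>i\<le>r. k choose i)"

text \<open>The shift by 2 only keeps the logarithm away from 0 when the bound equals 1.\<close>

definition soft_O :: "'x filter \<Rightarrow> ('x \<Rightarrow> real) \<Rightarrow> ('x \<Rightarrow> real) set" where
  "soft_O F f = (\<Union>d::nat. O[F](\<lambda>x. f x * ln (2 + f x) ^ d))"

text \<open>
  Memory cells are addressed by natural numbers; the input is a separate read-only tape.
  Instructions contain no field elements, so that a program is meaningful over every field.
  In the arithmetic instructions the first argument is the destination.
\<close>

datatype instr =
    Set_Zero nat
  | Set_One nat
  | Load nat nat
  | Add nat nat nat
  | Sub nat nat nat
  | Mul nat nat nat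
  | Div nat nat nat

type_synonym 'a memory = "nat \<Rightarrow> 'a"

fun step :: "(nat \<Rightarrow> 'a::field) \<Rightarrow> instr \<Rightarrow> 'a memory \<Rightarrow> 'a memory option" where
  "step inp (Set_Zero d) m = Some (m(d := 0))"
| "step inp (Set_One d) m = Some (m(d := 1))"
| "step inp (Load d i) m = Some (m(d := inp i))"
| "step inp (Add d x y) m = Some (m(d := m x + m y))"
| "step inp (Sub d x y) m = Some (m(d := m x - m y))"
| "step inp (Mul d x y) m = Some (m(d := m x * m y))"
| "step inp (Div d x y) m = (if m y = 0 then None else Some (m(d := m x / m y)))"

fun run :: "(nat \<Rightarrow> 'a::field) \<Rightarrow> instr list \<Rightarrow> 'a memory \<Rightarrow> 'a memory option" where
  "run inp [] m = Some m"
| "run inp (c # p) m = Option.bind (step inp c m) (run inp p)"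

fun is_arith :: "instr \<Rightarrow> bool" where
  "is_arith (Add d x y) = True"
| "is_arith (Sub d x y) = True"
| "is_arith (Mul d x y) = True"
| "is_arith (Div d x y) = True"
| "is_arith _ = False"

definition field_ops :: "instr list \<Rightarrow> nat" where
  "field_ops p = length (filter is_arith p)"

text \<open>
  The total recursive functions, in unary form with several arguments packed by
  \<^const>\<open>prod_encode\<close>; minimisation is applied to regular functions only, so that exactly
  the total computable functions are obtained.
\<close>

inductive computable :: "(nat \<Rightarrow> nat) \<Rightarrow> bool" where
  zero: "computable (\<lambda>_. 0)"
| suc: "computable Suc"
| fst: "computable (\<lambda>x. fst (prod_decode x))"
| snd: "computable (\<lambda>x. snd (prod_decode x))"
| pair: "computable f \<Longrightarrow> computable g \<Longrightarrow> computable (\<lambda>x. prod_encode (f x, g x))"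
| comp: "computable f \<Longrightarrow> computable g \<Longrightarrow> computable (\<lambda>x. f (g x))"
| rec: "computable f \<Longrightarrow> computable g \<Longrightarrow>
    computable (\<lambda>x. rec_nat (f (fst (prod_decode x)))
      (\<lambda>n y. g (prod_encode (fst (prod_decode x), prod_encode (n, y))))
      (snd (prod_decode x)))"
| mu: "computable f \<Longrightarrow> (\<And>x. \<exists>n. f (prod_encode (x, n)) = 0) \<Longrightarrow>
    computable (\<lambda>x. LEAST n. f (prod_encode (x, n)) = 0)"

fun instr_code :: "instr \<Rightarrow> nat" where
  "instr_code (Set_Zero d) = prod_encode (0, d)"
| "instr_code (Set_One d) = prod_encode (1, d)"
| "instr_code (Load d i) = prod_encode (2, prod_encode (d, i))"
| "instr_code (Add d x y) = prod_encode (3, prod_encode (d, prod_encode (x, y)))"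
| "instr_code (Sub d x y) = prod_encode (4, prod_encode (d, prod_encode (x, y)))"
| "instr_code (Mul d x y) = prod_encode (5, prod_encode (d, prod_encode (x, y)))"
| "instr_code (Div d x y) = prod_encode (6, prod_encode (d, prod_encode (x, y)))"

definition uniform_family :: "(nat \<Rightarrow> nat \<Rightarrow> instr list) \<Rightarrow> bool" where
  "uniform_family P \<longleftrightarrow>
     computable (\<lambda>x. case prod_decode x of (k, r) \<Rightarrow> list_encode (map instr_code (P k r)))"

text \<open>
  A matrix is presented row by row; the entry in row $i$ and column $j$ of a polynomial matrix
  occupies $r$ consecutive cells $(i k + j) r, \ldots, (i k + j) r + r - 1$, holding its
  coefficients of $t^0, \ldots, t^{r-1}$.
\<close>

definition matrix_input :: "'a::zero mat \<Rightarrow> nat \<Rightarrow> 'a" where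
  "matrix_input A n =
     (let k = dim_row A in if n < k * k then A $$ (n div k, n mod k) else 0)"

definition poly_matrix_input :: "nat \<Rightarrow> 'a::zero poly mat \<Rightarrow> nat \<Rightarrow> 'a" where
  "poly_matrix_input r F n =
     (let k = dim_row F in
      if n < k * k * r then coeff (F $$ (n div r div k, n div r mod k)) (n mod r) else 0)"

definition valid_query :: "nat \<Rightarrow> nat \<Rightarrow> 'a::field mat \<Rightarrow> 'a poly mat \<Rightarrow> bool" where
  "valid_query k r A F \<longleftrightarrow>
     F \<in> carrier_mat k k \<and> (\<forall>i<k. \<forall>j<k. degree (F $$ (i, j)) < r) \<and>
     map_mat (\<lambda>p. poly p 0) F = A"

text \<open>
  The precomputation sees only the matrix (and, through the choice of the program, \<open>k\<close> and \<open>r\<close>);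
  every query starts from the memory \<open>M\<close> left by the precomputation and sees only the
  polynomial matrix. The answer is left in the cells $0, \ldots, r-1$.
\<close>

definition answers_queries ::
  "nat \<Rightarrow> nat \<Rightarrow> 'a::field mat \<Rightarrow> instr list \<Rightarrow> instr list \<Rightarrow> bool" where
  "answers_queries k r A pre query \<longleftrightarrow>
     (\<exists>M. run (matrix_input A) pre (\<lambda>_. 0) = Some M \<and>
       (\<forall>F. valid_query k r A F \<longrightarrow>
         (\<exists>N. run (poly_matrix_input r F) query M = Some N \<and>
           (\<forall>s<r. N s = coeff (hc F mod monom 1 r) s))))"

end

theory Submission
  imports
    Defs
    "HOL-Combinatorics.Cycles"
    "HOL-Combinatorics.Multiset_Permutations"
begin

text \<open>
  Over every commutative ring $\mathrm{hc}(F) = -\sum_{S \ni 0} (-1)^{|S|} \det(F_S)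
  \,\mathrm{per}(F_{V - S})$: in the expansion of the right-hand side over permutations, a cycle
  that avoids 0 may be moved in or out of $S$ with a change of sign, so that only Hamiltonian
  cycles survive. Write $F = A + B$ with $t \mid B$. Splitting both factors by Laplace expansion
  along the set $P$ of rows taken from $B$ (with columns $Q$) leaves only the terms with
  $|P| = |Q| < r$ modulo $t^r$. The minors of $B$ depend on $S$ only through $Z = S \cap (P \cup Q)$,
  so the precomputation tabulates the sums over all $S$ with given $P, Q, Z$; there are at most
  $2^k \binom{k}{\downarrow r} 2^k$ triples $(P, Q, S)$, and a query visits at most
  $\binom{k}{\downarrow r}^2 4^r$ triples $(P, Q, Z)$. For $2r \le k$ the factor $4^r$ is at most
  $2r \binom{k}{r}$. For $2r > k$ one has $\binom{k}{\downarrow r} \ge 2^{k-1}$, and a query may run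
  the dynamic programme of Held and Karp on polynomials, in $2^k k^2 r^2$ operations up to a constant.
\<close>

section \<open>Signed sums over bijections\<close>

text \<open>The rows X and the columns Y of a submatrix are different sets, so no sign of a
  permutation is at hand. Signs are products over the 2-element subsets of X, with -1 for each pair
  whose order is reversed. This makes sense over every commutative ring and for every bijection from
  X to Y, is multiplicative under composition and splits along any subset of X. A Boolean flag
  switches the sign off, so one argument covers determinants, permanents and their mixed products.

  On the machine side every intermediate quantity is a \<open>node\<close> with its own cell and a
  value prescribed in advance. The programs are straight-line: all tests on sets are made while a
  program is generated. Correctness thus reduces to checking that each assignment reads only cells
  already filled and that its summands add up to the prescribed value. The generator must be
  recursive and its output countable, so programs are nested loops over codes of sets; this one
  shape yields computability, values and operation counts.\<close>

text \<open>Fixing every point outside X gives each bijection a single representative; hence the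
  sums are finite, and \<open>bijs V V\<close> is literally the set of permutations of V.\<close>

definition bijs :: "nat set \<Rightarrow> nat set \<Rightarrow> (nat \<Rightarrow> nat) set" where
  "bijs X Y = {f. bij_betw f X Y \<and> (\<forall>x. x \<notin> X \<longrightarrow> f x = x)}"

text \<open>A pair is an unordered 2-element set, so that an injective map reindexes a product over
  pairs without a choice of orientation.\<close>

definition pair_sign :: "(nat \<Rightarrow> nat) \<Rightarrow> nat set \<Rightarrow> 'a::comm_ring_1" where
  "pair_sign f e = (if f (Min e) < f (Max e) then 1 else - 1)"

definition inv_sign :: "bool \<Rightarrow> nat set \<Rightarrow> (nat \<Rightarrow> nat) \<Rightarrow> 'a::comm_ring_1" where
  "inv_sign b X f = (if b then \<Prod>e | e \<subseteq> X \<and> card e = 2. pair_sign f e else 1)"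

text \<open>Determinant (b true) or permanent (b false) of the submatrix with rows X and columns Y
  in increasing order; the sum is empty if the sizes differ.\<close>

definition minor :: "bool \<Rightarrow> (nat \<Rightarrow> nat \<Rightarrow> 'a::comm_ring_1) \<Rightarrow> nat set \<Rightarrow> nat set \<Rightarrow> 'a" where
  "minor b M X Y = (\<Sum>f\<in>bijs X Y. inv_sign b X f * (\<Prod>i\<in>X. M i (f i)))"

text \<open>For disjoint I and J: the number of inversions created by listing I in front of J, the
  exponent in the sign of a Laplace expansion.\<close>

definition inv_count :: "nat set \<Rightarrow> nat set \<Rightarrow> nat" where
  "inv_count I J = (\<Sum>i\<in>I. card {j\<in>J. j < i})"

definition split_sign :: "bool \<Rightarrow> nat set \<Rightarrow> nat set \<Rightarrow> 'a::comm_ring_1" where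
  "split_sign b I J = (if b then (- 1) ^ inv_count I J else 1)"

lemma finite_bijs: assumes "finite X" "finite Y" shows "finite (bijs X Y)"
proof (rule finite_subset)
  show "bijs X Y \<subseteq> (\<lambda>f x. if x \<in> X then f x else x) ` (X \<rightarrow>\<^sub>E Y)"
  proof
    fix f assume f: "f \<in> bijs X Y"
    have "f = (\<lambda>x. if x \<in> X then restrict f X x else x)"
      using f by (auto simp: bijs_def)
    moreover have "restrict f X \<in> X \<rightarrow>\<^sub>E Y"
      using f by (auto simp: bijs_def bij_betw_def)
    ultimately show "f \<in> (\<lambda>f x. if x \<in> X then f x else x) ` (X \<rightarrow>\<^sub>E Y)" by blast
  qed
qed (use assms in \<open>simp add: finite_PiE\<close>)

lemma bijs_same: "bijs V V = {\<sigma>. \<sigma> permutes V}"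
  by (auto simp: bijs_def permutes_imp_bij permutes_not_in intro: bij_imp_permutes)

text \<open>A bijection from I to J and one between the complements glue to a bijection that carries
  I onto J, and restriction undoes this. The locality assumptions allow both weights to be evaluated
  at the glued map.\<close>

lemma sum_bijs_split:
  fixes u w :: "(nat \<Rightarrow> nat) \<Rightarrow> 'a::comm_ring_1"
  assumes fin: "finite X" "finite Y" and sub: "I \<subseteq> X" "J \<subseteq> Y"
    and u: "\<And>f g. (\<And>i. i \<in> I \<Longrightarrow> f i = g i) \<Longrightarrow> u f = u g"
    and w: "\<And>f g. (\<And>i. i \<in> X - I \<Longrightarrow> f i = g i) \<Longrightarrow> w f = w g"
  shows "(\<Sum>f\<in>bijs I J. u f) * (\<Sum>g\<in>bijs (X - I) (Y - J). w g)
       = (\<Sum>h | h \<in> bijs X Y \<and> h ` I = J. u h * w h)"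
proof -
  define glue where "glue = (\<lambda>(f, g) x. if x \<in> I then f x else g x :: nat)"
  define cut where "cut = (\<lambda>h. (\<lambda>x. if x \<in> I then h x else x :: nat, \<lambda>x. if x \<in> X - I then h x else x))"
  have "(\<Sum>f\<in>bijs I J. u f) * (\<Sum>g\<in>bijs (X - I) (Y - J). w g)
      = (\<Sum>(f, g)\<in>bijs I J \<times> bijs (X - I) (Y - J). u f * w g)"
    by (simp add: sum_product sum.cartesian_product)
  also have "\<dots> = (\<Sum>h | h \<in> bijs X Y \<and> h ` I = J. u h * w h)"
  proof (rule sum.reindex_bij_witness[of _ cut glue])
    fix p assume p: "p \<in> bijs I J \<times> bijs (X - I) (Y - J)"
    obtain f g where fg: "p = (f, g)" "f \<in> bijs I J" "g \<in> bijs (X - I) (Y - J)" using p by auto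
    have "bij_betw (glue p) I J" "bij_betw (glue p) (X - I) (Y - J)"
      using fg bij_betw_cong[of I f "glue p"] bij_betw_cong[of "X - I" g "glue p"]
      by (simp_all add: glue_def bijs_def)
    then have "bij_betw (glue p) (I \<union> (X - I)) (J \<union> (Y - J))" "glue p ` I = J"
      by (intro bij_betw_combine, auto simp: bij_betw_def)
    then show "glue p \<in> {h. h \<in> bijs X Y \<and> h ` I = J}"
      using fg sub by (auto simp: bijs_def glue_def Un_absorb1)
    show "cut (glue p) = p"
      using fg by (auto simp: cut_def glue_def bijs_def fun_eq_iff)
    have "u (glue p) = u f" by (rule u) (simp add: glue_def fg)
    moreover have "w (glue p) = w g" by (rule w) (simp add: glue_def fg)
    ultimately show "u (glue p) * w (glue p) = (case p of (f, g) \<Rightarrow> u f * w g)"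
      by (simp add: fg)
  next
    fix h assume h: "h \<in> {h. h \<in> bijs X Y \<and> h ` I = J}"
    then have b: "bij_betw h X Y" "h ` I = J" by (auto simp: bijs_def)
    show "glue (cut h) = h"
      using h sub by (auto simp: cut_def glue_def bijs_def fun_eq_iff)
    have 1: "bij_betw h I J" using b sub by (auto simp: bij_betw_def inj_on_subset)
    have 2: "bij_betw h (X - I) (Y - J)"
      using b sub by (metis bij_betw_DiffI 1)
    show "cut h \<in> bijs I J \<times> bijs (X - I) (Y - J)"
      using 1 2 bij_betw_cong[of I h "fst (cut h)"] bij_betw_cong[of "X - I" h "snd (cut h)"]
      by (auto simp: bijs_def cut_def)
  qed
  finally show ?thesis .
qed


lemma pair_sign_doubleton:
  assumes "i \<noteq> j" "f i \<noteq> f j"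
  shows "pair_sign f {i, j} = (if (i < j) = (f i < f j) then 1 else - 1)"
  using assms by (auto simp: pair_sign_def min_def max_def)

lemma prod_sign_eq_power:
  assumes "finite J"
  shows "(\<Prod>j\<in>J. if P j then - 1 else 1 :: 'a::comm_ring_1) = (- 1) ^ card {j\<in>J. P j}"
  using assms by (simp flip: prod.inter_filter)

lemma inv_count_image:
  assumes "inj_on f (I \<union> J)" "finite I" "finite J"
  shows "inv_count (f ` I) (f ` J) = (\<Sum>i\<in>I. card {j\<in>J. f j < f i})"
proof -
  have "inj_on f I" "inj_on f J" using assms by (auto simp: inj_on_Un)
  have "card {j \<in> f ` J. j < f i} = card {j\<in>J. f j < f i}" for i
  proof -
    have "{j \<in> f ` J. j < f i} = f ` {j\<in>J. f j < f i}" by auto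
    then show ?thesis
      using \<open>inj_on f J\<close> by (metis (no_types, lifting) card_image inj_on_subset mem_Collect_eq subsetI)
  qed
  then show ?thesis
    unfolding inv_count_def by (simp add: sum.reindex[OF \<open>inj_on f I\<close>])
qed

text \<open>Pairs inside I and inside X - I give the first two factors. For i in I and j outside, f
  reverses the pair iff exactly one of j < i and f j < f i holds, so the crossing pairs contribute
  one inversion count before f and one after it.\<close>

lemma inv_sign_split:
  assumes fin: "finite X" and I: "I \<subseteq> X" and inj: "inj_on f X"
  shows "inv_sign b X f = inv_sign b I f * inv_sign b (X - I) f *
    (split_sign b I (X - I) * split_sign b (f ` I) (f ` (X - I)) :: 'a::comm_ring_1)"
proof (cases b)
  case True
  define I' where "I' = X - I"
  define pairs :: "nat set \<Rightarrow> nat set set" where "pairs = (\<lambda>X. {e. e \<subseteq> X \<and> card e = 2})"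
  define cross where "cross = (\<lambda>(i, j). {i, j}) ` (I \<times> I')"
  have finI: "finite I" "finite I'" using fin I by (auto simp: I'_def intro: finite_subset)
  have fin_pairs: "finite (pairs A)" if "finite A" for A using that by (simp add: pairs_def)
  have XI: "X = I \<union> I'" "I \<inter> I' = {}" using I by (auto simp: I'_def)
  have split: "pairs X = (pairs I \<union> pairs I') \<union> cross"
  proof (intro equalityI subsetI)
    fix e assume "e \<in> pairs X"
    then obtain i j where "e = {i, j}" "i \<noteq> j" "i \<in> X" "j \<in> X"
      by (auto simp: pairs_def card_2_iff)
    then show "e \<in> (pairs I \<union> pairs I') \<union> cross"
      unfolding XI cross_def pairs_def by (fastforce simp: insert_commute)
  next
    fix e assume "e \<in> (pairs I \<union> pairs I') \<union> cross"
    then show "e \<in> pairs X"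
      using XI by (auto simp: pairs_def cross_def card_insert_if)
  qed
  have disj: "pairs I \<inter> pairs I' = {}" "(pairs I \<union> pairs I') \<inter> cross = {}"
    using XI by (auto simp: pairs_def cross_def card_2_iff)
  have inj_cross: "inj_on (\<lambda>(i, j). {i, j}) (I \<times> I')"
    using XI by (auto simp: inj_on_def doubleton_eq_iff)
  have sgn: "pair_sign f {i, j} = (if j < i then - 1 else 1) * (if f j < f i then - 1 else 1 :: 'a)"
    if "i \<in> I" "j \<in> I'" for i j
  proof -
    have "i \<noteq> j" "f i \<noteq> f j" using that XI inj by (auto simp: inj_on_def)
    then show ?thesis by (auto simp: pair_sign_doubleton)
  qed
  have "(\<Prod>e\<in>cross. pair_sign f e :: 'a) = (\<Prod>i\<in>I. \<Prod>j\<in>I'. pair_sign f {i, j})"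
    unfolding cross_def
    by (subst prod.reindex[OF inj_cross]) (simp add: prod.cartesian_product case_prod_unfold comp_def)
  also have "\<dots> = (\<Prod>i\<in>I. \<Prod>j\<in>I'. (if j < i then - 1 else 1) * (if f j < f i then - 1 else 1))"
    by (intro prod.cong refl sgn)
  also have "\<dots> = split_sign b I I' * split_sign b (f ` I) (f ` I')"
  proof -
    have "inv_count (f ` I) (f ` I') = (\<Sum>i\<in>I. card {j\<in>I'. f j < f i})"
      using inj finI XI(1) by (intro inv_count_image) auto
    then show ?thesis
      using True by (simp only: split_sign_def if_True inv_count_def[of I] power_sum prod.distrib
        prod_sign_eq_power[OF finI(2)])
  qed
  finally have cross: "(\<Prod>e\<in>cross. pair_sign f e :: 'a) = split_sign b I I' * split_sign b (f ` I) (f ` I')" .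
  have "inv_sign b X f = (\<Prod>e\<in>pairs X. pair_sign f e :: 'a)"
    using True by (simp add: inv_sign_def pairs_def)
  also have "\<dots> = inv_sign b I f * inv_sign b I' f * (\<Prod>e\<in>cross. pair_sign f e)"
    using True finI fin_pairs disj unfolding split
    by (subst prod.union_disjoint, simp, simp add: cross_def, simp, subst prod.union_disjoint)
      (auto simp: inv_sign_def pairs_def)
  finally show ?thesis by (simp add: cross I'_def)
next
  case False
  then show ?thesis by (simp only: inv_sign_def split_sign_def) simp
qed

lemma inv_sign_cong:
  assumes "\<And>i. i \<in> X \<Longrightarrow> f i = g i"
  shows "inv_sign b X f = inv_sign b X g"
proof -
  have "pair_sign f e = pair_sign g e" if e: "e \<subseteq> X" "card e = 2" for e
  proof -
    have "finite e" "e \<noteq> {}" using e(2) by (auto intro: card_ge_0_finite)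
    then have "Min e \<in> X" "Max e \<in> X" using e(1) Min_in Max_in by blast+
    then show ?thesis by (simp add: pair_sign_def assms)
  qed
  then show ?thesis unfolding inv_sign_def by (auto intro!: prod.cong)
qed

lemma split_sign_square: "split_sign b I J * split_sign b I J = (1 :: 'a::comm_ring_1)"
  by (simp add: split_sign_def flip: power_mult_distrib)

section \<open>Products of minors and Laplace expansion\<close>

lemma minor_cong:
  assumes "\<And>i j. i \<in> X \<Longrightarrow> j \<in> Y \<Longrightarrow> M i j = N i j"
  shows "minor b M X Y = minor b N X Y"
  unfolding minor_def using assms
  by (intro sum.cong refl arg_cong2[where f = "(*)"] prod.cong) (auto simp: bijs_def bij_betw_def)

text \<open>The two flags are independent because the formula for Hamiltonian cycles multiplies a
  determinant by a permanent.\<close>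

theorem minor_mult_eq_sum:
  fixes M :: "nat \<Rightarrow> nat \<Rightarrow> 'a::comm_ring_1"
  assumes fin: "finite X" "finite Y" and sub: "I \<subseteq> X" "J \<subseteq> Y"
  shows "minor b M I J * minor c M (X - I) (Y - J) =
    (\<Sum>f | f \<in> bijs X Y \<and> f ` I = J. inv_sign b I f * inv_sign c (X - I) f * (\<Prod>i\<in>X. M i (f i)))"
proof -
  have "minor b M I J * minor c M (X - I) (Y - J) =
    (\<Sum>f | f \<in> bijs X Y \<and> f ` I = J. (inv_sign b I f * (\<Prod>i\<in>I. M i (f i))) *
      (inv_sign c (X - I) f * (\<Prod>i\<in>X - I. M i (f i))))"
    unfolding minor_def by (rule sum_bijs_split[OF fin sub])
      (auto intro!: arg_cong2[where f = "(*)"] inv_sign_cong)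
  then show ?thesis
    using fin sub by (simp add: prod.subset_diff[of I X] mult_ac)
qed

text \<open>The bijections are grouped by the image J of the fixed row set I; within a group X - I
  maps onto Y - J, and \<open>inv_sign_split\<close> factors the sign.\<close>

theorem minor_laplace:
  fixes M :: "nat \<Rightarrow> nat \<Rightarrow> 'a::comm_ring_1"
  assumes fin: "finite X" "finite Y" and I: "I \<subseteq> X"
  shows "minor b M X Y = (\<Sum>J\<in>Pow Y. split_sign b I (X - I) * split_sign b J (Y - J) *
    (minor b M I J * minor b M (X - I) (Y - J)))"
proof -
  have "minor b M X Y = (\<Sum>J\<in>Pow Y. \<Sum>f | f \<in> bijs X Y \<and> f ` I = J. inv_sign b X f * (\<Prod>i\<in>X. M i (f i)))"
    unfolding minor_def using fin I
    by (intro sum.group[symmetric] finite_bijs) (auto simp: bijs_def bij_betw_def)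
  also have "\<dots> = (\<Sum>J\<in>Pow Y. split_sign b I (X - I) * split_sign b J (Y - J) *
    (minor b M I J * minor b M (X - I) (Y - J)))"
  proof (intro sum.cong refl)
    fix J assume J: "J \<in> Pow Y"
    have "inv_sign b X f = split_sign b I (X - I) * split_sign b J (Y - J) *
        (inv_sign b I f * inv_sign b (X - I) f :: 'a)"
      if "f \<in> bijs X Y" "f ` I = J" for f
    proof -
      have "inj_on f X" "f ` X = Y" using that by (auto simp: bijs_def bij_betw_def)
      moreover have "f ` (X - I) = Y - J"
        using calculation I that(2) inj_on_image_set_diff[of f X X I] by auto
      ultimately show ?thesis
        using inv_sign_split[OF fin(1) I, of f b] that by (simp add: mult_ac)
    qed
    then show "(\<Sum>f | f \<in> bijs X Y \<and> f ` I = J. inv_sign b X f * (\<Prod>i\<in>X. M i (f i))) =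
      split_sign b I (X - I) * split_sign b J (Y - J) * (minor b M I J * minor b M (X - I) (Y - J))"
      using J by (subst minor_mult_eq_sum[OF fin I]) (auto simp: sum_distrib_left mult.assoc intro!: sum.cong)
  qed
  finally show ?thesis .
qed

lemma minor_eq_0:
  assumes "finite X" "finite Y" "card X \<noteq> card Y"
  shows "minor b M X Y = 0"
  using assms by (auto simp: minor_def bijs_def dest!: bij_betw_same_card intro!: sum.neutral)

lemma minor_empty [simp]: "minor b M {} {} = 1"
proof -
  have "bijs {} {} = {id}" by (auto simp: bijs_def)
  moreover have "{e :: nat set. e = {} \<and> card e = 2} = {}" by auto
  ultimately show ?thesis by (simp only: minor_def inv_sign_def subset_empty) simp
qed

lemma minor_singleton [simp]: "minor b M {i} {j} = M i j"
proof -
  have "bijs {i} {j} = {\<lambda>x. if x = i then j else x}"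
    by (auto simp: bijs_def bij_betw_def)
  moreover have "{e. e \<subseteq> {i} \<and> card e = 2} = {}"
    by (auto simp: subset_singleton_iff)
  ultimately show ?thesis by (simp only: minor_def inv_sign_def) simp
qed

text \<open>Taking the least row makes the row sign trivial, so that only the position of the column
  counts. This is the recursion that the generated programs evaluate.\<close>

lemma minor_row_expansion:
  fixes M :: "nat \<Rightarrow> nat \<Rightarrow> 'a::comm_ring_1"
  assumes fin: "finite X" "finite Y" and m: "m \<in> X" "\<forall>x\<in>X. m \<le> x"
  shows "minor b M X Y = (\<Sum>j\<in>Y. (if b then (- 1) ^ card {y\<in>Y. y < j} else 1) *
    (M m j * minor b M (X - {m}) (Y - {j})))"
proof -
  have "{j \<in> X - {m}. j < m} = {}" using m by auto
  then have 0: "inv_count {m} (X - {m}) = 0" by (simp only: inv_count_def) simp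
  have "minor b M X Y = (\<Sum>J\<in>(\<lambda>j. {j}) ` Y. split_sign b {m} (X - {m}) * split_sign b J (Y - J) *
    (minor b M {m} J * minor b M (X - {m}) (Y - J)))"
    unfolding minor_laplace[OF fin, of "{m}", simplified, OF m(1)]
  \<comment> \<open>Column sets that are not singletons drop out, since a minor with one row and
    another number of columns is 0.\<close>
  proof (rule sum.mono_neutral_right)
    show "\<forall>J\<in>Pow Y - (\<lambda>j. {j}) ` Y. split_sign b {m} (X - {m}) * split_sign b J (Y - J) *
      (minor b M {m} J * minor b M (X - {m}) (Y - J)) = 0"
    proof
      fix J assume J: "J \<in> Pow Y - (\<lambda>j. {j}) ` Y"
      then have "card J \<noteq> 1" by (auto simp: card_1_singleton_iff)
      then have "minor b M {m} J = 0"
        using J fin by (intro minor_eq_0) (auto intro: finite_subset)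
      then show "split_sign b {m} (X - {m}) * split_sign b J (Y - J) *
        (minor b M {m} J * minor b M (X - {m}) (Y - J)) = 0" by simp
    qed
  qed (use fin in auto)
  also have "\<dots> = (\<Sum>j\<in>Y. split_sign b {m} (X - {m}) * split_sign b {j} (Y - {j}) *
    (M m j * minor b M (X - {m}) (Y - {j})))"
    by (subst sum.reindex) (auto simp: inj_on_def)
  also have "\<dots> = (\<Sum>j\<in>Y. (if b then (- 1) ^ card {y\<in>Y. y < j} else 1) *
    (M m j * minor b M (X - {m}) (Y - {j})))"
  proof (intro sum.cong refl)
    fix j
    have "{y \<in> Y - {j}. y < j} = {y\<in>Y. y < j}" by auto
    then have "inv_count {j} (Y - {j}) = card {y\<in>Y. y < j}" by (simp only: inv_count_def) simp
    then show "split_sign b {m} (X - {m}) * split_sign b {j} (Y - {j}) *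
      (M m j * minor b M (X - {m}) (Y - {j})) = (if b then (- 1) ^ card {y\<in>Y. y < j} else 1) *
      (M m j * minor b M (X - {m}) (Y - {j}))"
      by (simp add: split_sign_def 0)
  qed
  finally show ?thesis .
qed

text \<open>Multilinearity in the rows: every row chooses one of the two matrices, and I collects
  the rows that choose N.\<close>

lemma minor_add:
  fixes M N :: "nat \<Rightarrow> nat \<Rightarrow> 'a::comm_ring_1"
  assumes fin: "finite X"
  shows "minor b (\<lambda>i j. M i j + N i j) X Y = (\<Sum>I\<in>Pow X. minor b (\<lambda>i. if i \<in> I then N i else M i) X Y)"
proof -
  have "(\<Prod>i\<in>X. M i (f i) + N i (f i)) = (\<Sum>I\<in>Pow X. \<Prod>i\<in>X. (if i \<in> I then N i else M i) (f i))" for f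
  proof -
    have "(\<Prod>i\<in>X. M i (f i) + N i (f i)) = (\<Prod>i\<in>X. N i (f i) + M i (f i))" by (simp add: add.commute)
    also have "\<dots> = (\<Sum>I\<in>Pow X. (\<Prod>i\<in>I. N i (f i)) * (\<Prod>i\<in>X - I. M i (f i)))"
      by (rule prod_add[OF fin])
    also have "\<dots> = (\<Sum>I\<in>Pow X. \<Prod>i\<in>X. (if i \<in> I then N i else M i) (f i))"
    proof (intro sum.cong refl)
      fix I assume "I \<in> Pow X"
      then have "(\<Prod>i\<in>X. (if i \<in> I then N i else M i) (f i)) =
          (\<Prod>i\<in>X - I. (if i \<in> I then N i else M i) (f i)) * (\<Prod>i\<in>I. (if i \<in> I then N i else M i) (f i))"
        using fin by (intro prod.subset_diff) auto
      then show "(\<Prod>i\<in>I. N i (f i)) * (\<Prod>i\<in>X - I. M i (f i)) = (\<Prod>i\<in>X. (if i \<in> I then N i else M i) (f i))"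
        by (simp add: mult.commute)
    qed
    finally show ?thesis .
  qed
  then show ?thesis
    unfolding minor_def by (simp add: sum_distrib_left) (rule sum.swap)
qed

text \<open>With d = t this is the source of the truncation: many rows from B force a high power of
  t.\<close>

lemma minor_dvd:
  assumes "\<And>i j. i \<in> X \<Longrightarrow> j \<in> Y \<Longrightarrow> d dvd M i j"
  shows "d ^ card X dvd minor b M X Y"
  unfolding minor_def
proof (intro dvd_sum dvd_mult)
  fix f assume "f \<in> bijs X Y"
  then have "(\<Prod>i\<in>X. d) dvd (\<Prod>i\<in>X. M i (f i))"
    using assms by (intro prod_dvd_prod) (auto simp: bijs_def bij_betw_def)
  then show "d ^ card X dvd (\<Prod>i\<in>X. M i (f i))" by simp
qed

text \<open>Lets A enter identities over the polynomial ring as a constant matrix while its minors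
  remain field elements that can be tabulated.\<close>

lemma minor_const_poly: "minor b (\<lambda>i j. [:M i j:]) X Y = [:minor b M X Y :: 'a::comm_ring_1:]"
proof -
  have "pair_sign f e = [:pair_sign f e :: 'a:]" for f e
    unfolding pair_sign_def by (cases "f (Min e) < f (Max e)") (simp_all only: if_True if_False one_pCons minus_pCons minus_zero)
  then have "(\<Prod>e\<in>E. pair_sign f e) = [:\<Prod>e\<in>E. pair_sign f e :: 'a:]" for f E
    by (metis (no_types, lifting) prod.cong prod_to_poly)
  then have "inv_sign b X f = [:inv_sign b X f :: 'a:]" for f
    unfolding inv_sign_def by (cases b) (simp_all only: if_True if_False flip: one_pCons)
  then have "inv_sign b X f * (\<Prod>i\<in>X. [:M i (f i):]) = [:inv_sign b X f * (\<Prod>i\<in>X. M i (f i)):]" for f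
    by (simp only: prod_to_poly mult_pCons_left) simp
  then show ?thesis by (simp only: minor_def sum_to_poly)
qed

section \<open>Hamiltonian cycles as products of determinants and permanents\<close>

text \<open>The map g carries the pairs of X bijectively to those of its image, and on each pair the
  reversals by g and by f multiply.\<close>

lemma inv_sign_comp:
  assumes g: "inj_on g X" and f: "inj_on f (g ` X)"
  shows "inv_sign b X (f \<circ> g) = inv_sign b (g ` X) f * (inv_sign b X g :: 'a::comm_ring_1)"
proof (cases b)
  case True
  define pairs :: "nat set \<Rightarrow> nat set set" where "pairs = (\<lambda>X. {e. e \<subseteq> X \<and> card e = 2})"
  have "bij_betw ((`) g) (pairs X) (pairs (g ` X))"
  proof (rule bij_betw_imageI)
    show "inj_on ((`) g) (pairs X)"
      using g by (auto simp: pairs_def inj_on_def inj_on_image_eq_iff)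
    show "(`) g ` pairs X = pairs (g ` X)"
    proof (intro equalityI subsetI)
      fix e assume "e \<in> pairs (g ` X)"
      then obtain e' where "e' \<subseteq> X" "e = g ` e'" "card e = 2" by (auto simp: pairs_def subset_image_iff)
      then show "e \<in> (`) g ` pairs X"
        using g by (auto simp: pairs_def card_image inj_on_subset)
    qed (use g in \<open>auto simp: pairs_def card_image inj_on_subset\<close>)
  qed
  then have re: "(\<Prod>e\<in>pairs X. pair_sign f (g ` e)) = (\<Prod>e\<in>pairs (g ` X). pair_sign f e :: 'a)"
    by (rule prod.reindex_bij_betw)
  have "pair_sign (f \<circ> g) e = pair_sign f (g ` e) * (pair_sign g e :: 'a)" if e: "e \<in> pairs X" for e
  proof -
    obtain i j where ij: "e = {i, j}" "i \<noteq> j"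
      using e by (auto simp: pairs_def card_2_iff)
    moreover have "i \<in> X" "j \<in> X" using e ij by (auto simp: pairs_def)
    ultimately have "g i \<noteq> g j" "f (g i) \<noteq> f (g j)" using g f by (auto simp: inj_on_def)
    then show ?thesis using ij by (auto simp: pair_sign_doubleton)
  qed
  then have "(\<Prod>e\<in>pairs X. pair_sign (f \<circ> g) e :: 'a) = (\<Prod>e\<in>pairs X. pair_sign f (g ` e)) * (\<Prod>e\<in>pairs X. pair_sign g e)"
    by (simp flip: prod.distrib)
  then show ?thesis using True re by (simp add: inv_sign_def pairs_def)
next
  case False
  then show ?thesis by (simp only: inv_sign_def) simp
qed

lemma inv_sign_id: "inv_sign b X id = 1"
proof -
  have "pair_sign id e = 1" if "card e = 2" for e
    using that by (auto simp: card_2_iff pair_sign_doubleton)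
  then show ?thesis unfolding inv_sign_def by (auto intro!: prod.neutral)
qed

lemma inv_sign_invariant_split:
  assumes "finite X" "I \<subseteq> X" "inj_on f X" "f ` I = I" "f ` (X - I) = X - I"
  shows "inv_sign b X f = inv_sign b I f * (inv_sign b (X - I) f :: 'a::comm_ring_1)"
  using inv_sign_split[OF assms(1-3), of b, where 'a = 'a] assms(4,5) by (simp add: split_sign_square)

text \<open>The set {i, j} is invariant, so its crossing signs cancel; outside it the transposition
  is the identity, and only the pair {i, j} counts.\<close>

lemma inv_sign_transpose:
  assumes "finite V" "i \<in> V" "j \<in> V" "i \<noteq> j"
  shows "inv_sign True V (transpose i j) = (- 1 :: 'a::comm_ring_1)"
proof -
  have "inv_sign True V (transpose i j) = inv_sign True {i, j} (transpose i j) *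
      (inv_sign True (V - {i, j}) (transpose i j) :: 'a)"
    using assms by (intro inv_sign_invariant_split) (auto simp: transpose_def image_iff inj_on_def)
  also have "inv_sign True (V - {i, j}) (transpose i j) = (inv_sign True (V - {i, j}) id :: 'a)"
    by (intro inv_sign_cong) (auto simp: transpose_def)
  also have "{e. e \<subseteq> {i, j} \<and> card e = 2} = {{i, j}}"
    using assms by (auto simp: card_2_iff)
  then have "inv_sign True {i, j} (transpose i j) = (- 1 :: 'a)"
    using assms by (simp only: inv_sign_def) (auto simp: pair_sign_doubleton)
  finally show ?thesis by (simp only: inv_sign_id) simp
qed

text \<open>Each induction step peels off one transposition. The ambient V may exceed the cycle
  because it stays fixed while the cycle shrinks.\<close>

lemma inv_sign_cycle:
  assumes "distinct cs" "set cs \<subseteq> V" "finite V"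
  shows "inv_sign True V (cycle_of_list cs) = ((- 1) ^ (length cs - 1) :: 'a::comm_ring_1)"
  using assms
proof (induction cs rule: cycle_of_list.induct)
  case (1 i j cs)
  define \<rho> where "\<rho> = cycle_of_list (j # cs)"
  have "\<rho> permutes V"
    unfolding \<rho>_def using cycle_permutes[of "j # cs"] 1 by (meson permutes_subset set_subset_Cons subset_trans)
  then have "inj_on \<rho> V" "\<rho> ` V = V" by (simp_all add: permutes_inj_on permutes_image)
  then have "inv_sign True V (transpose i j \<circ> \<rho>) = inv_sign True V (transpose i j) * (inv_sign True V \<rho> :: 'a)"
    using inj_on_subset[OF inj_transpose[of i j] subset_UNIV, of V]
    by (subst inv_sign_comp) simp_all
  moreover have "inv_sign True V \<rho> = ((- 1) ^ length cs :: 'a)" using 1 by (simp add: \<rho>_def)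
  moreover have "inv_sign True V (transpose i j) = (- 1 :: 'a)" using 1 by (intro inv_sign_transpose) auto
  ultimately have "inv_sign True V (transpose i j \<circ> \<rho>) = ((- 1) ^ Suc (length cs) :: 'a)" by simp
  then show ?case by (simp only: cycle_of_list.simps \<rho>_def) simp
qed (simp_all add: inv_sign_id)

text \<open>A cycle of length n has sign (-1)^(n-1), so together with (-1)^n every cycle weighs -1,
  whatever its length. This is the purpose of the factor (-1)^|S| in the Hamiltonian
  formula.\<close>

lemma inv_sign_orbit:
  assumes \<sigma>: "\<sigma> permutes V" "finite V" and v: "v \<in> V"
  shows "(- 1) ^ card (orbit \<sigma> v) * inv_sign True (orbit \<sigma> v) \<sigma> = (- 1 :: 'a::comm_ring_1)"
proof -
  have perm: "permutation \<sigma>" using \<sigma> permutation_permutes by blast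
  have C: "orbit \<sigma> v = set (support \<sigma> v)"
    by (simp only: support_set[OF perm] orbit_altdef_permutation[OF perm]) auto
  have dist: "distinct (support \<sigma> v)" by (rule cycle_of_permutation[OF perm])
  have "inv_sign True (orbit \<sigma> v) \<sigma> = (inv_sign True (orbit \<sigma> v) (cycle_of_list (support \<sigma> v)) :: 'a)"
    by (rule inv_sign_cong) (use C cycle_restrict[OF perm] in metis)
  also have "\<dots> = (- 1) ^ (length (support \<sigma> v) - 1)"
    by (rule inv_sign_cycle[OF dist]) (simp_all only: C order_refl finite_set)
  also have "length (support \<sigma> v) = card (orbit \<sigma> v)"
    by (simp only: C distinct_card[OF dist])
  finally have *: "inv_sign True (orbit \<sigma> v) \<sigma> = ((- 1) ^ (card (orbit \<sigma> v) - 1) :: 'a)" .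
  have "card (orbit \<sigma> v) > 0"
    by (metis C card_gt_0_iff finite_set orbit_nonempty)
  then obtain n where "card (orbit \<sigma> v) = Suc n" by (auto simp: gr0_conv_Suc)
  then show ?thesis by (simp add: * flip: power_mult_distrib)
qed

lemma orbit_subset_invariant:
  assumes "f ` S = S" "x \<in> S" shows "orbit f x \<subseteq> S"
proof
  fix y assume "y \<in> orbit f x" then show "y \<in> S"
    by induction (use assms in auto)
qed

text \<open>By \<open>inv_sign_orbit\<close> an invariant S weighs (-1) to the number of cycles in
  S. Apart from the cycle of 0 these can be chosen freely, so the sum alternates over all subsets of
  the other cycles and vanishes as soon as there is one.\<close>

theorem sum_invariant_sets:
  assumes \<sigma>: "\<sigma> permutes {..<k}" and k: "0 < k"
  shows "(\<Sum>S | S \<subseteq> {..<k} \<and> 0 \<in> S \<and> \<sigma> ` S = S. (- 1) ^ card S * inv_sign True S \<sigma>) =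
    (if cycle_count k \<sigma> = 1 then - 1 else 0 :: 'a::comm_ring_1)"
proof -
  let ?V = "{..<k}"
  let ?w = "\<lambda>S. (- 1) ^ card S * inv_sign True S \<sigma> :: 'a"
  have perm: "permutation \<sigma>" using \<sigma> permutation_permutes by blast
  have self: "x \<in> orbit \<sigma> x" for x by (rule permutation_self_in_orbit[OF perm])
  have orbit_V: "orbit \<sigma> v \<subseteq> ?V" if "v \<in> ?V" for v
    by (rule orbit_subset_invariant) (use \<sigma> that in \<open>auto simp: permutes_image\<close>)
  have img: "\<sigma> ` orbit \<sigma> v = orbit \<sigma> v" for v
    using self[of v] by (auto intro: orbit.intros elim: orbit.cases)
  have orbit_eq: "orbit \<sigma> x = orbit \<sigma> v" if "x \<in> orbit \<sigma> v" for x v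
    using that perm by (metis cyclic_on_orbit' orbit_cyclic_eq3)
  have inj: "inj_on \<sigma> A" for A using \<sigma> by (meson inj_on_subset permutes_inj subset_UNIV)
  show ?thesis
  proof (cases "cycle_count k \<sigma> = 1")
    case True
    then obtain C where C: "orbit \<sigma> ` ?V = {C}" by (auto simp: cycle_count_def card_1_singleton_iff)
    have C0: "orbit \<sigma> 0 = ?V"
    proof
      show "?V \<subseteq> orbit \<sigma> 0"
      proof
        fix v assume v: "v \<in> ?V"
        then have "orbit \<sigma> v = orbit \<sigma> 0" using C k by blast
        then show "v \<in> orbit \<sigma> 0" using self by blast
      qed
    qed (use orbit_V k in simp)
    have "{S. S \<subseteq> ?V \<and> 0 \<in> S \<and> \<sigma> ` S = S} = {?V}"
    proof -
      have "S = ?V" if "S \<subseteq> ?V" "0 \<in> S" "\<sigma> ` S = S" for S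
        using orbit_subset_invariant[OF that(3,2)] that(1) C0 by simp
      moreover have "\<sigma> ` ?V = ?V" "0 \<in> ?V" using \<sigma> k by (simp_all add: permutes_image)
      ultimately show ?thesis by blast
    qed
    then show ?thesis using True inv_sign_orbit[OF \<sigma>, of 0, where 'a = 'a] k unfolding C0 by simp
  next
    case False
    obtain v where v: "v \<in> ?V" "orbit \<sigma> v \<noteq> orbit \<sigma> 0"
    proof (rule ccontr)
      assume "\<not> thesis"
      then have "orbit \<sigma> ` ?V = {orbit \<sigma> 0}" using that k by auto
      then show False using False by (simp add: cycle_count_def)
    qed
    define C where "C = orbit \<sigma> v"
    have CV: "C \<subseteq> ?V" unfolding C_def by (rule orbit_V[OF v(1)])
    moreover have "\<sigma> ` C = C" by (simp only: C_def img)
    moreover have "0 \<notin> C" using v(2) orbit_eq[of 0 v] by (auto simp: C_def)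
    moreover have "finite C" using finite_subset[OF CV] by simp
    ultimately have C: "C \<subseteq> ?V" "\<sigma> ` C = C" "0 \<notin> C" "finite C" by blast+
    let ?I = "{S. S \<subseteq> ?V \<and> 0 \<in> S \<and> \<sigma> ` S = S}"
    have fin: "finite ?I" by (rule finite_subset[of _ "Pow ?V"]) auto
    \<comment> \<open>An invariant set contains an orbit or misses it; therefore adjoining C and
      removing C are inverse to each other.\<close>
    have dich: "C \<subseteq> S \<or> S \<inter> C = {}" if "S \<in> ?I" for S
    proof (cases "S \<inter> C = {}")
      case False
      then obtain x where x: "x \<in> S" "x \<in> C" by blast
      have "\<sigma> ` S = S" using that by simp
      then have "orbit \<sigma> x \<subseteq> S" using x(1) by (rule orbit_subset_invariant)
      then show ?thesis using orbit_eq[of x v] x(2) by (simp add: C_def)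
    qed simp
    have "sum ?w ?I = sum ?w {S\<in>?I. C \<subseteq> S} + sum ?w {S\<in>?I. \<not> C \<subseteq> S}"
      using fin by (subst sum.union_disjoint[symmetric]) (auto intro: sum.cong)
    also have "sum ?w {S\<in>?I. C \<subseteq> S} = sum (\<lambda>S. - ?w S) {S\<in>?I. \<not> C \<subseteq> S}"
    proof (rule sum.reindex_bij_witness[of _ "\<lambda>S. S \<union> C" "\<lambda>S. S - C"])
      fix S assume S: "S \<in> {S\<in>?I. C \<subseteq> S}"
      have diff: "\<sigma> ` (S - C) = S - C" using S C(2) inj_on_image_set_diff[OF inj[of UNIV], of S C] by simp
      show "S - C \<union> C = S" using S by auto
      show "S - C \<in> {S\<in>?I. \<not> C \<subseteq> S}"
        using S C diff self[of v] by (auto simp: C_def)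
      have finS: "finite S" using S finite_subset by auto
      have "inv_sign True S \<sigma> = inv_sign True C \<sigma> * (inv_sign True (S - C) \<sigma> :: 'a)"
        by (rule inv_sign_invariant_split) (use S C diff inj finS in auto)
      moreover have "card S = card C + card (S - C)"
        using S C finS by (metis (no_types, lifting) card_Diff_subset card_mono le_add_diff_inverse mem_Collect_eq)
      ultimately have "?w S = ((- 1) ^ card C * inv_sign True C \<sigma>) * ?w (S - C)"
        by (simp add: power_add mult_ac)
      then show "- ?w (S - C) = ?w S"
        using inv_sign_orbit[OF \<sigma> _ v(1), where 'a = 'a] by (simp add: C_def)
    next
      fix S assume S: "S \<in> {S\<in>?I. \<not> C \<subseteq> S}"
      then have "S \<inter> C = {}" using dich by auto
      then show "S \<union> C - C = S" by auto
      show "S \<union> C \<in> {S\<in>?I. C \<subseteq> S}" using S C by (auto simp: image_Un)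
    qed
    finally show ?thesis using False by (simp add: sum_negf)
  qed
qed

text \<open>For fixed S the product expands over the permutations that map S to itself. After the
  two sums are exchanged, \<open>sum_invariant_sets\<close> evaluates the inner one.\<close>

theorem hc_eq_sum_minors:
  fixes M :: "'a::comm_ring_1 mat"
  assumes M: "M \<in> carrier_mat k k" and k: "0 < k"
  shows "hc M = - (\<Sum>S | S \<subseteq> {..<k} \<and> 0 \<in> S. (- 1) ^ card S *
    (minor True (\<lambda>i j. M $$ (i, j)) S S * minor False (\<lambda>i j. M $$ (i, j)) ({..<k} - S) ({..<k} - S)))"
proof -
  let ?V = "{..<k}" and ?M = "\<lambda>i j. M $$ (i, j)"
  have fin: "finite {\<sigma>. \<sigma> permutes ?V}" by (simp add: finite_permutations)
  have finS: "finite {S. S \<subseteq> ?V \<and> 0 \<in> S}" by (rule finite_subset[of _ "Pow ?V"]) auto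
  have "(\<Sum>S | S \<subseteq> ?V \<and> 0 \<in> S. (- 1) ^ card S * (minor True ?M S S * minor False ?M (?V - S) (?V - S)))
    = (\<Sum>S | S \<subseteq> ?V \<and> 0 \<in> S. \<Sum>\<sigma> | \<sigma> permutes ?V. if \<sigma> ` S = S then
        (- 1) ^ card S * inv_sign True S \<sigma> * (\<Prod>i<k. ?M i (\<sigma> i)) else 0)"
  proof (intro sum.cong refl)
    fix S assume S: "S \<in> {S. S \<subseteq> ?V \<and> 0 \<in> S}"
    have "minor True ?M S S * minor False ?M (?V - S) (?V - S) =
        (\<Sum>\<sigma> | \<sigma> \<in> bijs ?V ?V \<and> \<sigma> ` S = S. inv_sign True S \<sigma> * inv_sign False (?V - S) \<sigma> * (\<Prod>i<k. ?M i (\<sigma> i)))"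
      by (rule minor_mult_eq_sum) (use S in auto)
    then show "(- 1) ^ card S * (minor True ?M S S * minor False ?M (?V - S) (?V - S)) =
        (\<Sum>\<sigma> | \<sigma> permutes ?V. if \<sigma> ` S = S then (- 1) ^ card S * inv_sign True S \<sigma> * (\<Prod>i<k. ?M i (\<sigma> i)) else 0)"
      using fin by (simp add: bijs_same sum_distrib_left mult.assoc inv_sign_def[of False]
          flip: sum.inter_filter)
  qed
  also have "\<dots> = (\<Sum>\<sigma> | \<sigma> permutes ?V. \<Sum>S | S \<subseteq> ?V \<and> 0 \<in> S. if \<sigma> ` S = S then
        (- 1) ^ card S * inv_sign True S \<sigma> * (\<Prod>i<k. ?M i (\<sigma> i)) else 0)"
    by (rule sum.swap)
  also have "\<dots> = (\<Sum>\<sigma> | \<sigma> permutes ?V. (\<Sum>S | S \<subseteq> ?V \<and> 0 \<in> S \<and> \<sigma> ` S = S. (- 1) ^ card S * inv_sign True S \<sigma>) *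
      (\<Prod>i<k. ?M i (\<sigma> i)))"
    using finS by (simp add: sum_distrib_right conj_assoc flip: sum.inter_filter)
  also have "\<dots> = (\<Sum>\<sigma> | \<sigma> permutes ?V. if cycle_count k \<sigma> = 1 then - (\<Prod>i<k. ?M i (\<sigma> i)) else 0)"
    by (intro sum.cong refl) (simp add: sum_invariant_sets[OF _ k])
  also have "\<dots> = - hc M"
    using M fin by (simp add: hc_def sum_negf flip: sum.inter_filter)
  finally show ?thesis by simp
qed


section \<open>Expansion for a sum of two matrices\<close>

lemma minor_add_laplace:
  fixes M N :: "nat \<Rightarrow> nat \<Rightarrow> 'a::comm_ring_1"
  assumes fin: "finite X" "finite Y"
  shows "minor b (\<lambda>i j. M i j + N i j) X Y = (\<Sum>I\<in>Pow X. \<Sum>J\<in>Pow Y.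
    split_sign b I (X - I) * split_sign b J (Y - J) * (minor b N I J * minor b M (X - I) (Y - J)))"
  unfolding minor_add[OF fin(1)]
proof (intro sum.cong refl)
  fix I assume I: "I \<in> Pow X"
  let ?L = "\<lambda>i. if i \<in> I then N i else M i"
  have "minor b ?L I J = minor b N I J" "minor b ?L (X - I) J = minor b M (X - I) J" for J
    by (auto intro: minor_cong)
  then show "minor b ?L X Y = (\<Sum>J\<in>Pow Y. split_sign b I (X - I) * split_sign b J (Y - J) *
      (minor b N I J * minor b M (X - I) (Y - J)))"
    using I by (subst minor_laplace[OF fin, of I]) auto
qed

lemma sum_Pow_split:
  assumes "S \<subseteq> V"
  shows "(\<Sum>P\<in>Pow V. g (P \<inter> S) (P - S)) = (\<Sum>I\<in>Pow S. \<Sum>I'\<in>Pow (V - S). g I I')"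
  unfolding sum.cartesian_product
  by (rule sum.reindex_bij_witness[of _ "\<lambda>(I, I'). I \<union> I'" "\<lambda>P. (P \<inter> S, P - S)"])
    (use assms in \<open>auto simp: Un_Int_distrib2 intro!: arg_cong2[of _ _ _ _ g]\<close>)

text \<open>\<open>Suc\<close> is the minus sign in front of the Hamiltonian formula,
  \<open>card S\<close> its alternating factor, and the inversion counts are the row and column
  signs of the Laplace expansion of the determinant on S; the permanent adds no sign. An exponent is
  kept instead of a sign because its parity selects addition or subtraction in the generated
  program.\<close>

definition exchange_sign :: "nat set \<Rightarrow> nat set \<Rightarrow> nat set \<Rightarrow> nat" where
  "exchange_sign P Q S = Suc (card S) + inv_count (P \<inter> S) (S - P) + inv_count (Q \<inter> S) (S - Q)"

text \<open>Both factors are expanded by \<open>minor_add_laplace\<close>. The rows taken from B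
  inside and outside S are merged into P, the columns into Q. The sum over S is moved innermost: for
  fixed P and Q everything but the two minors of B depends on A alone.\<close>

theorem hc_add:
  fixes M :: "'a::comm_ring_1 mat"
  assumes M: "M \<in> carrier_mat k k" and k: "0 < k"
    and AB: "\<And>i j. i < k \<Longrightarrow> j < k \<Longrightarrow> M $$ (i, j) = A i j + B i j"
  shows "hc M = (\<Sum>P\<in>Pow {..<k}. \<Sum>Q\<in>Pow {..<k}. \<Sum>S | S \<subseteq> {..<k} \<and> 0 \<in> S.
    (minor True B (P \<inter> S) (Q \<inter> S) * minor False B (P - S) (Q - S)) *
    ((- 1) ^ exchange_sign P Q S *
      (minor True A (S - P) (S - Q) * minor False A ({..<k} - S - P) ({..<k} - S - Q))))"
    (is "_ = (\<Sum>P\<in>_. \<Sum>Q\<in>_. \<Sum>S\<in>_. ?t P Q S)")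
proof -
  let ?V = "{..<k}" and ?M = "\<lambda>i j. M $$ (i, j)"
  have "- ((- 1) ^ card S * (minor True ?M S S * minor False ?M (?V - S) (?V - S))) =
      (\<Sum>P\<in>Pow ?V. \<Sum>Q\<in>Pow ?V. ?t P Q S)" if "S \<in> {S. S \<subseteq> ?V \<and> 0 \<in> S}" for S
  proof -
    have S: "S \<subseteq> ?V" "finite S" using that finite_subset by auto
    let ?s = "\<lambda>I J. split_sign True I (S - I) * split_sign True J (S - J) :: 'a"
    have 1: "minor True ?M S S = (\<Sum>I\<in>Pow S. \<Sum>J\<in>Pow S. ?s I J * (minor True B I J * minor True A (S - I) (S - J)))"
      using S AB by (subst minor_add_laplace[symmetric]) (auto intro!: minor_cong)
    have 2: "minor False ?M (?V - S) (?V - S) = (\<Sum>I'\<in>Pow (?V - S). \<Sum>J'\<in>Pow (?V - S).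
        minor False B I' J' * minor False A (?V - S - I') (?V - S - J'))"
      using minor_add_laplace[of "?V - S" "?V - S" False A B] AB
        minor_cong[of "?V - S" "?V - S" ?M "\<lambda>i j. A i j + B i j" False]
      by (simp add: split_sign_def)
    define g where "g I I' J J' = ?s I J * (minor True B I J * minor True A (S - I) (S - J)) *
      (minor False B I' J' * minor False A (?V - S - I') (?V - S - J'))" for I I' J J'
    have t: "?t P Q S = - ((- 1) ^ card S * g (P \<inter> S) (P - S) (Q \<inter> S) (Q - S))" for P Q
    proof -
      have "S - P \<inter> S = S - P" "?V - S - (P - S) = ?V - S - P" for P by auto
      then show ?thesis
        by (simp add: g_def exchange_sign_def split_sign_def power_add mult_ac)
    qed
    have "minor True ?M S S * minor False ?M (?V - S) (?V - S) =
      (\<Sum>I\<in>Pow S. \<Sum>J\<in>Pow S. \<Sum>I'\<in>Pow (?V - S). \<Sum>J'\<in>Pow (?V - S). g I I' J J')"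
      unfolding 1 2 g_def by (simp only: sum_distrib_right) (simp only: sum_distrib_left)
    also have "\<dots> = (\<Sum>I\<in>Pow S. \<Sum>I'\<in>Pow (?V - S). \<Sum>J\<in>Pow S. \<Sum>J'\<in>Pow (?V - S). g I I' J J')"
      by (rule sum.cong[OF refl]) (rule sum.swap)
    also have "\<dots> = (\<Sum>P\<in>Pow ?V. \<Sum>J\<in>Pow S. \<Sum>J'\<in>Pow (?V - S). g (P \<inter> S) (P - S) J J')"
      by (rule sum_Pow_split[OF S(1), symmetric])
    also have "\<dots> = (\<Sum>P\<in>Pow ?V. \<Sum>Q\<in>Pow ?V. g (P \<inter> S) (P - S) (Q \<inter> S) (Q - S))"
      by (rule sum.cong[OF refl]) (rule sum_Pow_split[OF S(1), symmetric])
    finally show ?thesis by (simp only: t sum_negf sum_distrib_left)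
  qed
  then have "hc M = (\<Sum>S | S \<subseteq> ?V \<and> 0 \<in> S. \<Sum>P\<in>Pow ?V. \<Sum>Q\<in>Pow ?V. ?t P Q S)"
    unfolding hc_eq_sum_minors[OF M k] sum_negf[symmetric] by (intro sum.cong refl)
  also have "\<dots> = (\<Sum>P\<in>Pow ?V. \<Sum>S | S \<subseteq> ?V \<and> 0 \<in> S. \<Sum>Q\<in>Pow ?V. ?t P Q S)"
    by (rule sum.swap)
  also have "\<dots> = (\<Sum>P\<in>Pow ?V. \<Sum>Q\<in>Pow ?V. \<Sum>S | S \<subseteq> ?V \<and> 0 \<in> S. ?t P Q S)"
    by (rule sum.cong[OF refl]) (rule sum.swap)
  finally show ?thesis .
qed

section \<open>Hamiltonian cycles by the recursion of Held and Karp\<close>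

fun path_weight :: "(nat \<Rightarrow> nat \<Rightarrow> 'a::comm_ring_1) \<Rightarrow> nat \<Rightarrow> nat list \<Rightarrow> 'a" where
  "path_weight M a [] = M a 0"
| "path_weight M a (b # xs) = M a b * path_weight M b xs"

text \<open>Total weight of the paths that leave a, visit the vertices of X in any order and close
  with the edge to 0.\<close>

definition held_karp :: "(nat \<Rightarrow> nat \<Rightarrow> 'a::comm_ring_1) \<Rightarrow> nat set \<Rightarrow> nat \<Rightarrow> 'a" where
  "held_karp M X a = (\<Sum>xs\<in>permutations_of_set X. path_weight M a xs)"

lemma held_karp_empty: "held_karp M {} a = M a 0"
  by (simp add: held_karp_def)

lemma held_karp_rec:
  assumes "finite X" "X \<noteq> {}"
  shows "held_karp M X a = (\<Sum>b\<in>X. M a b * held_karp M (X - {b}) b)"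
proof -
  have "held_karp M X a = (\<Sum>b\<in>X. \<Sum>xs\<in>(#) b ` permutations_of_set (X - {b}). path_weight M a xs)"
    unfolding held_karp_def permutations_of_set_nonempty[OF assms(2)]
    using assms by (intro sum.UNION_disjoint) auto
  also have "\<dots> = (\<Sum>b\<in>X. M a b * held_karp M (X - {b}) b)"
    by (intro sum.cong refl) (simp add: sum.reindex held_karp_def sum_distrib_left)
  finally show ?thesis .
qed

lemma path_weight_eq_prod:
  "path_weight M a xs = (\<Prod>i<length (a # xs). M ((a # xs) ! i) ((a # xs @ [0]) ! Suc i))"
proof (induction xs arbitrary: a)
  case (Cons b xs)
  then show ?case by (simp add: prod.lessThan_Suc_shift del: prod.lessThan_Suc)
qed simp

lemma cycle_of_list_funpow_nth:
  assumes "distinct cs" "cs \<noteq> []"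
  shows "(cycle_of_list cs ^^ n) (cs ! 0) = cs ! (n mod length cs)"
proof -
  have "(cycle_of_list cs ^^ n) (cs ! 0) = map (cycle_of_list cs ^^ n) cs ! 0"
    using assms by simp
  also have "\<dots> = cs ! (n mod length cs)"
    using assms by (simp only: cyclic_rotation) (simp add: nth_rotate)
  finally show ?thesis .
qed

lemma cycle_of_list_nth:
  assumes "distinct cs" "i < length cs"
  shows "cycle_of_list cs (cs ! i) = cs ! (Suc i mod length cs)"
proof -
  have "cycle_of_list cs (cs ! i) = map (cycle_of_list cs ^^ 1) cs ! i"
    using assms by simp
  also have "\<dots> = cs ! (Suc i mod length cs)"
    using assms by (simp only: cyclic_rotation nth_rotate) simp
  finally show ?thesis .
qed

lemma orbit_cycle_of_list:
  assumes "distinct cs" "v \<in> set cs"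
  shows "orbit (cycle_of_list cs) v = set cs"
proof -
  have ne: "cs \<noteq> []" using assms by auto
  have perm: "permutation (cycle_of_list cs)" by (rule permutation_of_cycle)
  have "cs ! i \<in> orbit (cycle_of_list cs) (cs ! 0)" if "i < length cs" for i
    using cycle_of_list_funpow_nth[OF assms(1) ne, of i] that
    by (auto simp: orbit_altdef_permutation[OF perm] intro!: exI[of _ i])
  then have "set cs \<subseteq> orbit (cycle_of_list cs) (cs ! 0)"
    by (auto simp: in_set_conv_nth)
  moreover have "orbit (cycle_of_list cs) (cs ! 0) \<subseteq> set cs"
    using ne by (intro permutes_orbit_subset[OF cycle_permutes]) simp
  ultimately have "orbit (cycle_of_list cs) (cs ! 0) = set cs" by simp
  then show ?thesis
    using assms(2) orbit_cyclic_eq3[OF cyclic_on_orbit'[OF perm]] by metis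
qed

text \<open>Makes "write the cycle down, starting at a" a left inverse of
  \<open>cycle_of_list\<close>.\<close>

lemma support_cycle_of_list:
  assumes "distinct (a # xs)"
  shows "support (cycle_of_list (a # xs)) a = a # xs"
proof -
  let ?c = "cycle_of_list (a # xs)"
  have perm: "permutation ?c" by (rule permutation_of_cycle)
  have pow: "(?c ^^ i) a = (a # xs) ! i" if "i < length (a # xs)" for i
    using cycle_of_list_funpow_nth[OF assms, of i] that by (simp del: cycle_of_list.simps)
  have dist: "distinct (support ?c a)" by (rule cycle_of_permutation[OF perm])
  have "set (support ?c a) = orbit ?c a"
    by (simp only: support_set[OF perm] orbit_altdef_permutation[OF perm]) auto
  also have "\<dots> = set (a # xs)" by (rule orbit_cycle_of_list[OF assms]) simp
  finally have "card (set (support ?c a)) = card (set (a # xs))" by (rule arg_cong)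
  then have "length (support ?c a) = length (a # xs)"
    by (simp only: distinct_card[OF dist] distinct_card[OF assms])
  then show ?thesis
    using pow by (intro nth_equalityI) (simp_all del: cycle_of_list.simps upt_Suc)
qed

text \<open>A permutation with a single cycle is written as that cycle starting at 0. The tail is an
  arbitrary ordering of the other vertices, and the product over the rows becomes the weight of the
  closed path.\<close>

theorem hc_eq_held_karp:
  fixes M :: "'a::comm_ring_1 mat"
  assumes M: "M \<in> carrier_mat k k" and k: "0 < k"
  shows "hc M = held_karp (\<lambda>i j. M $$ (i, j)) ({..<k} - {0}) 0"
proof -
  let ?V = "{..<k}" and ?M = "\<lambda>i j. M $$ (i, j)"
  have "hc M = (\<Sum>\<sigma> | \<sigma> permutes ?V \<and> cycle_count k \<sigma> = 1. \<Prod>i<k. ?M i (\<sigma> i))"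
    using M by (simp add: hc_def)
  also have "\<dots> = (\<Sum>xs\<in>permutations_of_set (?V - {0}). path_weight ?M 0 xs)"
  proof (rule sum.reindex_bij_witness[of _ "\<lambda>xs. cycle_of_list (0 # xs)" "\<lambda>\<sigma>. tl (support \<sigma> 0)"])
    fix \<sigma> assume "\<sigma> \<in> {\<sigma>. \<sigma> permutes ?V \<and> cycle_count k \<sigma> = 1}"
    then have \<sigma>: "\<sigma> permutes ?V" "cycle_count k \<sigma> = 1" by auto
    have perm: "permutation \<sigma>" using \<sigma> permutation_permutes by blast
    obtain C where "orbit \<sigma> ` ?V = {C}" using \<sigma>(2) by (auto simp: cycle_count_def card_1_singleton_iff)
    then have "orbit \<sigma> v = orbit \<sigma> 0" if "v \<in> ?V" for v using that k by blast
    then have "?V \<subseteq> orbit \<sigma> 0" using permutation_self_in_orbit[OF perm] by blast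
    then have "orbit \<sigma> 0 = ?V" using permutes_orbit_subset[OF \<sigma>(1)] k by blast
    moreover have "set (support \<sigma> 0) = orbit \<sigma> 0"
      by (simp only: support_set[OF perm] orbit_altdef_permutation[OF perm]) auto
    ultimately have set: "set (support \<sigma> 0) = ?V" by simp
    have dist: "distinct (support \<sigma> 0)" by (rule cycle_of_permutation[OF perm])
    \<comment> \<open>The period is positive, so the list of iterates begins with 0 itself.\<close>
    have "[0..<least_power \<sigma> 0] = 0 # [1..<least_power \<sigma> 0]"
      using least_power_of_permutation(2)[OF perm, of 0] by (simp add: upt_conv_Cons)
    then have supp: "support \<sigma> 0 = 0 # tl (support \<sigma> 0)"
      by (simp only: list.map funpow_0 list.sel)
    show "tl (support \<sigma> 0) \<in> permutations_of_set (?V - {0})"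
    proof -
      have "distinct (0 # tl (support \<sigma> 0))" "set (0 # tl (support \<sigma> 0)) = ?V"
        unfolding supp[symmetric] by (fact dist set)+
      then show ?thesis by (auto simp only: permutations_of_set_def distinct.simps list.set mem_Collect_eq)
    qed
    show c: "cycle_of_list (0 # tl (support \<sigma> 0)) = \<sigma>"
    proof
      fix x
      have "cycle_of_list (support \<sigma> 0) x = \<sigma> x"
      proof (cases "x \<in> ?V")
        case True
        then show ?thesis by (intro cycle_restrict[OF perm, symmetric]) (simp only: set)
      next
        case False
        then have "x \<notin> set (support \<sigma> 0)" by (simp only: set not_False_eq_True)
        moreover have "\<sigma> x = x" using \<sigma>(1) False by (rule permutes_not_in)
        ultimately show ?thesis using id_outside_supp[of x "support \<sigma> 0"] by metis
      qed
      then show "cycle_of_list (0 # tl (support \<sigma> 0)) x = \<sigma> x" by (simp only: supp[symmetric])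
    qed
    define cs where "cs = support \<sigma> 0"
    have cs: "distinct cs" "set cs = ?V" "cycle_of_list cs = \<sigma>" "cs = 0 # tl cs"
      using dist set c supp by (simp_all only: cs_def)
    have bij: "bij_betw (\<lambda>i. cs ! i) {..<length cs} ?V"
      by (rule bij_betw_nth[OF cs(1)]) (simp_all only: cs(2))
    have "path_weight ?M 0 (tl cs) = (\<Prod>i<length cs. ?M (cs ! i) ((cs @ [0]) ! Suc i))"
      unfolding path_weight_eq_prod by (simp only: cs(4)[symmetric] append_Cons[symmetric])
    also have "\<dots> = (\<Prod>i<length cs. ?M (cs ! i) (\<sigma> (cs ! i)))"
    proof (intro prod.cong refl)
      fix i assume i: "i \<in> {..<length cs}"
      \<comment> \<open>The appended 0 closes the cycle: at the last position the index wraps around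
        to 0, where \<open>cs\<close> holds the vertex 0.\<close>
      have "(cs @ [0]) ! Suc i = cs ! (Suc i mod length cs)"
      proof (cases "Suc i = length cs")
        case True
        have "cs ! 0 = 0" by (subst cs(4)) simp
        then show ?thesis using True by simp
      qed (use i in \<open>auto simp: nth_append\<close>)
      then show "?M (cs ! i) ((cs @ [0]) ! Suc i) = ?M (cs ! i) (\<sigma> (cs ! i))"
        using cycle_of_list_nth[OF cs(1)] i cs(3) by simp
    qed
    also have "\<dots> = (\<Prod>i<k. ?M i (\<sigma> i))"
      by (rule prod.reindex_bij_betw[OF bij])
    finally show "path_weight ?M 0 (tl (support \<sigma> 0)) = (\<Prod>i<k. ?M i (\<sigma> i))"
      by (simp only: cs_def)
  next
    fix xs assume "xs \<in> permutations_of_set (?V - {0})"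
    then have xs: "distinct (0 # xs)" "set (0 # xs) = ?V"
      using k by (auto simp: permutations_of_set_def)
    show "tl (support (cycle_of_list (0 # xs)) 0) = xs"
      by (simp only: support_cycle_of_list[OF xs(1)] list.sel)
    have "orbit (cycle_of_list (0 # xs)) ` ?V = {?V}"
      using orbit_cycle_of_list[OF xs(1)] xs(2) k by (auto simp del: cycle_of_list.simps)
    then show "cycle_of_list (0 # xs) \<in> {\<sigma>. \<sigma> permutes ?V \<and> cycle_count k \<sigma> = 1}"
      using cycle_permutes[of "0 # xs"] xs(2) by (simp add: cycle_count_def del: cycle_of_list.simps)
  qed
  finally show ?thesis by (simp add: held_karp_def)
qed

section \<open>Computable functions, sets and programs\<close>

definition dfst :: "nat \<Rightarrow> nat" where "dfst x = fst (prod_decode x)"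
definition dsnd :: "nat \<Rightarrow> nat" where "dsnd x = snd (prod_decode x)"

lemma dfst_encode [simp]: "dfst (prod_encode (a, b)) = a"
  and dsnd_encode [simp]: "dsnd (prod_encode (a, b)) = b"
  by (simp_all add: dfst_def dsnd_def)

lemma computable_id: "computable (\<lambda>x. x)"
  using computable.pair[OF computable.fst computable.snd] by simp

lemma computable_const: "computable (\<lambda>_. c)"
  by (induction c) (use computable.zero computable.comp[OF computable.suc] in auto)

lemma computable_Suc: "computable f \<Longrightarrow> computable (\<lambda>x. Suc (f x))"
  by (rule computable.comp[OF computable.suc])

lemma computable_dfst: "computable f \<Longrightarrow> computable (\<lambda>x. dfst (f x))"
  unfolding dfst_def by (rule computable.comp[OF computable.fst])

lemma computable_dsnd: "computable f \<Longrightarrow> computable (\<lambda>x. dsnd (f x))"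
  unfolding dsnd_def by (rule computable.comp[OF computable.snd])

lemmas computable_basic = computable_id computable_const computable_Suc computable_dfst computable_dsnd
  computable.pair

lemma computable_rec:
  assumes a: "computable a" and n: "computable n"
    and g: "computable (\<lambda>y. g (dfst y) (dfst (dsnd y)) (dsnd (dsnd y)))"
  shows "computable (\<lambda>x. rec_nat (a x) (g x) (n x))"
  using computable.comp[OF computable.rec[OF a g] computable.pair[OF computable_id n]] by simp

lemma computable_plus:
  assumes "computable f" "computable g" shows "computable (\<lambda>x. f x + g x)"
proof -
  have "rec_nat a (\<lambda>_ y. Suc y) n = a + n" for a n by (induction n) auto
  then show ?thesis
    using computable_rec[OF assms, of "\<lambda>_ _ y. Suc y"] by (simp add: computable_basic)
qed

lemma computable_times:
  assumes "computable f" "computable g" shows "computable (\<lambda>x. f x * g x)"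
proof -
  have "rec_nat 0 (\<lambda>_ y. y + a) n = a * n" for a n by (induction n) auto
  then show ?thesis
    using computable_rec[OF computable_const[of 0] assms(2), of "\<lambda>x _ y. y + f x"]
    by (simp add: computable_basic computable_plus computable.comp[OF assms(1)])
qed

lemma computable_minus:
  assumes "computable f" "computable g" shows "computable (\<lambda>x. f x - g x)"
proof -
  have "rec_nat 0 (\<lambda>i _. i) n = n - 1" for n by (cases n) auto
  then have pred: "computable (\<lambda>x. h x - 1)" if "computable h" for h
    using computable_rec[OF computable_const[of 0] that, of "\<lambda>_ i _. i"] by (simp add: computable_basic)
  have "rec_nat a (\<lambda>_ y. y - 1) n = a - n" for a n by (induction n) auto
  then show ?thesis
    using computable_rec[OF assms, of "\<lambda>_ _ y. y - 1"] pred[of "\<lambda>y. dsnd (dsnd y)"]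
    by (simp add: computable_basic)
qed

lemma computable_power:
  assumes "computable f" "computable g" shows "computable (\<lambda>x. f x ^ g x)"
proof -
  have "rec_nat 1 (\<lambda>_ y. y * a) n = a ^ n" for a n :: nat by (induction n) auto
  then show ?thesis
    using computable_rec[OF computable_const[of 1] assms(2), of "\<lambda>x _ y. y * f x"]
    by (simp add: computable_basic computable_times computable.comp[OF assms(1)])
qed

lemma computable_sum:
  assumes "computable n" and h: "computable (\<lambda>y. h (dfst y) (dsnd y))"
  shows "computable (\<lambda>x. \<Sum>i<n x. h x i)"
proof -
  have "rec_nat 0 (\<lambda>i y. y + g i) n = (\<Sum>i<n. g i)" for g :: "nat \<Rightarrow> nat" and n by (induction n) auto
  moreover have "computable (\<lambda>y. h (dfst y) (dfst (dsnd y)))"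
    using computable.comp[OF h, of "\<lambda>y. prod_encode (dfst y, dfst (dsnd y))"] by (simp add: computable_basic)
  ultimately show ?thesis
    using computable_rec[OF computable_const[of 0] assms(1), of "\<lambda>x i y. y + h x i"]
    by (simp add: computable_basic computable_plus)
qed

section \<open>Decidable predicates and bounded tests\<close>

definition decidable :: "(nat \<Rightarrow> bool) \<Rightarrow> bool" where
  "decidable P \<longleftrightarrow> computable (\<lambda>x. of_bool (P x))"

lemma decidable_comp: "decidable P \<Longrightarrow> computable f \<Longrightarrow> decidable (\<lambda>x. P (f x))"
  unfolding decidable_def by (rule computable.comp)

lemma decidable_const: "decidable (\<lambda>_. b)"
  unfolding decidable_def by (rule computable_const)

lemma decidable_not: assumes "decidable P" shows "decidable (\<lambda>x. \<not> P x)"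
proof -
  have "of_bool (\<not> P x) = 1 - (of_bool (P x) :: nat)" for x by simp
  then show ?thesis
    using assms unfolding decidable_def by (simp only: computable_minus computable_const)
qed

lemma decidable_conj: assumes "decidable P" "decidable Q" shows "decidable (\<lambda>x. P x \<and> Q x)"
  using assms computable_times unfolding decidable_def of_bool_conj by blast

lemma decidable_disj: assumes "decidable P" "decidable Q" shows "decidable (\<lambda>x. P x \<or> Q x)"
  using decidable_not[OF decidable_conj[OF decidable_not[OF assms(1)] decidable_not[OF assms(2)]]] by simp

lemma decidable_le: assumes "computable f" "computable g" shows "decidable (\<lambda>x. f x \<le> g x)"
proof -
  have "of_bool (f x \<le> g x) = 1 - (f x - g x)" for x by auto
  then show ?thesis unfolding decidable_def by (simp only: computable_minus computable_const assms)
qed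

lemma decidable_less: assumes "computable f" "computable g" shows "decidable (\<lambda>x. f x < g x)"
  using decidable_not[OF decidable_le[OF assms(2,1)]] by (simp add: not_le)

lemma decidable_eq: assumes "computable f" "computable g" shows "decidable (\<lambda>x. f x = g x)"
  using decidable_conj[OF decidable_le[OF assms] decidable_le[OF assms(2,1)]] by (simp add: eq_iff)

lemma computable_if:
  assumes "decidable P" "computable f" "computable g" shows "computable (\<lambda>x. if P x then f x else g x)"
proof -
  have "(if P x then f x else g x) = of_bool (P x) * f x + of_bool (\<not> P x) * g x" for x by simp
  then show ?thesis
    using assms decidable_not[OF assms(1)] unfolding decidable_def
    by (simp only: computable_plus computable_times)
qed

text \<open>The quotient counts the i < a with \<open>Suc i * b \<le> a\<close>, a bounded sum of
  decidable tests. The guard 0 < b reproduces the value 0 of a division by 0.\<close>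

lemma computable_div:
  assumes "computable f" "computable g" shows "computable (\<lambda>x. f x div g x)"
proof -
  have div: "(\<Sum>i<a. of_bool (0 < b \<and> Suc i * b \<le> a)) = a div b" for a b :: nat
  proof (cases "b = 0")
    case False
    have "{i. i < a \<and> Suc i * b \<le> a} = {..<a div b}"
    proof (rule Set.set_eqI)
      fix i
      have "i < a div b \<longleftrightarrow> Suc i * b \<le> a"
        using False less_eq_div_iff_mult_less_eq[of b "Suc i" a] by (simp add: Suc_le_eq)
      moreover have "i < a div b \<Longrightarrow> i < a"
        using div_le_dividend[of a b] by linarith
      ultimately show "i \<in> {i. i < a \<and> Suc i * b \<le> a} \<longleftrightarrow> i \<in> {..<a div b}" by auto
    qed
    moreover have "(\<Sum>i<a. of_bool (0 < b \<and> Suc i * b \<le> a)) = card {i. i < a \<and> Suc i * b \<le> a}"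
      using False by (simp add: of_bool_def sum.If_cases Int_def)
    ultimately show ?thesis by simp
  qed simp
  have "computable (\<lambda>x. \<Sum>i<f x. of_bool (0 < g x \<and> Suc i * g x \<le> f x))"
    using assms by (intro computable_sum computable_basic decidable_conj[unfolded decidable_def]
        decidable_less[unfolded decidable_def] decidable_le[unfolded decidable_def] computable_times)
      (simp_all add: computable.comp[OF assms(1)] computable.comp[OF assms(2)] computable_basic)
  then show ?thesis by (simp only: div)
qed

lemma decidable_odd: assumes "computable f" shows "decidable (\<lambda>x. odd (f x))"
proof -
  have "odd (f x) \<longleftrightarrow> 2 * (f x div 2) \<noteq> f x" for x by presburger
  then show ?thesis
    by (simp only: decidable_not decidable_eq computable_times computable_div computable_const assms)
qed

lemma decidable_even: assumes "computable f" shows "decidable (\<lambda>x. even (f x))"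
  using decidable_not[OF decidable_odd[OF assms]] by simp

section \<open>Finite sets represented by their codes\<close>

text \<open>Finiteness is demanded because \<open>set_encode\<close> sends every infinite set to 0,
  the code of the empty set.\<close>

definition computable_set :: "(nat \<Rightarrow> nat set) \<Rightarrow> bool" where
  "computable_set A \<longleftrightarrow> computable (\<lambda>x. set_encode (A x)) \<and> (\<forall>x. finite (A x))"

lemma computable_set_encode: "computable_set A \<Longrightarrow> computable (\<lambda>x. set_encode (A x))"
  by (simp add: computable_set_def)

lemma computable_set_decode: "computable f \<Longrightarrow> computable_set (\<lambda>x. set_decode (f x))"
  by (simp add: computable_set_def)

lemma computable_set_comp: "computable_set A \<Longrightarrow> computable f \<Longrightarrow> computable_set (\<lambda>x. A (f x))"
  by (simp add: computable_set_def computable.comp[of "\<lambda>x. set_encode (A x)"])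

lemma decidable_member:
  assumes "computable f" "computable_set A" shows "decidable (\<lambda>x. f x \<in> A x)"
proof -
  have "f x \<in> A x \<longleftrightarrow> odd (set_encode (A x) div 2 ^ f x)" for x
  proof -
    have "f x \<in> A x \<longleftrightarrow> f x \<in> set_decode (set_encode (A x))"
      using assms(2) by (simp add: computable_set_def)
    then show ?thesis by (simp add: set_decode_def)
  qed
  then show ?thesis
    using assms by (simp only: decidable_odd computable_div computable_power computable_const
        computable_set_encode)
qed

lemma computable_set_bounded:
  assumes n: "computable n" and P: "decidable (\<lambda>y. P (dfst y) (dsnd y))"
  shows "computable_set (\<lambda>x. {i. i < n x \<and> P x i})"
proof -
  have "set_encode {i. i < n x \<and> P x i} = (\<Sum>i<n x. of_bool (P x i) * 2 ^ i)" for x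
  proof -
    have "(\<Sum>i<n x. of_bool (P x i) * 2 ^ i) = (\<Sum>i<n x. if P x i then 2 ^ i else 0 :: nat)"
      by (intro sum.cong) auto
    also have "\<dots> = (\<Sum>i | i < n x \<and> P x i. 2 ^ i)" by (simp flip: sum.inter_filter)
    finally show ?thesis by (simp add: set_encode_def)
  qed
  moreover have "computable (\<lambda>x. \<Sum>i<n x. of_bool (P x i) * 2 ^ i)"
    using P by (intro computable_sum n computable_times computable_power computable_basic)
      (simp add: decidable_def)
  ultimately show ?thesis by (simp add: computable_set_def)
qed

text \<open>As i < 2^i, a code bounds the elements of its set; filters, unions and sums over sets
  thereby become bounded searches.\<close>

lemma less_set_encode: assumes "finite A" "i \<in> A" shows "i < set_encode A"
proof -
  have "2 ^ i \<le> set_encode A" unfolding set_encode_def by (rule member_le_sum) (use assms in auto)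
  then show ?thesis using less_exp[of i] by linarith
qed

lemma computable_set_filter:
  assumes A: "computable_set A" and P: "decidable (\<lambda>y. P (dfst y) (dsnd y))"
  shows "computable_set (\<lambda>x. {i \<in> A x. P x i})"
proof -
  have "{i \<in> A x. P x i} = {i. i < set_encode (A x) \<and> (i \<in> A x \<and> P x i)}" for x
    using A less_set_encode by (auto simp: computable_set_def)
  moreover have "computable_set (\<lambda>x. {i. i < set_encode (A x) \<and> (i \<in> A x \<and> P x i)})"
    by (intro computable_set_bounded computable_set_encode A decidable_conj P decidable_member
        computable_basic computable_set_comp[OF A])
  ultimately show ?thesis by simp
qed

lemma computable_set_Int:
  assumes "computable_set A" "computable_set B" shows "computable_set (\<lambda>x. A x \<inter> B x)"
proof -
  have "A x \<inter> B x = {i \<in> A x. i \<in> B x}" for x by auto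
  then show ?thesis
    using assms by (simp only: computable_set_filter decidable_member computable_basic
        computable_set_comp[OF assms(2)])
qed

lemma computable_set_Diff:
  assumes "computable_set A" "computable_set B" shows "computable_set (\<lambda>x. A x - B x)"
proof -
  have "A x - B x = {i \<in> A x. \<not> i \<in> B x}" for x by auto
  then show ?thesis
    using assms by (simp only: computable_set_filter decidable_not decidable_member computable_basic
        computable_set_comp[OF assms(2)])
qed

lemma computable_set_Un:
  assumes "computable_set A" "computable_set B" shows "computable_set (\<lambda>x. A x \<union> B x)"
proof -
  have "A x \<union> B x = {i. i < set_encode (A x) + set_encode (B x) \<and> (i \<in> A x \<or> i \<in> B x)}" for x
    using assms by (auto simp: computable_set_def intro: trans_less_add1 trans_less_add2 less_set_encode)
  moreover have "computable_set (\<lambda>x. {i. i < set_encode (A x) + set_encode (B x) \<and> (i \<in> A x \<or> i \<in> B x)})"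
    by (intro computable_set_bounded computable_plus computable_set_encode assms decidable_disj
        decidable_member computable_basic computable_set_comp[OF assms(1)] computable_set_comp[OF assms(2)])
  ultimately show ?thesis by simp
qed

lemma computable_set_lessThan: assumes "computable f" shows "computable_set (\<lambda>x. {..<f x})"
  using computable_set_bounded[OF assms decidable_const[of True]] by (simp add: lessThan_def)

lemma computable_set_empty: "computable_set (\<lambda>_. {})"
  by (simp add: computable_set_def computable_const)

lemma computable_set_singleton: assumes "computable f" shows "computable_set (\<lambda>x. {f x})"
proof -
  have "{f x} = {i. i < Suc (f x) \<and> i = f x}" for x by auto
  moreover have "computable_set (\<lambda>x. {i. i < Suc (f x) \<and> i = f x})"
    by (intro computable_set_bounded computable_basic assms decidable_eq computable.comp[OF assms])
  ultimately show ?thesis by simp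
qed

lemma computable_sum_set:
  assumes A: "computable_set A" and h: "computable (\<lambda>y. h (dfst y) (dsnd y))"
  shows "computable (\<lambda>x. \<Sum>i\<in>A x. h x i)"
proof -
  have "(\<Sum>i\<in>A x. h x i) = (\<Sum>i<set_encode (A x). of_bool (i \<in> A x) * h x i)" for x
    by (rule sum.mono_neutral_cong_left) (use A less_set_encode in \<open>auto simp: computable_set_def\<close>)
  moreover have "computable (\<lambda>x. \<Sum>i<set_encode (A x). of_bool (i \<in> A x) * h x i)"
    by (intro computable_sum computable_set_encode A computable_times h
        decidable_member[unfolded decidable_def] computable_basic computable_set_comp[OF A])
  ultimately show ?thesis by simp
qed

lemma computable_card: assumes "computable_set A" shows "computable (\<lambda>x. card (A x))"
  using computable_sum_set[OF assms, of "\<lambda>_ _. 1"] by (simp add: computable_const)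

lemma decidable_set_eq:
  assumes "computable_set A" "computable_set B" shows "decidable (\<lambda>x. A x = B x)"
proof -
  have "A x = B x \<longleftrightarrow> set_encode (A x) = set_encode (B x)" for x
    using assms by (simp add: computable_set_def set_encode_eq)
  then show ?thesis using assms by (simp only: decidable_eq computable_set_encode)
qed

lemma decidable_ball:
  assumes "computable_set A" "decidable (\<lambda>y. P (dfst y) (dsnd y))" shows "decidable (\<lambda>x. \<forall>i\<in>A x. P x i)"
proof -
  have "(\<forall>i\<in>A x. P x i) \<longleftrightarrow> {i \<in> A x. \<not> P x i} = {}" for x by auto
  then show ?thesis
    using assms by (simp only: decidable_set_eq computable_set_filter decidable_not computable_set_empty)
qed

lemma decidable_subset:
  assumes "computable_set A" "computable_set B" shows "decidable (\<lambda>x. A x \<subseteq> B x)"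
proof -
  have "A x \<subseteq> B x \<longleftrightarrow> A x - B x = {}" for x by auto
  then show ?thesis
    using assms by (simp only: decidable_set_eq computable_set_Diff computable_set_empty)
qed

text \<open>
  A program is generated in front of a given tail, so that concatenation becomes composition and
  a loop becomes primitive recursion from its last iteration to the first.
\<close>

definition computable_prog :: "(nat \<Rightarrow> instr list) \<Rightarrow> bool" where
  "computable_prog p \<longleftrightarrow>
     computable (\<lambda>y. list_encode (map instr_code (p (dfst y)) @ list_decode (dsnd y)))"

lemma computable_prog_Nil: "computable_prog (\<lambda>_. [])"
  by (simp add: computable_prog_def computable_basic)

lemma computable_prog_append:
  assumes "computable_prog p" "computable_prog q" shows "computable_prog (\<lambda>x. p x @ q x)"
  using computable.comp[OF assms(1)[unfolded computable_prog_def]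
      computable.pair[OF computable_dfst[OF computable_id] assms(2)[unfolded computable_prog_def]]]
  by (simp add: computable_prog_def)

lemma computable_prog_Cons:
  assumes c: "computable (\<lambda>x. instr_code (c x))" and p: "computable_prog p"
  shows "computable_prog (\<lambda>x. c x # p x)"
  using p computable.comp[OF c, of dfst]
  by (simp add: computable_prog_def computable_Suc computable.pair computable_dfst[OF computable_id])

lemma computable_prog_if:
  assumes P: "decidable P" and p: "computable_prog p" "computable_prog q"
  shows "computable_prog (\<lambda>x. if P x then p x else q x)"
  using computable_if[OF decidable_comp[OF P computable_dfst[OF computable_id]]
      p[unfolded computable_prog_def]]
  unfolding computable_prog_def by (simp add: if_distrib if_distribR cong: if_cong)

lemma computable_prog_loop:
  assumes n: "computable n" and body: "computable_prog (\<lambda>y. body (dfst y) (dsnd y))"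
  shows "computable_prog (\<lambda>x. concat (map (body x) [0..<n x]))"
proof -
  let ?enc = "\<lambda>p t. list_encode (map instr_code p @ list_decode t)"
  \<comment> \<open>After i steps the accumulator holds the last i iterations in front of the tail,
    so the next one to prepend has index n - Suc i.\<close>
  have loop: "rec_nat t (\<lambda>i acc. ?enc (body x (n - Suc i)) acc) i = ?enc (concat (map (body x) [n - i..<n])) t"
    if "i \<le> n" for x n t i
    using that
  proof (induction i)
    case (Suc i)
    then have "[n - Suc i..<n] = (n - Suc i) # [n - i..<n]"
      by (subst upt_conv_Cons) (auto simp: Suc_diff_Suc)
    then show ?case using Suc by simp
  qed simp
  \<comment> \<open>The recursion supplies ((x, tail), (i, accumulator)); this map rearranges it to
    ((x, iteration), accumulator), the argument expected by the generator of the body.\<close>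
  let ?h = "\<lambda>y. prod_encode (prod_encode (dfst (dfst y), n (dfst (dfst y)) - Suc (dfst (dsnd y))), dsnd (dsnd y))"
  have "computable ?h"
    by (intro computable_basic computable_minus computable.comp[OF n])
  from computable.comp[OF body[unfolded computable_prog_def] this]
  have "computable (\<lambda>y. ?enc (body (dfst (dfst y)) (n (dfst (dfst y)) - Suc (dfst (dsnd y)))) (dsnd (dsnd y)))"
    by simp
  from computable_rec[OF computable_dsnd[OF computable_id] computable.comp[OF n computable_dfst[OF computable_id]],
      of "\<lambda>y i acc. ?enc (body (dfst y) (n (dfst y) - Suc i)) acc", OF this]
  show ?thesis unfolding computable_prog_def by (simp add: loop)
qed

text \<open>Increasing codes list every set after all its proper subsets, which is the order
  required by the recursions over sets.\<close>

definition subsets :: "nat \<Rightarrow> nat set list" where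
  "subsets k = map set_decode [0..<2 ^ k]"

lemma computable_prog_subsets:
  assumes "computable n" "computable_prog (\<lambda>y. body (dfst y) (set_decode (dsnd y)))"
  shows "computable_prog (\<lambda>x. concat (map (body x) (subsets (n x))))"
  using computable_prog_loop[of "\<lambda>x. 2 ^ n x" "\<lambda>x i. body x (set_decode i)"] assms
  by (simp add: subsets_def comp_def computable_power computable_const)

lemma computable_instr_code:
  "computable f \<Longrightarrow> computable (\<lambda>x. instr_code (Set_Zero (f x)))"
  "computable f \<Longrightarrow> computable (\<lambda>x. instr_code (Set_One (f x)))"
  "computable f \<Longrightarrow> computable g \<Longrightarrow> computable (\<lambda>x. instr_code (Load (f x) (g x)))"
  "computable f \<Longrightarrow> computable g \<Longrightarrow> computable h \<Longrightarrow> computable (\<lambda>x. instr_code (Add (f x) (g x) (h x)))"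
  "computable f \<Longrightarrow> computable g \<Longrightarrow> computable h \<Longrightarrow> computable (\<lambda>x. instr_code (Sub (f x) (g x) (h x)))"
  "computable f \<Longrightarrow> computable g \<Longrightarrow> computable h \<Longrightarrow> computable (\<lambda>x. instr_code (Mul (f x) (g x) (h x)))"
  by (simp_all only: instr_code.simps computable.pair computable_const)

lemma uniform_familyI:
  assumes "computable_prog (\<lambda>x. P (dfst x) (dsnd x))" shows "uniform_family P"
  using computable.comp[OF assms[unfolded computable_prog_def]
      computable.pair[OF computable_id computable_const[of 0]]]
  by (simp add: uniform_family_def dfst_def dsnd_def case_prod_unfold)

lemmas computable_intros =
  computable_basic computable_plus computable_times computable_minus computable_power
  computable_sum_set computable_card computable_set_encode decidable_const decidable_not
  decidable_conj decidable_disj decidable_le decidable_less decidable_eq decidable_odd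
  decidable_even decidable_member decidable_set_eq decidable_ball decidable_subset
  computable_set_decode computable_set_filter computable_set_Int computable_set_Diff
  computable_set_Un computable_set_lessThan computable_set_empty computable_set_singleton
  computable_prog_Nil computable_prog_append computable_prog_Cons computable_prog_if
  computable_prog_loop computable_prog_subsets computable_instr_code

section \<open>Arithmetic circuits as programs\<close>

text \<open>
  The flag in \<open>Entry\<close> and the first flag in \<open>Minor\<close> select the matrix: \<open>False\<close> stands for the
  precomputed one, \<open>True\<close> for the query. Sets of rows and columns are given by their codes.
\<close>

datatype node =
    One
  | Entry bool nat nat nat
  | Minor bool bool nat nat nat
  | Table nat nat nat
  | Prod nat nat nat nat
  | Path nat nat nat
  | Out nat

text \<open>Cell \<open>r\<close> is the scratch cell of all assignments.\<close>

fun addr :: "nat \<Rightarrow> node \<Rightarrow> nat" where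
  "addr r One = Suc r"
| "addr r (Entry q i j l) = Suc (r + prod_encode (1, prod_encode (of_bool q, prod_encode (i, prod_encode (j, l)))))"
| "addr r (Minor q b x y s) = Suc (r + prod_encode (2, prod_encode (of_bool q, prod_encode (of_bool b,
      prod_encode (x, prod_encode (y, s))))))"
| "addr r (Table p q z) = Suc (r + prod_encode (3, prod_encode (p, prod_encode (q, z))))"
| "addr r (Prod p q z s) = Suc (r + prod_encode (4, prod_encode (p, prod_encode (q, prod_encode (z, s)))))"
| "addr r (Path x a s) = Suc (r + prod_encode (5, prod_encode (x, prod_encode (a, s))))"
| "addr r (Out s) = (if s < r then s else Suc (r + prod_encode (6, s)))"

lemma prod_encode_neq_0: "0 < a \<Longrightarrow> prod_encode (a, b) \<noteq> 0"
  using le_prod_encode_1[of a b] by linarith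

text \<open>The kinds of nodes above the scratch cell carry different positive tags, whose codes
  cannot be the 0 used for \<open>One\<close>; the outputs with index below r lie under the scratch
  cell.\<close>

lemma addr_eq_iff [simp]: "addr r x = addr r y \<longleftrightarrow> x = y"
  by (cases x; cases y) (auto simp: prod_encode_neq_0 split: if_splits)

lemma addr_neq [simp]: "addr r x \<noteq> r" "r \<noteq> addr r x"
  by (cases x; auto)+

type_synonym summand = "bool \<times> node \<times> node"

text \<open>Each summand costs two operations, the product passing through the scratch cell. An
  empty list assigns 0, which serves for the cancelled constant coefficients of F - A and for k =
  0.\<close>

definition assign :: "nat \<Rightarrow> node \<Rightarrow> summand list \<Rightarrow> instr list" where
  "assign r c ts = Set_Zero (addr r c) # concat (map (\<lambda>(p, x, y). Mul r (addr r x) (addr r y) #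
     (if p then [Add (addr r c) (addr r c) r] else [Sub (addr r c) (addr r c) r])) ts)"

fun summand_value :: "(node \<Rightarrow> 'a::comm_ring_1) \<Rightarrow> summand \<Rightarrow> 'a" where
  "summand_value v (p, x, y) = (if p then v x * v y else - (v x * v y))"

text \<open>A Hoare triple for a fixed target valuation v: from memories correct on K the program
  succeeds, stays correct on K and becomes correct on D. Since the values are prescribed in advance,
  nothing needs to be said about other cells.\<close>

definition fills :: "nat \<Rightarrow> (nat \<Rightarrow> 'a::field) \<Rightarrow> (node \<Rightarrow> 'a) \<Rightarrow> instr list \<Rightarrow> node set \<Rightarrow> node set \<Rightarrow> bool" where
  "fills r inp v p K D \<longleftrightarrow> (\<forall>m. (\<forall>c\<in>K. m (addr r c) = v c) \<longrightarrow>
     (\<exists>m'. run inp p m = Some m' \<and> (\<forall>c\<in>K \<union> D. m' (addr r c) = v c)))"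

lemma run_append: "run inp (p @ q) m = Option.bind (run inp p m) (run inp q)"
  by (induction p arbitrary: m) (auto split: Option.bind_split)

lemma fills_mono: "fills r inp v p K D \<Longrightarrow> D' \<subseteq> K \<union> D \<Longrightarrow> fills r inp v p K D'"
  unfolding fills_def by blast

lemma fills_Nil: "fills r inp v [] K {}"
  by (simp add: fills_def)

lemma fills_append:
  assumes "fills r inp v p K D" "fills r inp v q (K \<union> D) E"
  shows "fills r inp v (p @ q) K (D \<union> E)"
  unfolding fills_def
proof (intro allI impI)
  fix m assume "\<forall>c\<in>K. m (addr r c) = v c"
  then obtain m1 where m1: "run inp p m = Some m1" "\<forall>c\<in>K \<union> D. m1 (addr r c) = v c"
    using assms(1) unfolding fills_def by blast
  then obtain m2 where "run inp q m1 = Some m2" "\<forall>c\<in>K \<union> D \<union> E. m2 (addr r c) = v c"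
    using assms(2) unfolding fills_def by blast
  then show "\<exists>m'. run inp (p @ q) m = Some m' \<and> (\<forall>c\<in>K \<union> (D \<union> E). m' (addr r c) = v c)"
    using m1 by (auto simp: run_append)
qed

lemma fills_if:
  assumes "b \<Longrightarrow> fills r inp v p K D"
  shows "fills r inp v (if b then p else []) K (if b then D else {})"
  using assms by (simp add: fills_Nil)

lemma fills_each:
  assumes "\<And>x K'. x \<in> set xs \<Longrightarrow> K \<subseteq> K' \<Longrightarrow> fills r inp v (body x) K' (D x)"
  shows "fills r inp v (concat (map body xs)) K (\<Union>x\<in>set xs. D x)"
  using assms
proof (induction xs arbitrary: K)
  case (Cons x xs)
  have "fills r inp v (body x) K (D x)" by (rule Cons.prems) auto
  moreover have "fills r inp v (concat (map body xs)) (K \<union> D x) (\<Union>x\<in>set xs. D x)"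
    by (rule Cons.IH) (use Cons.prems in auto)
  ultimately show ?case by (simp add: fills_append)
qed (simp add: fills_Nil)

text \<open>Iteration i may rely on what earlier iterations delivered; the arbitrary K' above K
  absorbs whatever else is known by then.\<close>

lemma fills_ordered:
  assumes "\<And>i K'. i < n \<Longrightarrow> K \<subseteq> K' \<Longrightarrow> (\<And>j. j < i \<Longrightarrow> D j \<subseteq> K') \<Longrightarrow> fills r inp v (body i) K' (D i)"
  shows "fills r inp v (concat (map body [0..<n])) K (\<Union>i<n. D i)"
  using assms
proof (induction n)
  case (Suc n)
  have "fills r inp v (concat (map body [0..<n])) K (\<Union>i<n. D i)"
    by (rule Suc.IH) (use Suc.prems in simp)
  moreover have "fills r inp v (body n) (K \<union> (\<Union>i<n. D i)) (D n)"
    by (rule Suc.prems) auto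
  ultimately show ?case
    using fills_append by (fastforce simp: lessThan_Suc Un_commute)
qed (simp add: fills_Nil)

lemma fills_assign:
  assumes ops: "\<And>p x y. (p, x, y) \<in> set ts \<Longrightarrow> x \<in> K \<and> y \<in> K \<and> x \<noteq> c \<and> y \<noteq> c"
    and val: "v c = (\<Sum>t\<leftarrow>ts. summand_value v t)"
  shows "fills r inp v (assign r c ts) K {c}"
  unfolding fills_def
proof (intro allI impI)
  fix m assume m: "\<forall>c\<in>K. m (addr r c) = v c"
  \<comment> \<open>During accumulation the cell of c holds a partial sum, even if c belongs to K.
    The invariant therefore exempts c, and operands have to differ from c.\<close>
  have run: "\<exists>m'. run inp (concat (map (\<lambda>(p, x, y). Mul r (addr r x) (addr r y) #
      (if p then [Add (addr r c) (addr r c) r] else [Sub (addr r c) (addr r c) r])) ts)) m = Some m' \<and>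
      m' (addr r c) = m (addr r c) + (\<Sum>t\<leftarrow>ts. summand_value v t) \<and>
      (\<forall>d. d \<noteq> c \<longrightarrow> m' (addr r d) = m (addr r d))"
    if "\<forall>d\<in>K. d \<noteq> c \<longrightarrow> m (addr r d) = v d" for m
    using that ops
  proof (induction ts arbitrary: m)
    case (Cons t ts)
    obtain p x y where t: "t = (p, x, y)" by (cases t)
    let ?m = "(m(r := m (addr r x) * m (addr r y)))(addr r c := m (addr r c) +
      (if p then m (addr r x) * m (addr r y) else - (m (addr r x) * m (addr r y))))"
    have xy: "m (addr r x) = v x" "m (addr r y) = v y"
      using Cons.prems t by auto
    have "\<forall>d\<in>K. d \<noteq> c \<longrightarrow> ?m (addr r d) = v d" using Cons.prems(1) by simp
    moreover have "x \<in> K \<and> y \<in> K \<and> x \<noteq> c \<and> y \<noteq> c" if "(p, x, y) \<in> set ts" for p x y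
      using Cons.prems(2)[of p x y] that by simp
    ultimately obtain m' where
      "run inp (concat (map (\<lambda>(p, x, y). Mul r (addr r x) (addr r y) #
      (if p then [Add (addr r c) (addr r c) r] else [Sub (addr r c) (addr r c) r])) ts)) ?m = Some m'"
      "m' (addr r c) = ?m (addr r c) + (\<Sum>t\<leftarrow>ts. summand_value v t)"
      "\<forall>d. d \<noteq> c \<longrightarrow> m' (addr r d) = ?m (addr r d)"
      using Cons.IH[of ?m] by blast
    then show ?case by (auto simp: t xy add.assoc)
  qed simp
  have "\<forall>d\<in>K. d \<noteq> c \<longrightarrow> (m(addr r c := 0)) (addr r d) = v d" using m by simp
  from run[OF this] obtain m' where m':
    "run inp (concat (map (\<lambda>(p, x, y). Mul r (addr r x) (addr r y) #
      (if p then [Add (addr r c) (addr r c) r] else [Sub (addr r c) (addr r c) r])) ts)) (m(addr r c := 0)) = Some m'"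
    "m' (addr r c) = (m(addr r c := 0)) (addr r c) + (\<Sum>t\<leftarrow>ts. summand_value v t)"
    "\<forall>d. d \<noteq> c \<longrightarrow> m' (addr r d) = (m(addr r c := 0)) (addr r d)" by blast
  have "run inp (assign r c ts) m = Some m'"
    using m'(1) by (simp add: assign_def)
  moreover have "m' (addr r d) = v d" if "d \<in> K \<union> {c}" for d
    using that m'(2,3) m val by (cases "d = c") auto
  ultimately show "\<exists>m'. run inp (assign r c ts) m = Some m' \<and> (\<forall>d\<in>K \<union> {c}. m' (addr r d) = v d)"
    by blast
qed

lemma fills_Load: "inp i = v c \<Longrightarrow> fills r inp v [Load (addr r c) i] K {c}"
  by (auto simp: fills_def)

lemma fills_One: "v c = 1 \<Longrightarrow> fills r inp v [Set_One (addr r c)] K {c}"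
  by (auto simp: fills_def)

section \<open>Enumeration of subsets and sums over nested loops\<close>

lemma set_decode_lessThan: assumes "x < 2 ^ k" shows "set_decode x \<subseteq> {..<k}"
proof
  fix i assume "i \<in> set_decode x"
  then have "odd (x div 2 ^ i)" by (simp add: set_decode_def)
  then have "0 < x div 2 ^ i" by (rule odd_pos)
  then have "2 ^ i \<le> x" by (simp add: div_greater_zero_iff)
  then have "(2::nat) ^ i < 2 ^ k" using assms by linarith
  then show "i \<in> {..<k}" by simp
qed

lemma set_encode_less: assumes "A \<subseteq> {..<k}" shows "set_encode A < 2 ^ k"
proof -
  have "set_encode A \<le> (\<Sum>i<k. 2 ^ i)"
    unfolding set_encode_def using assms by (intro sum_mono2) auto
  also have "\<dots> < (2::nat) ^ k" by (induction k) auto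
  finally show ?thesis .
qed

lemma set_subsets: "set (subsets k) = Pow {..<k}"
proof
  show "Pow {..<k} \<subseteq> set (subsets k)"
  proof
    fix A assume "A \<in> Pow {..<k}"
    then have "set_encode A < 2 ^ k" "set_decode (set_encode A) = A"
      using set_encode_less[of A k] finite_subset[of A "{..<k}"] by auto
    then show "A \<in> set (subsets k)" unfolding subsets_def by (force intro: image_eqI[of _ _ "set_encode A"])
  qed
qed (auto simp: subsets_def dest: subsetD[OF set_decode_lessThan])

lemma distinct_subsets: "distinct (subsets k)"
  by (auto simp: subsets_def distinct_map intro!: inj_on_inverseI[of _ set_encode])

lemma sum_list_subsets: "(\<Sum>X\<leftarrow>subsets k. f X) = (\<Sum>X\<in>Pow {..<k}. f X)"
  using distinct_subsets[of k] by (simp add: sum_list_distinct_conv_sum_set set_subsets)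

lemma sum_list_upt: "(\<Sum>i\<leftarrow>[0..<n]. f i) = (\<Sum>i<n. f i)"
  by (simp add: interv_sum_list_conv_sum_set_nat lessThan_atLeast0)

lemma sum_list_map_concat:
  "(\<Sum>t\<leftarrow>concat (map g xs). f t) = (\<Sum>x\<leftarrow>xs. \<Sum>t\<leftarrow>g x. (f t :: 'b::comm_monoid_add))"
  by (induction xs) auto

lemma sum_list_if: "(\<Sum>t\<leftarrow>(if b then ts else []). f t) = (if b then \<Sum>t\<leftarrow>ts. f t else 0)"
  by simp

text \<open>These evaluate sums over summand lists that are built by nested loops. With
  \<open>summand_value\<close> they give the value of a node, with the constant 1 the number of its
  summands.\<close>

lemmas loop_sums = sum_list_map_concat sum_list_if sum_list_subsets sum_list_upt map_map o_def

text \<open>Sets with smaller codes have been treated before X; by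
  \<open>set_encode_Diff_less\<close> this covers X with one element removed.\<close>

lemma fills_subsets:
  assumes "\<And>X K'. X \<subseteq> {..<k} \<Longrightarrow> K \<subseteq> K' \<Longrightarrow>
    (\<And>Z. Z \<subseteq> {..<k} \<Longrightarrow> set_encode Z < set_encode X \<Longrightarrow> D Z \<subseteq> K') \<Longrightarrow> fills r inp v (body X) K' (D X)"
  shows "fills r inp v (concat (map body (subsets k))) K (\<Union>X\<in>Pow {..<k}. D X)"
proof -
  have "fills r inp v (concat (map (\<lambda>i. body (set_decode i)) [0..<2 ^ k])) K (\<Union>i<2 ^ k. D (set_decode i))"
  proof (rule fills_ordered)
    fix i K' assume *: "i < 2 ^ k" "K \<subseteq> K'" "\<And>j. j < i \<Longrightarrow> D (set_decode j) \<subseteq> K'"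
    show "fills r inp v (body (set_decode i)) K' (D (set_decode i))"
    proof (rule assms)
      fix Z assume "Z \<subseteq> {..<k}" "set_encode Z < set_encode (set_decode i)"
      then show "D Z \<subseteq> K'"
        using *(3)[of "set_encode Z"] finite_subset[of Z "{..<k}"] by simp
    qed (use * set_decode_lessThan in auto)
  qed
  moreover have "(\<Union>X\<in>Pow {..<k}. D X) = (\<Union>i<2 ^ k. D (set_decode i))"
  proof -
    have "Pow {..<k} = set_decode ` {..<2 ^ k}"
      using set_subsets[of k] by (simp add: subsets_def atLeast0LessThan)
    then show ?thesis by simp
  qed
  ultimately show ?thesis by (simp add: subsets_def comp_def)
qed

lemma set_encode_Diff_less: assumes "finite X" "m \<in> X" shows "set_encode (X - {m}) < set_encode X"
proof -
  have "set_encode (insert m (X - {m})) = 2 ^ m + set_encode (X - {m})"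
    using assms by (intro set_encode_insert) auto
  then show ?thesis using assms by (simp add: insert_absorb)
qed

lemma concat_map_concat:
  "concat (map f (concat (map g xs))) = concat (map (\<lambda>x. concat (map f (g x))) xs)"
  by (induction xs) auto

lemma concat_map_if: "concat (map f (if b then xs else ys)) = (if b then concat (map f xs) else concat (map f ys))"
  by simp

lemma concat_map_single: "concat (map f [x]) = f x"
  by simp

section \<open>The programs\<close>

text \<open>Coefficient of t^s in the expansion along the least row m of X; l splits the degree
  between the entry and the smaller minor. The least row is found by a loop with a test, which keeps
  the generator within the constructs known to be computable.\<close>

definition minor_summands :: "nat \<Rightarrow> bool \<Rightarrow> bool \<Rightarrow> nat set \<Rightarrow> nat set \<Rightarrow> nat \<Rightarrow> summand list" where
  "minor_summands k q b X Y s =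
    (if X = {} then (if Y = {} \<and> s = 0 then [(True, One, One)] else [])
     else concat (map (\<lambda>m. if m \<in> X \<and> (\<forall>x\<in>X. m \<le> x)
       then concat (map (\<lambda>j. if j \<in> Y
         then map (\<lambda>l. (\<not> (b \<and> odd (card {y \<in> Y. y < j})), Entry q m j l,
           Minor q b (set_encode (X - {m})) (set_encode (Y - {j})) (s - l))) [0..<Suc s]
         else []) [0..<k])
       else []) [0..<k]))"

text \<open>The precomputation uses w = Suc k and R = 1, as the complementary minors of A are
  constants of any size; a query uses w = R = r.\<close>

definition minors_prog :: "nat \<Rightarrow> nat \<Rightarrow> bool \<Rightarrow> nat \<Rightarrow> nat \<Rightarrow> instr list" where
  "minors_prog k r q w R = concat (map (\<lambda>X. concat (map (\<lambda>Y. if card X < w \<and> card Y < w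
     then concat (map (\<lambda>s.
         assign r (Minor q True (set_encode X) (set_encode Y) s) (minor_summands k q True X Y s) @
         assign r (Minor q False (set_encode X) (set_encode Y) s) (minor_summands k q False X Y s)) [0..<R])
     else []) (subsets k))) (subsets k))"

definition load_matrix :: "nat \<Rightarrow> nat \<Rightarrow> instr list" where
  "load_matrix k r = concat (map (\<lambda>i. concat (map (\<lambda>j.
     [Load (addr r (Entry False i j 0)) (i * k + j)]) [0..<k])) [0..<k])"

text \<open>With \<open>l0 = 1\<close> this loads $F - A$, with \<open>l0 = 0\<close> all of $F$.\<close>

definition load_query :: "nat \<Rightarrow> nat \<Rightarrow> nat \<Rightarrow> instr list" where
  "load_query k r l0 = concat (map (\<lambda>i. concat (map (\<lambda>j. concat (map (\<lambda>l.
     if l < l0 then assign r (Entry True i j l) []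
     else [Load (addr r (Entry True i j l)) ((i * k + j) * r + l)]) [0..<r])) [0..<k])) [0..<k])"

text \<open>The test on S is made at generation time: for given P and Q, each S produces a summand
  in at most one entry Z.\<close>

definition table_summands :: "nat \<Rightarrow> nat set \<Rightarrow> nat set \<Rightarrow> nat set \<Rightarrow> summand list" where
  "table_summands k P Q Z = concat (map (\<lambda>S. if 0 \<in> S \<and> S \<inter> (P \<union> Q) = Z
     then [(even (exchange_sign P Q S), Minor False True (set_encode (S - P)) (set_encode (S - Q)) 0,
       Minor False False (set_encode ({..<k} - S - P)) (set_encode ({..<k} - S - Q)) 0)]
     else []) (subsets k))"

definition table_prog :: "nat \<Rightarrow> nat \<Rightarrow> instr list" where
  "table_prog k r = concat (map (\<lambda>P. concat (map (\<lambda>Q. if card P < r \<and> card Q < r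
     then concat (map (\<lambda>Z. assign r (Table (set_encode P) (set_encode Q) (set_encode Z))
       (table_summands k P Q Z)) (subsets k))
     else []) (subsets k))) (subsets k))"

definition prod_summands :: "nat set \<Rightarrow> nat set \<Rightarrow> nat set \<Rightarrow> nat \<Rightarrow> summand list" where
  "prod_summands P Q Z s = map (\<lambda>l. (True, Minor True True (set_encode (P \<inter> Z)) (set_encode (Q \<inter> Z)) l,
     Minor True False (set_encode (P - Z)) (set_encode (Q - Z)) (s - l))) [0..<Suc s]"

definition prod_prog :: "nat \<Rightarrow> nat \<Rightarrow> instr list" where
  "prod_prog k r = concat (map (\<lambda>P. concat (map (\<lambda>Q. if card P < r \<and> card Q < r
     then concat (map (\<lambda>Z. if Z \<subseteq> P \<union> Q
       then concat (map (\<lambda>s. assign r (Prod (set_encode P) (set_encode Q) (set_encode Z) s)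
         (prod_summands P Q Z s)) [0..<r])
       else []) (subsets k))
     else []) (subsets k))) (subsets k))"

definition out_summands :: "nat \<Rightarrow> nat \<Rightarrow> nat \<Rightarrow> summand list" where
  "out_summands k r s = concat (map (\<lambda>P. concat (map (\<lambda>Q. if card P < r \<and> card Q < r
     then concat (map (\<lambda>Z. if Z \<subseteq> P \<union> Q
       then [(True, Prod (set_encode P) (set_encode Q) (set_encode Z) s,
         Table (set_encode P) (set_encode Q) (set_encode Z))]
       else []) (subsets k))
     else []) (subsets k))) (subsets k))"

definition out_prog :: "nat \<Rightarrow> nat \<Rightarrow> instr list" where
  "out_prog k r = concat (map (\<lambda>s. assign r (Out s) (out_summands k r s)) [0..<r])"

definition path_summands :: "nat \<Rightarrow> nat set \<Rightarrow> nat \<Rightarrow> nat \<Rightarrow> summand list" where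
  "path_summands k X a s = (if X = {} then [(True, One, Entry True a 0 s)]
     else concat (map (\<lambda>b. if b \<in> X
       then map (\<lambda>l. (True, Entry True a b l, Path (set_encode (X - {b})) b (s - l))) [0..<Suc s]
       else []) [0..<k]))"

definition path_prog :: "nat \<Rightarrow> nat \<Rightarrow> instr list" where
  "path_prog k r = concat (map (\<lambda>X. concat (map (\<lambda>a. concat (map (\<lambda>s.
     assign r (Path (set_encode X) a s) (path_summands k X a s)) [0..<r])) [0..<k])) (subsets k))"

text \<open>Multiplication by \<open>One\<close> serves as copying. For k = 0 the empty assignment
  writes 0, in agreement with \<open>hc_dim_0\<close>.\<close>

definition path_out_prog :: "nat \<Rightarrow> nat \<Rightarrow> instr list" where
  "path_out_prog k r = concat (map (\<lambda>s. assign r (Out s)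
     (if 0 < k then [(True, One, Path (set_encode ({..<k} - {0})) 0 s)] else [])) [0..<r])"

definition pre :: "nat \<Rightarrow> nat \<Rightarrow> instr list" where
  "pre k r = (if 2 * r \<le> k
     then Set_One (addr r One) # load_matrix k r @ minors_prog k r False (Suc k) 1 @ table_prog k r
     else [])"

definition query :: "nat \<Rightarrow> nat \<Rightarrow> instr list" where
  "query k r = (if 2 * r \<le> k
     then load_query k r 1 @ minors_prog k r True r r @ prod_prog k r @ out_prog k r
     else Set_One (addr r One) # load_query k r 0 @ path_prog k r @ path_out_prog k r)"

lemmas prog_unfold = assign_def minor_summands_def minors_prog_def load_matrix_def load_query_def
  table_summands_def table_prog_def prod_summands_def prod_prog_def out_summands_def out_prog_def
  path_summands_def path_prog_def path_out_prog_def
  concat_map_concat concat_map_if concat_map_single map_map o_def prod.case addr.simps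
  exchange_sign_def inv_count_def list.map concat.simps

lemma uniform_family_pre: "uniform_family pre"
proof (rule uniform_familyI)
  show "computable_prog (\<lambda>x. pre (dfst x) (dsnd x))"
    unfolding pre_def prog_unfold by (intro computable_intros computable_if)
qed

lemma uniform_family_query: "uniform_family query"
proof (rule uniform_familyI)
  show "computable_prog (\<lambda>x. query (dfst x) (dsnd x))"
    unfolding query_def prog_unfold by (intro computable_intros computable_if)
qed

section \<open>Correctness\<close>

text \<open>The entries of A are polynomials so that minors of both matrices live in one ring; for
  constant entries, as in \<open>coeff_hc_add\<close>, coefficient 0 loses nothing.\<close>

definition table_value :: "nat \<Rightarrow> (nat \<Rightarrow> nat \<Rightarrow> 'a::field poly) \<Rightarrow> nat set \<Rightarrow> nat set \<Rightarrow> nat set \<Rightarrow> 'a" where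
  "table_value k A P Q Z = (\<Sum>S | S \<subseteq> {..<k} \<and> 0 \<in> S \<and> S \<inter> (P \<union> Q) = Z.
     (- 1) ^ exchange_sign P Q S * (coeff (minor True A (S - P) (S - Q)) 0 *
       coeff (minor False A ({..<k} - S - P) ({..<k} - S - Q)) 0))"

text \<open>The answer h is an independent parameter: the earlier phases are correct for every h,
  and only the output phase has to show that h is what it sums up.\<close>

fun node_value :: "nat \<Rightarrow> (bool \<Rightarrow> nat \<Rightarrow> nat \<Rightarrow> 'a::field poly) \<Rightarrow> 'a poly \<Rightarrow> node \<Rightarrow> 'a" where
  "node_value k M h One = 1"
| "node_value k M h (Entry q i j l) = coeff (M q i j) l"
| "node_value k M h (Minor q b x y s) = coeff (minor b (M q) (set_decode x) (set_decode y)) s"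
| "node_value k M h (Table p q z) = table_value k (M False) (set_decode p) (set_decode q) (set_decode z)"
| "node_value k M h (Prod p q z s) =
    coeff (minor True (M True) (set_decode p \<inter> set_decode z) (set_decode q \<inter> set_decode z) *
      minor False (M True) (set_decode p - set_decode z) (set_decode q - set_decode z)) s"
| "node_value k M h (Path x a s) = coeff (held_karp (M True) (set_decode x) a) s"
| "node_value k M h (Out s) = coeff h s"

definition entry_nodes :: "bool \<Rightarrow> nat \<Rightarrow> nat \<Rightarrow> node set" where
  "entry_nodes q k R = {Entry q i j l |i j l. i < k \<and> j < k \<and> l < R}"

definition minor_nodes :: "bool \<Rightarrow> nat \<Rightarrow> nat \<Rightarrow> nat \<Rightarrow> node set" where
  "minor_nodes q k w R = {Minor q b (set_encode X) (set_encode Y) s |b X Y s.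
     X \<subseteq> {..<k} \<and> Y \<subseteq> {..<k} \<and> card X < w \<and> card Y < w \<and> s < R}"

definition table_nodes :: "nat \<Rightarrow> nat \<Rightarrow> node set" where
  "table_nodes k r = {Table (set_encode P) (set_encode Q) (set_encode Z) |P Q Z.
     P \<subseteq> {..<k} \<and> Q \<subseteq> {..<k} \<and> Z \<subseteq> {..<k} \<and> card P < r \<and> card Q < r}"

definition prod_nodes :: "nat \<Rightarrow> nat \<Rightarrow> node set" where
  "prod_nodes k r = {Prod (set_encode P) (set_encode Q) (set_encode Z) s |P Q Z s.
     P \<subseteq> {..<k} \<and> Q \<subseteq> {..<k} \<and> Z \<subseteq> P \<union> Q \<and> card P < r \<and> card Q < r \<and> s < r}"

definition path_nodes :: "nat \<Rightarrow> nat \<Rightarrow> node set" where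
  "path_nodes k r = {Path (set_encode X) a s |X a s. X \<subseteq> {..<k} \<and> a < k \<and> s < r}"

lemma decode_encode: "X \<subseteq> {..<k::nat} \<Longrightarrow> set_decode (set_encode X) = X"
  by (rule set_encode_inverse) (rule finite_subset[OF _ finite_lessThan])

lemma sum_if_mem:
  assumes "X \<subseteq> {..<k::nat}"
  shows "(\<Sum>i<k. if i \<in> X then f i else 0) = (\<Sum>i\<in>X. f i :: 'b::comm_monoid_add)"
  using assms by (simp add: Int_absorb1 flip: sum.inter_restrict)

lemma sum_list_minor_summands:
  assumes X: "X \<subseteq> {..<k}" "m \<in> X" "\<forall>x\<in>X. m \<le> x" and Y: "Y \<subseteq> {..<k}"
  shows "(\<Sum>t\<leftarrow>minor_summands k q b X Y s. f t) =
    (\<Sum>j\<in>Y. \<Sum>l<Suc s. f (\<not> (b \<and> odd (card {y \<in> Y. y < j})), Entry q m j l,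
       Minor q b (set_encode (X - {m})) (set_encode (Y - {j})) (s - l)) :: 'b::comm_monoid_add)"
proof -
  have least: "i \<in> X \<and> (\<forall>x\<in>X. i \<le> x) \<longleftrightarrow> i = m" for i
    using X by (meson antisym)
  have ne: "X \<noteq> {}" "m < k" using X by auto
  show ?thesis
    unfolding minor_summands_def loop_sums least if_not_P[OF ne(1)] sum_if_mem[OF Y]
    using ne(2) by (simp add: sum.delta)
qed

lemma minor_summands_operands:
  assumes "(p, x, y) \<in> set (minor_summands k q b X Y s)"
  shows "x = One \<and> y = One \<or> (\<exists>m j l. m \<in> X \<and> j \<in> Y \<and> m < k \<and> j < k \<and> l \<le> s \<and> x = Entry q m j l \<and>
    y = Minor q b (set_encode (X - {m})) (set_encode (Y - {j})) (s - l))"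
  using assms by (auto simp: minor_summands_def split: if_splits)

lemma minor_summands_value:
  assumes X: "X \<subseteq> {..<k}" and Y: "Y \<subseteq> {..<k}"
  shows "coeff (minor b (M q) X Y) s = (\<Sum>t\<leftarrow>minor_summands k q b X Y s. summand_value (node_value k M h) t)"
proof (cases "X = {}")
  case True
  have fin: "finite Y" using Y finite_subset by blast
  have "minor b (M q) {} Y = (if Y = {} then 1 else 0)"
    using fin by (auto intro: minor_eq_0)
  then show ?thesis using True by (auto simp: minor_summands_def)
next
  case False
  have fin: "finite X" "finite Y" using X Y finite_subset by blast+
  define m where "m = Min X"
  have m: "m \<in> X" "\<forall>x\<in>X. m \<le> x" using fin False by (auto simp: m_def)
  have sub: "X - {m} \<subseteq> {..<k}" "Y - {j} \<subseteq> {..<k}" for j using X Y by auto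
  show ?thesis
    unfolding sum_list_minor_summands[OF X m Y] minor_row_expansion[OF fin m] coeff_sum
  proof (intro sum.cong refl)
    fix j
    have "coeff (M q m j * minor b (M q) (X - {m}) (Y - {j})) s =
        (\<Sum>l<Suc s. coeff (M q m j) l * coeff (minor b (M q) (X - {m}) (Y - {j})) (s - l))"
      unfolding coeff_mult by (simp add: lessThan_Suc_atMost)
    then show "coeff ((if b then (- 1) ^ card {y \<in> Y. y < j} else 1) *
        (M q m j * minor b (M q) (X - {m}) (Y - {j}))) s =
      (\<Sum>l<Suc s. summand_value (node_value k M h) (\<not> (b \<and> odd (card {y \<in> Y. y < j})), Entry q m j l,
        Minor q b (set_encode (X - {m})) (set_encode (Y - {j})) (s - l)))"
      by (auto simp: decode_encode[OF sub(1)] decode_encode[OF sub(2)] minus_one_power_iff sum_negf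
          simp del: sum.lessThan_Suc)
  qed
qed

lemma fills_minors:
  assumes K: "One \<in> K" "entry_nodes q k R \<subseteq> K"
  shows "fills r inp (node_value k M h) (minors_prog k r q w R) K (minor_nodes q k w R)"
proof -
  define D where "D X = {Minor q b (set_encode X) (set_encode Y) s |b Y s.
     Y \<subseteq> {..<k} \<and> card X < w \<and> card Y < w \<and> s < R}" for X
  have "fills r inp (node_value k M h) (minors_prog k r q w R) K (\<Union>X\<in>Pow {..<k}. D X)"
    unfolding minors_prog_def
  proof (rule fills_subsets)
    fix X K1 assume X: "X \<subseteq> {..<k}" and K1: "K \<subseteq> K1"
      and prev: "\<And>Z. Z \<subseteq> {..<k} \<Longrightarrow> set_encode Z < set_encode X \<Longrightarrow> D Z \<subseteq> K1"
    have asg: "fills r inp (node_value k M h)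
        (assign r (Minor q b (set_encode X) (set_encode Y) s) (minor_summands k q b X Y s)) K2
        {Minor q b (set_encode X) (set_encode Y) s}"
      if Y: "Y \<subseteq> {..<k}" and w: "card X < w" "card Y < w" and s: "s < R" and K2: "K1 \<subseteq> K2" for b Y s K2
    proof (rule fills_assign)
      show "node_value k M h (Minor q b (set_encode X) (set_encode Y) s) =
          (\<Sum>t\<leftarrow>minor_summands k q b X Y s. summand_value (node_value k M h) t)"
        by (simp add: decode_encode[OF X] decode_encode[OF Y] minor_summands_value[OF X Y])
      fix p x y assume "(p, x, y) \<in> set (minor_summands k q b X Y s)"
      from minor_summands_operands[OF this]
      show "x \<in> K2 \<and> y \<in> K2 \<and> x \<noteq> Minor q b (set_encode X) (set_encode Y) s \<and>
          y \<noteq> Minor q b (set_encode X) (set_encode Y) s"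
      proof (elim disjE exE conjE)
        fix m j l assume *: "m \<in> X" "j \<in> Y" "m < k" "j < k" "l \<le> s" "x = Entry q m j l"
          "y = Minor q b (set_encode (X - {m})) (set_encode (Y - {j})) (s - l)"
        have fin: "finite X" "finite Y" using X Y finite_subset by blast+
        \<comment> \<open>Only the row set has to precede X, because D (X - {m}) contains the minors
          for all admissible column sets and all degrees.\<close>
        have less: "set_encode (X - {m}) < set_encode X"
          by (rule set_encode_Diff_less) (use fin * in auto)
        have "card (X - {m}) < w" "card (Y - {j}) < w"
          using w fin by (meson Diff_subset card_mono le_less_trans)+
        then have "y \<in> D (X - {m})"
          unfolding D_def *(7) using s Y by (force intro: less_imp_diff_less)
        then have "y \<in> K2" using prev[OF _ less] X K2 by blast
        moreover have "x \<in> K2"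
          using * s K(2) K1 K2 by (auto simp: entry_nodes_def subset_iff)
        ultimately show ?thesis using *(6,7) less by simp
      qed (use K(1) K1 K2 in auto)
    qed
    let ?E = "\<lambda>Y. if card X < w \<and> card Y < w then (\<Union>s\<in>set [0..<R].
        {Minor q True (set_encode X) (set_encode Y) s} \<union> {Minor q False (set_encode X) (set_encode Y) s}) else {}"
    have "fills r inp (node_value k M h) (concat (map (\<lambda>Y. if card X < w \<and> card Y < w
        then concat (map (\<lambda>s.
          assign r (Minor q True (set_encode X) (set_encode Y) s) (minor_summands k q True X Y s) @
          assign r (Minor q False (set_encode X) (set_encode Y) s) (minor_summands k q False X Y s)) [0..<R])
        else []) (subsets k))) K1 (\<Union>Y\<in>set (subsets k). ?E Y)"
      by (intro fills_each fills_if fills_append asg) (auto simp: set_subsets)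
    then show "fills r inp (node_value k M h) (concat (map (\<lambda>Y. if card X < w \<and> card Y < w
        then concat (map (\<lambda>s.
          assign r (Minor q True (set_encode X) (set_encode Y) s) (minor_summands k q True X Y s) @
          assign r (Minor q False (set_encode X) (set_encode Y) s) (minor_summands k q False X Y s)) [0..<R])
        else []) (subsets k))) K1 (D X)"
    proof (rule fills_mono)
      show "D X \<subseteq> K1 \<union> (\<Union>Y\<in>set (subsets k). ?E Y)"
      proof
        fix c assume "c \<in> D X"
        then obtain b Y s where c: "c = Minor q b (set_encode X) (set_encode Y) s"
          "Y \<subseteq> {..<k}" "card X < w" "card Y < w" "s < R" unfolding D_def by blast
        have "c \<in> ?E Y" using c by (cases b) auto
        moreover have "Y \<in> set (subsets k)" using c by (simp add: set_subsets)
        ultimately show "c \<in> K1 \<union> (\<Union>Y\<in>set (subsets k). ?E Y)" by blast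
      qed
    qed
  qed
  then show ?thesis
    by (rule fills_mono) (auto simp: minor_nodes_def D_def)
qed

lemma fills_load_matrix:
  assumes A: "A \<in> carrier_mat k k" and M: "\<And>i j. i < k \<Longrightarrow> j < k \<Longrightarrow> coeff (M False i j) 0 = A $$ (i, j)"
  shows "fills r (matrix_input A) (node_value k M h) (load_matrix k r) K (entry_nodes False k 1)"
proof -
  have "matrix_input A (i * k + j) = coeff (M False i j) 0" if "i < k" "j < k" for i j
  proof -
    have "Suc i * k \<le> k * k" using that by (intro mult_le_mono1) simp
    then have "i * k + j < k * k" using that by simp
    then show ?thesis using A that M by (simp add: matrix_input_def)
  qed
  then have "fills r (matrix_input A) (node_value k M h) (load_matrix k r) K
      (\<Union>i\<in>set [0..<k]. \<Union>j\<in>set [0..<k]. {Entry False i j 0})"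
    unfolding load_matrix_def by (intro fills_each fills_Load) auto
  then show ?thesis by (rule fills_mono) (auto simp: entry_nodes_def)
qed

lemma fills_load_query:
  assumes F: "F \<in> carrier_mat k k"
    and M: "\<And>i j l. i < k \<Longrightarrow> j < k \<Longrightarrow> l < r \<Longrightarrow>
      coeff (M True i j) l = (if l < l0 then 0 else coeff (F $$ (i, j)) l)"
  shows "fills r (poly_matrix_input r F) (node_value k M h) (load_query k r l0) K (entry_nodes True k r)"
proof -
  have inp: "poly_matrix_input r F ((i * k + j) * r + l) = coeff (F $$ (i, j)) l"
    if "i < k" "j < k" "l < r" for i j l
  proof -
    have "Suc i * k \<le> k * k" using that by (intro mult_le_mono1) simp
    then have "Suc (i * k + j) * r \<le> k * k * r" using that by (intro mult_le_mono1) simp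
    then have "(i * k + j) * r + l < k * k * r" using that by simp
    then show ?thesis using F that by (simp add: poly_matrix_input_def)
  qed
  let ?body = "\<lambda>i j l. if l < l0 then assign r (Entry True i j l) []
     else [Load (addr r (Entry True i j l)) ((i * k + j) * r + l)]"
  have "fills r (poly_matrix_input r F) (node_value k M h) (?body i j l) K' {Entry True i j l}"
    if "i < k" "j < k" "l < r" for i j l K'
  proof (cases "l < l0")
    case True
    then have "node_value k M h (Entry True i j l) = 0" using M that by simp
    then show ?thesis unfolding if_P[OF True] by (intro fills_assign) simp_all
  next
    case False
    then have "poly_matrix_input r F ((i * k + j) * r + l) = node_value k M h (Entry True i j l)"
      using M that inp by simp
    then show ?thesis unfolding if_not_P[OF False] by (rule fills_Load)
  qed
  then have "fills r (poly_matrix_input r F) (node_value k M h) (load_query k r l0) K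
      (\<Union>i\<in>set [0..<k]. \<Union>j\<in>set [0..<k]. \<Union>l\<in>set [0..<r]. {Entry True i j l})"
    unfolding load_query_def by (intro fills_each) auto
  then show ?thesis by (rule fills_mono) (auto simp: entry_nodes_def)
qed

lemma sum_list_table_summands:
  "(\<Sum>t\<leftarrow>table_summands k P Q Z. f t) = (\<Sum>S | S \<subseteq> {..<k} \<and> 0 \<in> S \<and> S \<inter> (P \<union> Q) = Z.
    f (even (exchange_sign P Q S), Minor False True (set_encode (S - P)) (set_encode (S - Q)) 0,
       Minor False False (set_encode ({..<k} - S - P)) (set_encode ({..<k} - S - Q)) 0) :: 'b::comm_monoid_add)"
proof -
  have "{S. S \<subseteq> {..<k} \<and> 0 \<in> S \<and> S \<inter> (P \<union> Q) = Z} = {S \<in> Pow {..<k}. 0 \<in> S \<and> S \<inter> (P \<union> Q) = Z}"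
    by auto
  then show ?thesis
    unfolding table_summands_def loop_sums by (simp only: sum.inter_filter finite_Pow_iff finite_lessThan)
      (simp add: if_distrib cong: if_cong)
qed

lemma fills_table:
  assumes K: "minor_nodes False k (Suc k) 1 \<subseteq> K"
  shows "fills r inp (node_value k M h) (table_prog k r) K (table_nodes k r)"
proof -
  have minor: "Minor False b (set_encode X) (set_encode Y) 0 \<in> K" if "X \<subseteq> {..<k}" "Y \<subseteq> {..<k}" for b X Y
  proof -
    have "card X < Suc k" "card Y < Suc k"
      using that card_mono[of "{..<k}"] by (auto simp: less_Suc_eq_le)
    then show ?thesis using that K by (fastforce simp: minor_nodes_def)
  qed
  have asg: "fills r inp (node_value k M h) (assign r (Table (set_encode P) (set_encode Q) (set_encode Z))
      (table_summands k P Q Z)) K' {Table (set_encode P) (set_encode Q) (set_encode Z)}"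
    if "K \<subseteq> K'" "P \<subseteq> {..<k}" "Q \<subseteq> {..<k}" "Z \<subseteq> {..<k}" for P Q Z K'
  proof (rule fills_assign)
    fix p x y assume "(p, x, y) \<in> set (table_summands k P Q Z)"
    then obtain S where S: "S \<subseteq> {..<k}"
      "x = Minor False True (set_encode (S - P)) (set_encode (S - Q)) 0"
      "y = Minor False False (set_encode ({..<k} - S - P)) (set_encode ({..<k} - S - Q)) 0"
      by (auto simp: table_summands_def set_subsets split: if_splits)
    have "x \<in> K" unfolding S(2) by (rule minor) (use S(1) in auto)
    moreover have "y \<in> K" unfolding S(3) by (rule minor) auto
    ultimately show "x \<in> K' \<and> y \<in> K' \<and> x \<noteq> Table (set_encode P) (set_encode Q) (set_encode Z) \<and>
      y \<noteq> Table (set_encode P) (set_encode Q) (set_encode Z)" using S that by auto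
  next
    have dec: "set_decode (set_encode (S - X)) = S - X"
      "set_decode (set_encode ({..<k} - S - X)) = {..<k} - S - X" if "S \<subseteq> {..<k}" for S X
      using that by (intro decode_encode[of _ k]; auto)+
    show "node_value k M h (Table (set_encode P) (set_encode Q) (set_encode Z)) =
        (\<Sum>t\<leftarrow>table_summands k P Q Z. summand_value (node_value k M h) t)"
      unfolding sum_list_table_summands
      by (simp add: decode_encode[OF that(2)] decode_encode[OF that(3)] decode_encode[OF that(4)]
          table_value_def) (intro sum.cong refl, simp add: dec minus_one_power_iff)
  qed
  have "fills r inp (node_value k M h) (table_prog k r) K (\<Union>P\<in>set (subsets k). \<Union>Q\<in>set (subsets k).
      if card P < r \<and> card Q < r then (\<Union>Z\<in>set (subsets k). {Table (set_encode P) (set_encode Q) (set_encode Z)}) else {})"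
    unfolding table_prog_def by (intro fills_each fills_if asg) (auto simp: set_subsets)
  then show ?thesis
    by (rule fills_mono) (force simp: table_nodes_def set_subsets)
qed

lemma fills_prod:
  assumes K: "minor_nodes True k r r \<subseteq> K"
  shows "fills r inp (node_value k M h) (prod_prog k r) K (prod_nodes k r)"
proof -
  have asg: "fills r inp (node_value k M h) (assign r (Prod (set_encode P) (set_encode Q) (set_encode Z) s)
      (prod_summands P Q Z s)) K' {Prod (set_encode P) (set_encode Q) (set_encode Z) s}"
    if "K \<subseteq> K'" "P \<subseteq> {..<k}" "Q \<subseteq> {..<k}" "Z \<subseteq> {..<k}" "card P < r" "card Q < r" "s < r" for P Q Z s K'
  proof (rule fills_assign)
    have minor: "Minor True b (set_encode X) (set_encode Y) l \<in> K" if "X \<subseteq> P" "Y \<subseteq> Q" "l \<le> s" for b X Y l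
    proof -
      have "finite P" "finite Q" using \<open>P \<subseteq> {..<k}\<close> \<open>Q \<subseteq> {..<k}\<close> finite_subset by blast+
      then have "card X < r" "card Y < r" "X \<subseteq> {..<k}" "Y \<subseteq> {..<k}" "l < r"
        using that \<open>P \<subseteq> {..<k}\<close> \<open>Q \<subseteq> {..<k}\<close> \<open>card P < r\<close> \<open>card Q < r\<close> \<open>s < r\<close>
          card_mono[of P X] card_mono[of Q Y] by auto
      then show ?thesis using K unfolding minor_nodes_def by blast
    qed
    fix p x y assume "(p, x, y) \<in> set (prod_summands P Q Z s)"
    then show "x \<in> K' \<and> y \<in> K' \<and> x \<noteq> Prod (set_encode P) (set_encode Q) (set_encode Z) s \<and>
      y \<noteq> Prod (set_encode P) (set_encode Q) (set_encode Z) s"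
      using minor \<open>K \<subseteq> K'\<close> by (auto simp: prod_summands_def)
  next
    have sub: "P \<inter> Z \<subseteq> {..<k}" "Q \<inter> Z \<subseteq> {..<k}" "P - Z \<subseteq> {..<k}" "Q - Z \<subseteq> {..<k}" using that by auto
    show "node_value k M h (Prod (set_encode P) (set_encode Q) (set_encode Z) s) =
        (\<Sum>t\<leftarrow>prod_summands P Q Z s. summand_value (node_value k M h) t)"
      unfolding prod_summands_def loop_sums
      by (simp only: node_value.simps summand_value.simps if_True decode_encode[OF that(2)]
          decode_encode[OF that(3)] decode_encode[OF that(4)] decode_encode[OF sub(1)]
          decode_encode[OF sub(2)] decode_encode[OF sub(3)] decode_encode[OF sub(4)] coeff_mult lessThan_Suc_atMost)
  qed
  have "fills r inp (node_value k M h) (prod_prog k r) K (\<Union>P\<in>set (subsets k). \<Union>Q\<in>set (subsets k).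
      if card P < r \<and> card Q < r then (\<Union>Z\<in>set (subsets k). if Z \<subseteq> P \<union> Q then
        (\<Union>s\<in>set [0..<r]. {Prod (set_encode P) (set_encode Q) (set_encode Z) s}) else {}) else {})"
    unfolding prod_prog_def by (intro fills_each fills_if asg) (auto simp: set_subsets)
  then show ?thesis
  proof (rule fills_mono)
    show "prod_nodes k r \<subseteq> K \<union> (\<Union>P\<in>set (subsets k). \<Union>Q\<in>set (subsets k).
      if card P < r \<and> card Q < r then (\<Union>Z\<in>set (subsets k). if Z \<subseteq> P \<union> Q then
        (\<Union>s\<in>set [0..<r]. {Prod (set_encode P) (set_encode Q) (set_encode Z) s}) else {}) else {})"
    proof
      fix c assume "c \<in> prod_nodes k r"
      then obtain P Q Z s where c: "c = Prod (set_encode P) (set_encode Q) (set_encode Z) s"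
        "P \<subseteq> {..<k}" "Q \<subseteq> {..<k}" "Z \<subseteq> P \<union> Q" "card P < r" "card Q < r" "s < r"
        unfolding prod_nodes_def by blast
      then have "P \<in> set (subsets k)" "Q \<in> set (subsets k)" "Z \<in> set (subsets k)"
        by (auto simp: set_subsets)
      with c show "c \<in> K \<union> (\<Union>P\<in>set (subsets k). \<Union>Q\<in>set (subsets k).
        if card P < r \<and> card Q < r then (\<Union>Z\<in>set (subsets k). if Z \<subseteq> P \<union> Q then
          (\<Union>s\<in>set [0..<r]. {Prod (set_encode P) (set_encode Q) (set_encode Z) s}) else {}) else {})"
        by (intro UnI2 UN_I[of P] UN_I[of Q]) auto
    qed
  qed
qed

lemma sum_list_out_summands:
  "(\<Sum>t\<leftarrow>out_summands k r s. f t) = (\<Sum>P\<in>Pow {..<k}. \<Sum>Q\<in>Pow {..<k}. if card P < r \<and> card Q < r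
    then (\<Sum>Z\<in>Pow {..<k}. if Z \<subseteq> P \<union> Q then f (True, Prod (set_encode P) (set_encode Q) (set_encode Z) s,
         Table (set_encode P) (set_encode Q) (set_encode Z)) else 0) else 0 :: 'b::comm_monoid_add)"
  unfolding out_summands_def loop_sums by (simp cong: if_cong)

text \<open>If P and Q differ in size, one of the two minors of B is not square and vanishes. If
  they have the same size, at least r, then t^r divides the product. Every pair excluded by the test
  falls under one of these cases.\<close>

theorem coeff_hc_add:
  fixes F :: "'a::field poly mat"
  assumes F: "F \<in> carrier_mat k k" and k: "0 < k" and s: "s < r"
    and AB: "\<And>i j. i < k \<Longrightarrow> j < k \<Longrightarrow> F $$ (i, j) = [:A i j:] + B i j"
    and B: "\<And>i j. i < k \<Longrightarrow> j < k \<Longrightarrow> coeff (B i j) 0 = 0"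
  shows "coeff (hc F) s = (\<Sum>P\<in>Pow {..<k}. \<Sum>Q\<in>Pow {..<k}. if card P < r \<and> card Q < r
    then (\<Sum>Z\<in>Pow {..<k}. if Z \<subseteq> P \<union> Q then
      coeff (minor True B (P \<inter> Z) (Q \<inter> Z) * minor False B (P - Z) (Q - Z)) s *
      table_value k (\<lambda>i j. [:A i j:]) P Q Z else 0) else 0)"
proof -
  let ?V = "{..<k}" and ?A = "\<lambda>i j. [:A i j:]"
  let ?B = "\<lambda>P Q S. minor True B (P \<inter> S) (Q \<inter> S) * minor False B (P - S) (Q - S)"
  let ?c = "\<lambda>P Q S. (- 1) ^ exchange_sign P Q S *
      (minor True A (S - P) (S - Q) * minor False A (?V - S - P) (?V - S - Q))"
  have const: "(- 1) ^ exchange_sign P Q S * (minor True ?A (S - P) (S - Q) *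
      minor False ?A (?V - S - P) (?V - S - Q)) = [:?c P Q S:]" for P Q S
    by (simp add: minor_const_poly minus_one_power_iff)
  have table: "table_value k ?A P Q Z = (\<Sum>S | S \<subseteq> ?V \<and> 0 \<in> S \<and> S \<inter> (P \<union> Q) = Z. ?c P Q S)" for P Q Z
    by (simp add: table_value_def minor_const_poly)
  have finS: "finite {S. S \<subseteq> ?V \<and> 0 \<in> S}" by (rule finite_subset[of _ "Pow ?V"]) auto
  have "coeff (hc F) s = (\<Sum>P\<in>Pow ?V. \<Sum>Q\<in>Pow ?V. \<Sum>S | S \<subseteq> ?V \<and> 0 \<in> S. coeff (?B P Q S) s * ?c P Q S)"
  proof -
    have "coeff (p * [:c:]) s = coeff p s * c" for p and c :: 'a by (simp add: mult.commute)
    then show ?thesis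
      using hc_add[of F k ?A B, OF F k AB] by (simp only: coeff_sum const)
  qed
  also have "\<dots> = (\<Sum>P\<in>Pow ?V. \<Sum>Q\<in>Pow ?V. if card P < r \<and> card Q < r
    then (\<Sum>Z\<in>Pow ?V. if Z \<subseteq> P \<union> Q then coeff (?B P Q Z) s * table_value k ?A P Q Z else 0) else 0)"
  proof (intro sum.cong refl)
    fix P Q assume "P \<in> Pow ?V" "Q \<in> Pow ?V"
    then have P: "P \<subseteq> ?V" "finite P" and Q: "Q \<subseteq> ?V" "finite Q" using finite_subset by auto
    show "(\<Sum>S | S \<subseteq> ?V \<and> 0 \<in> S. coeff (?B P Q S) s * ?c P Q S) = (if card P < r \<and> card Q < r
      then (\<Sum>Z\<in>Pow ?V. if Z \<subseteq> P \<union> Q then coeff (?B P Q Z) s * table_value k ?A P Q Z else 0) else 0)"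
    proof (cases "card P < r \<and> card Q < r")
      case True
      have "(\<Sum>S | S \<subseteq> ?V \<and> 0 \<in> S. coeff (?B P Q S) s * ?c P Q S) =
        (\<Sum>Z\<in>Pow ?V. \<Sum>S | S \<in> {S. S \<subseteq> ?V \<and> 0 \<in> S} \<and> S \<inter> (P \<union> Q) = Z. coeff (?B P Q S) s * ?c P Q S)"
        by (rule sum.group[symmetric, OF finS]) auto
      also have "\<dots> = (\<Sum>Z\<in>Pow ?V. if Z \<subseteq> P \<union> Q then coeff (?B P Q Z) s * table_value k ?A P Q Z else 0)"
      proof (intro sum.cong refl)
        fix Z
        have "?B P Q S = ?B P Q Z" if "S \<inter> (P \<union> Q) = Z" for S
        proof -
          have "P \<inter> S = P \<inter> Z" "Q \<inter> S = Q \<inter> Z" "P - S = P - Z" "Q - S = Q - Z" using that by auto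
          then show ?thesis by simp
        qed
        then have "(\<Sum>S | S \<in> {S. S \<subseteq> ?V \<and> 0 \<in> S} \<and> S \<inter> (P \<union> Q) = Z. coeff (?B P Q S) s * ?c P Q S) =
            coeff (?B P Q Z) s * table_value k ?A P Q Z"
          unfolding table sum_distrib_left by (intro sum.cong) auto
        \<comment> \<open>Such a Z is not of the form S \<inter> (P \<union> Q), so restricting Z to
          subsets of P \<union> Q drops only zeros.\<close>
        moreover have "table_value k ?A P Q Z = 0" if "\<not> Z \<subseteq> P \<union> Q"
          unfolding table using that by (intro sum.neutral) auto
        ultimately show "(\<Sum>S | S \<in> {S. S \<subseteq> ?V \<and> 0 \<in> S} \<and> S \<inter> (P \<union> Q) = Z. coeff (?B P Q S) s * ?c P Q S) =
            (if Z \<subseteq> P \<union> Q then coeff (?B P Q Z) s * table_value k ?A P Q Z else 0)" by simp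
      qed
      finally show ?thesis using True by simp
    next
      case False
      have "coeff (?B P Q S) s = 0" for S
      proof (cases "card P = card Q")
        case True
        have dvd: "monom 1 1 dvd B i j" if "i \<in> P" "j \<in> Q" for i j
          using that P Q B by (auto simp: monom_1_dvd_iff')
        \<comment> \<open>The powers of t from the two minors add up to the size of P, however S
          cuts P.\<close>
        have "monom 1 1 ^ card (P \<inter> S) * monom 1 1 ^ card (P - S) dvd ?B P Q S"
          by (intro mult_dvd_mono minor_dvd dvd) auto
        moreover have "card (P \<inter> S) + card (P - S) = card P"
          using card_Int_Diff[OF P(2), of S] by simp
        ultimately have "monom 1 (card P) dvd ?B P Q S"
          by (simp add: monom_power mult_monom)
        then show ?thesis using True False s by (simp add: monom_1_dvd_iff')
      next
        case False
        then have "card (P \<inter> S) \<noteq> card (Q \<inter> S) \<or> card (P - S) \<noteq> card (Q - S)"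
          using card_Int_Diff[OF P(2), of S] card_Int_Diff[OF Q(2), of S] by auto
        then have "?B P Q S = 0"
          using P(2) Q(2) minor_eq_0[of "P \<inter> S" "Q \<inter> S" True B] minor_eq_0[of "P - S" "Q - S" False B] by auto
        then show ?thesis by (simp only: coeff_0)
      qed
      then show ?thesis by (simp only: if_not_P[OF False]) simp
    qed
  qed
  finally show ?thesis .
qed

lemma fills_out:
  assumes K: "prod_nodes k r \<subseteq> K" "table_nodes k r \<subseteq> K"
    and h: "\<And>s. s < r \<Longrightarrow> coeff h s = (\<Sum>P\<in>Pow {..<k}. \<Sum>Q\<in>Pow {..<k}. if card P < r \<and> card Q < r
      then (\<Sum>Z\<in>Pow {..<k}. if Z \<subseteq> P \<union> Q then
        coeff (minor True (M True) (P \<inter> Z) (Q \<inter> Z) * minor False (M True) (P - Z) (Q - Z)) s *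
        table_value k (M False) P Q Z else 0) else 0)"
  shows "fills r inp (node_value k M h) (out_prog k r) K (Out ` {..<r})"
proof -
  have asg: "fills r inp (node_value k M h) (assign r (Out s) (out_summands k r s)) K' {Out s}"
    if "K \<subseteq> K'" "s < r" for s K'
  proof (rule fills_assign)
    fix p x y assume "(p, x, y) \<in> set (out_summands k r s)"
    then obtain P Q Z where *: "P \<subseteq> {..<k}" "Q \<subseteq> {..<k}" "Z \<subseteq> {..<k}" "card P < r" "card Q < r" "Z \<subseteq> P \<union> Q"
      "x = Prod (set_encode P) (set_encode Q) (set_encode Z) s" "y = Table (set_encode P) (set_encode Q) (set_encode Z)"
      by (auto simp: out_summands_def set_subsets split: if_splits)
    then have "x \<in> prod_nodes k r" "y \<in> table_nodes k r"
      using that(2) unfolding prod_nodes_def table_nodes_def by blast+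
    then show "x \<in> K' \<and> y \<in> K' \<and> x \<noteq> Out s \<and> y \<noteq> Out s" using K that(1) * by auto
  next
    show "node_value k M h (Out s) = (\<Sum>t\<leftarrow>out_summands k r s. summand_value (node_value k M h) t)"
      unfolding sum_list_out_summands node_value.simps(7) h[OF that(2)]
      by (intro sum.cong refl if_cong) (simp add: decode_encode[of _ k])
  qed
  have "fills r inp (node_value k M h) (out_prog k r) K (\<Union>s\<in>set [0..<r]. {Out s})"
    unfolding out_prog_def by (intro fills_each asg) auto
  then show ?thesis by (rule fills_mono) auto
qed

lemma sum_list_path_summands:
  assumes "X \<subseteq> {..<k}" "X \<noteq> {}"
  shows "(\<Sum>t\<leftarrow>path_summands k X a s. f t) = (\<Sum>b\<in>X. \<Sum>l<Suc s.
    f (True, Entry True a b l, Path (set_encode (X - {b})) b (s - l)) :: 'b::comm_monoid_add)"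
  unfolding path_summands_def loop_sums if_not_P[OF assms(2)] sum_if_mem[OF assms(1)] ..

lemma path_summands_operands:
  assumes "(p, x, y) \<in> set (path_summands k X a s)"
  shows "X = {} \<or> (\<exists>b l. b \<in> X \<and> b < k \<and> l \<le> s \<and> x = Entry True a b l \<and>
    y = Path (set_encode (X - {b})) b (s - l))"
  using assms by (auto simp: path_summands_def split: if_splits)

lemma fills_path:
  assumes K: "One \<in> K" "entry_nodes True k r \<subseteq> K"
  shows "fills r inp (node_value k M h) (path_prog k r) K (path_nodes k r)"
proof -
  let ?D = "\<lambda>X. \<Union>a\<in>set [0..<k]. \<Union>s\<in>set [0..<r]. {Path (set_encode X) a s}"
  have "fills r inp (node_value k M h) (path_prog k r) K (\<Union>X\<in>Pow {..<k}. ?D X)"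
    unfolding path_prog_def
  proof (rule fills_subsets, intro fills_each)
    fix X K1 a K2 s K3
    assume X: "X \<subseteq> {..<k}" and K1: "K \<subseteq> K1"
      and prev: "\<And>Z. Z \<subseteq> {..<k} \<Longrightarrow> set_encode Z < set_encode X \<Longrightarrow> ?D Z \<subseteq> K1"
      and a: "a \<in> set [0..<k]" and K2: "K1 \<subseteq> K2" and s: "s \<in> set [0..<r]" and K3: "K2 \<subseteq> K3"
    have fin: "finite X" using X finite_subset by blast
    have dec: "set_decode (set_encode (X - {b})) = X - {b}" for b
      by (rule decode_encode[of _ k]) (use X in auto)
    show "fills r inp (node_value k M h) (assign r (Path (set_encode X) a s) (path_summands k X a s)) K3
        {Path (set_encode X) a s}"
    proof (rule fills_assign)
      show "node_value k M h (Path (set_encode X) a s) =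
          (\<Sum>t\<leftarrow>path_summands k X a s. summand_value (node_value k M h) t)"
      proof (cases "X = {}")
        case True
        then show ?thesis by (simp add: path_summands_def held_karp_empty)
      next
        case False
        show ?thesis
          unfolding sum_list_path_summands[OF X False] node_value.simps decode_encode[OF X]
            held_karp_rec[OF fin False] coeff_sum coeff_mult
          by (simp add: dec lessThan_Suc_atMost)
      qed
      fix p x y assume t: "(p, x, y) \<in> set (path_summands k X a s)"
      show "x \<in> K3 \<and> y \<in> K3 \<and> x \<noteq> Path (set_encode X) a s \<and> y \<noteq> Path (set_encode X) a s"
      proof (cases "X = {}")
        case True
        then have "x = One" "y = Entry True a 0 s" using t by (auto simp: path_summands_def)
        moreover have "Entry True a 0 s \<in> entry_nodes True k r"
          using a s by (auto simp: entry_nodes_def)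
        ultimately show ?thesis using K K1 K2 K3 by auto
      next
        case False
        with path_summands_operands[OF t] obtain b l where b: "b \<in> X" "b < k" "l \<le> s"
          "x = Entry True a b l" "y = Path (set_encode (X - {b})) b (s - l)"
          by blast
        have less: "set_encode (X - {b}) < set_encode X" by (rule set_encode_Diff_less[OF fin b(1)])
        have "y \<in> ?D (X - {b})" using b s by auto
        then have "y \<in> K3" using prev[OF _ less] X K2 K3 by blast
        moreover have "x \<in> entry_nodes True k r" using a b s by (auto simp: entry_nodes_def)
        ultimately show ?thesis using b less K K1 K2 K3 by auto
      qed
    qed
  qed
  then show ?thesis by (rule fills_mono) (auto simp: path_nodes_def)
qed

lemma fills_path_out:
  assumes K: "One \<in> K" "path_nodes k r \<subseteq> K"
    and h: "h = (if 0 < k then held_karp (M True) ({..<k} - {0}) 0 else 0)"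
  shows "fills r inp (node_value k M h) (path_out_prog k r) K (Out ` {..<r})"
proof -
  have dec: "set_decode (set_encode ({..<k} - {0})) = {..<k} - {0}"
    by (rule decode_encode[of _ k]) auto
  have asg: "fills r inp (node_value k M h) (assign r (Out s)
      (if 0 < k then [(True, One, Path (set_encode ({..<k} - {0})) 0 s)] else [])) K' {Out s}"
    if "K \<subseteq> K'" "s < r" for s K'
  proof (rule fills_assign)
    have "0 < k \<Longrightarrow> Path (set_encode ({..<k} - {0})) 0 s \<in> path_nodes k r"
      unfolding path_nodes_def using that by blast
    then show "x \<in> K' \<and> y \<in> K' \<and> x \<noteq> Out s \<and> y \<noteq> Out s"
      if "(p, x, y) \<in> set (if 0 < k then [(True, One, Path (set_encode ({..<k} - {0})) 0 s)] else [])" for p x y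
      using that K \<open>K \<subseteq> K'\<close> by (auto split: if_splits)
  qed (simp add: h dec)
  have "fills r inp (node_value k M h) (path_out_prog k r) K (\<Union>s\<in>set [0..<r]. {Out s})"
    unfolding path_out_prog_def by (intro fills_each asg) auto
  then show ?thesis by (rule fills_mono) auto
qed

lemma coeff_mod_monom:
  fixes p :: "'a::field poly"
  assumes "s < r" shows "coeff (p mod monom 1 r) s = coeff p s"
proof -
  have "coeff p s = coeff (p div monom 1 r * monom 1 r) s + coeff (p mod monom 1 r) s"
    by (metis coeff_add div_mult_mod_eq)
  moreover have "coeff (p div monom 1 r * monom 1 r) s = 0"
    using assms by (subst mult.commute) (simp add: coeff_monom_mult)
  ultimately show ?thesis by simp
qed

lemma hc_dim_0: "M \<in> carrier_mat 0 0 \<Longrightarrow> hc M = 0"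
  by (auto simp: hc_def cycle_count_def intro!: sum.neutral)

definition pre_nodes :: "nat \<Rightarrow> nat \<Rightarrow> node set" where
  "pre_nodes k r = {One} \<union> (entry_nodes False k 1 \<union> (minor_nodes False k (Suc k) 1 \<union> table_nodes k r))"

lemma fills_pre:
  assumes A: "A \<in> carrier_mat k k" and M: "\<And>i j. i < k \<Longrightarrow> j < k \<Longrightarrow> coeff (M False i j) 0 = A $$ (i, j)"
    and r: "2 * r \<le> k"
  shows "fills r (matrix_input A) (node_value k M h) (pre k r) {} (pre_nodes k r)"
proof -
  have "pre k r = [Set_One (addr r One)] @ load_matrix k r @ minors_prog k r False (Suc k) 1 @ table_prog k r"
    using r by (simp add: pre_def)
  then show ?thesis
    unfolding pre_nodes_def
    by (simp only:) (intro fills_append fills_One fills_load_matrix[OF A] fills_minors fills_table; auto simp: M)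
qed

theorem answers_queries_pre_query:
  fixes A :: "'a::field mat"
  assumes A: "A \<in> carrier_mat k k" and r: "0 < r"
  shows "answers_queries k r A (pre k r) (query k r)"
proof (cases "2 * r \<le> k")
  case True
  then have k: "0 < k" using r by simp
  define M where "M F = (\<lambda>q i j. if q then F $$ (i, j) - [:A $$ (i, j):] else [:A $$ (i, j):])" for F :: "'a poly mat"
  \<comment> \<open>Shown for all F and h at once, since the precomputation cannot see the
    query.\<close>
  have pre: "fills r (matrix_input A) (node_value k (M F) h) (pre k r) {} (pre_nodes k r)" for F h
    by (rule fills_pre[OF A _ True]) (simp add: M_def)
  then obtain m where m: "run (matrix_input A) (pre k r) (\<lambda>_. 0) = Some m"
    unfolding fills_def by blast
  show ?thesis
    unfolding answers_queries_def
  proof (rule exI[of _ m], intro conjI m allI impI)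
    fix F assume "valid_query k r A F"
    then have F: "F \<in> carrier_mat k k" and FA: "map_mat (\<lambda>p. poly p 0) F = A"
      by (auto simp: valid_query_def)
    have A0: "A $$ (i, j) = coeff (F $$ (i, j)) 0" if "i < k" "j < k" for i j
      using that F by (subst FA[symmetric]) (auto simp: poly_0_coeff_0)
    have MF: "coeff (M F True i j) l = (if l < 1 then 0 else coeff (F $$ (i, j)) l)" if "i < k" "j < k" for i j l
      using A0[OF that] by (cases l) (auto simp: M_def)
    let ?v = "node_value k (M F) (hc F)"
    have out: "coeff (hc F) s = (\<Sum>P\<in>Pow {..<k}. \<Sum>Q\<in>Pow {..<k}. if card P < r \<and> card Q < r
      then (\<Sum>Z\<in>Pow {..<k}. if Z \<subseteq> P \<union> Q then
        coeff (minor True (M F True) (P \<inter> Z) (Q \<inter> Z) * minor False (M F True) (P - Z) (Q - Z)) s *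
        table_value k (M F False) P Q Z else 0) else 0)" if "s < r" for s
    proof -
      have const: "M F False = (\<lambda>i j. [:A $$ (i, j):])" by (simp add: M_def)
      have sum: "F $$ (i, j) = [:A $$ (i, j):] + M F True i j" for i j by (simp add: M_def)
      show ?thesis
        unfolding const by (rule coeff_hc_add[OF F k that], rule sum, simp add: MF)
    qed
    have "query k r = load_query k r 1 @ minors_prog k r True r r @ prod_prog k r @ out_prog k r"
      using True by (simp add: query_def)
    then have "fills r (poly_matrix_input r F) ?v (query k r) (pre_nodes k r)
        (entry_nodes True k r \<union> (minor_nodes True k r r \<union> (prod_nodes k r \<union> Out ` {..<r})))"
      by (simp only:) (intro fills_append fills_load_query[OF F] fills_minors fills_prod fills_out out;
        auto simp: pre_nodes_def MF)
    \<comment> \<open>Runs are deterministic, so the single memory \<open>m\<close>, fixed before F,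
      is correct for the valuation belonging to this F.\<close>
    moreover have "\<forall>c\<in>pre_nodes k r. m (addr r c) = ?v c"
    proof -
      obtain m' where "run (matrix_input A) (pre k r) (\<lambda>_. 0) = Some m'" "\<forall>c\<in>pre_nodes k r. m' (addr r c) = ?v c"
        using pre[of F "hc F"] unfolding fills_def by fastforce
      then show ?thesis using m by simp
    qed
    ultimately obtain n where n: "run (poly_matrix_input r F) (query k r) m = Some n"
      "\<forall>c\<in>Out ` {..<r}. n (addr r c) = ?v c"
      unfolding fills_def by blast
    then show "\<exists>n. run (poly_matrix_input r F) (query k r) m = Some n \<and>
        (\<forall>s<r. n s = coeff (hc F mod monom 1 r) s)"
      by (auto simp: coeff_mod_monom)
  qed
next
  case False
  then have pre: "pre k r = []" by (simp add: pre_def)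
  show ?thesis
    unfolding answers_queries_def
  proof (rule exI[of _ "\<lambda>_. 0"], intro conjI allI impI)
    show "run (matrix_input A) (pre k r) (\<lambda>_. 0) = Some (\<lambda>_. 0)" by (simp add: pre)
    fix F assume "valid_query k r A F"
    then have F: "F \<in> carrier_mat k k" by (auto simp: valid_query_def)
    let ?M = "\<lambda>q::bool. \<lambda>i j. F $$ (i, j)"
    let ?v = "node_value k ?M (hc F)"
    have h: "hc F = (if 0 < k then held_karp (?M True) ({..<k} - {0}) 0 else 0)"
      using hc_eq_held_karp[OF F] hc_dim_0[of F] F by auto
    have "query k r = [Set_One (addr r One)] @ load_query k r 0 @ path_prog k r @ path_out_prog k r"
      using False by (simp add: query_def)
    then have "fills r (poly_matrix_input r F) ?v (query k r) {}
        ({One} \<union> (entry_nodes True k r \<union> (path_nodes k r \<union> Out ` {..<r})))"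
      by (simp only:) (intro fills_append fills_One fills_load_query[OF F] fills_path fills_path_out h; auto)
    then obtain n where "run (poly_matrix_input r F) (query k r) (\<lambda>_. 0) = Some n"
      "\<forall>c\<in>Out ` {..<r}. n (addr r c) = ?v c"
      unfolding fills_def by blast
    then show "\<exists>n. run (poly_matrix_input r F) (query k r) (\<lambda>_. 0) = Some n \<and>
        (\<forall>s<r. n s = coeff (hc F mod monom 1 r) s)"
      by (auto simp: coeff_mod_monom)
  qed
qed

section \<open>Operation counts\<close>

lemma field_ops_Nil: "field_ops [] = 0"
  by (simp add: field_ops_def)

lemma field_ops_append: "field_ops (p @ q) = field_ops p + field_ops q"
  by (simp add: field_ops_def)

lemma field_ops_Cons: "field_ops (c # p) = (if is_arith c then 1 else 0) + field_ops p"
  by (simp add: field_ops_def)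

lemma field_ops_concat: "field_ops (concat (map body xs)) = (\<Sum>x\<leftarrow>xs. field_ops (body x))"
  by (induction xs) (simp_all add: field_ops_Nil field_ops_append)

lemma field_ops_if: "field_ops (if b then p else []) = (if b then field_ops p else 0)"
  by (simp add: field_ops_Nil)

text \<open>The length is written as a sum of ones so that the summation lemmas for the summand
  lists apply to it.\<close>

lemma field_ops_assign: "field_ops (assign r c ts) = 2 * (\<Sum>t\<leftarrow>ts. 1)"
  unfolding assign_def by (induction ts) (auto simp: field_ops_Nil field_ops_Cons field_ops_append)

lemmas field_ops_simps = field_ops_concat field_ops_if field_ops_append field_ops_assign

definition few_subsets :: "nat \<Rightarrow> nat \<Rightarrow> nat" where
  "few_subsets k w = card {X \<in> Pow {..<k}. card X < w}"

lemma few_subsets_le_power: "few_subsets k w \<le> 2 ^ k"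
proof -
  have "few_subsets k w \<le> card (Pow {..<k})"
    unfolding few_subsets_def by (rule card_mono) auto
  then show ?thesis by (simp add: card_Pow)
qed

lemma few_subsets_le_binom: "few_subsets k r \<le> binom_le k r"
proof -
  have "{X \<in> Pow {..<k}. card X < r} \<subseteq> (\<Union>i\<le>r. {X. X \<subseteq> {..<k} \<and> card X = i})" by auto
  then have "few_subsets k r \<le> card (\<Union>i\<le>r. {X. X \<subseteq> {..<k} \<and> card X = i})"
    unfolding few_subsets_def by (intro card_mono) auto
  also have "\<dots> \<le> (\<Sum>i\<le>r. card {X. X \<subseteq> {..<k} \<and> card X = i})" by (rule card_UN_le) simp
  finally show ?thesis by (simp add: binom_le_def n_subsets)
qed

lemma sum_few_subsets_le:
  assumes "\<And>X Y. X \<subseteq> {..<k} \<Longrightarrow> Y \<subseteq> {..<k} \<Longrightarrow> card X < w \<Longrightarrow> card Y < w \<Longrightarrow> g X Y \<le> (c::nat)"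
  shows "(\<Sum>X\<in>Pow {..<k}. \<Sum>Y\<in>Pow {..<k}. if card X < w \<and> card Y < w then g X Y else 0) \<le> (few_subsets k w)\<^sup>2 * c"
proof -
  let ?S = "{X \<in> Pow {..<k}. card X < w}"
  have "(\<Sum>Y\<in>Pow {..<k}. if card X < w \<and> card Y < w then g X Y else 0) \<le> (if card X < w then card ?S * c else 0)"
    if "X \<in> Pow {..<k}" for X
  proof (cases "card X < w")
    case True
    have "(\<Sum>Y\<in>Pow {..<k}. if card X < w \<and> card Y < w then g X Y else 0) = (\<Sum>Y\<in>?S. g X Y)"
      using True by (subst sum.inter_filter) auto
    also have "\<dots> \<le> card ?S * c"
      using sum_bounded_above[of ?S "g X" c] assms that True by simp
    finally show ?thesis using True by simp
  qed simp
  then have "(\<Sum>X\<in>Pow {..<k}. \<Sum>Y\<in>Pow {..<k}. if card X < w \<and> card Y < w then g X Y else 0) \<le>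
      (\<Sum>X\<in>Pow {..<k}. if card X < w then card ?S * c else 0)"
    by (rule sum_mono)
  also have "\<dots> = card ?S * (card ?S * c)"
    by (subst sum.inter_filter[symmetric]) auto
  finally show ?thesis by (simp add: few_subsets_def power2_eq_square)
qed

lemma length_minor_summands_le:
  assumes X: "X \<subseteq> {..<k}" and Y: "Y \<subseteq> {..<k}" "card Y < w" and s: "s < R"
  shows "(\<Sum>t\<leftarrow>minor_summands k q b X Y s. 1 :: nat) \<le> w * R + 1"
proof (cases "X = {}")
  case True
  then show ?thesis by (simp add: minor_summands_def)
next
  case False
  have "finite X" using X finite_subset by blast
  then have "Min X \<in> X" "\<forall>x\<in>X. Min X \<le> x" using False by auto
  then have "(\<Sum>t\<leftarrow>minor_summands k q b X Y s. 1 :: nat) = card Y * Suc s"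
    by (subst sum_list_minor_summands[OF X _ _ Y(1), of "Min X"]) simp_all
  also have "\<dots> \<le> w * R" using Y(2) s by (intro mult_le_mono) auto
  finally show ?thesis by simp
qed

lemma field_ops_minors: "field_ops (minors_prog k r q w R) \<le> (few_subsets k w)\<^sup>2 * (R * (4 * (w * R + 1)))"
  unfolding minors_prog_def field_ops_simps sum_list_subsets sum_list_upt
proof (rule sum_few_subsets_le)
  fix X Y assume *: "X \<subseteq> {..<k}" "Y \<subseteq> {..<k}" "card X < w" "card Y < w"
  have "(\<Sum>s<R. 2 * (\<Sum>t\<leftarrow>minor_summands k q True X Y s. 1) + 2 * (\<Sum>t\<leftarrow>minor_summands k q False X Y s. 1)) \<le>
      (\<Sum>s<R. 4 * (w * R + 1))"
  proof (rule sum_mono)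
    fix s assume "s \<in> {..<R}"
    then have s: "s < R" by simp
    show "2 * (\<Sum>t\<leftarrow>minor_summands k q True X Y s. 1) + 2 * (\<Sum>t\<leftarrow>minor_summands k q False X Y s. 1) \<le> 4 * (w * R + 1)"
    proof -
      have "2 * x + 2 * y \<le> 4 * n" if "x \<le> n" "y \<le> n" for x y n :: nat using that by linarith
      from this[OF length_minor_summands_le[OF *(1,2,4) s] length_minor_summands_le[OF *(1,2,4) s]]
      show ?thesis .
    qed
  qed
  then show "(\<Sum>s<R. 2 * (\<Sum>t\<leftarrow>minor_summands k q True X Y s. 1) + 2 * (\<Sum>t\<leftarrow>minor_summands k q False X Y s. 1)) \<le>
      R * (4 * (w * R + 1))" by simp
qed

lemma field_ops_load_matrix: "field_ops (load_matrix k r) = 0"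
  unfolding load_matrix_def field_ops_simps by (simp add: field_ops_def)

lemma field_ops_load_query: "field_ops (load_query k r l0) = 0"
proof -
  have "field_ops (if b then assign r c [] else [Load d i]) = 0" for b c d i
    by (simp add: field_ops_def assign_def)
  then show ?thesis unfolding load_query_def field_ops_concat by simp
qed

text \<open>Every S meets P \<union> Q in exactly one Z, so the loops over Z and S together cost 2^k
  rather than 4^k summands for each pair P, Q.\<close>

lemma field_ops_table: "field_ops (table_prog k r) \<le> (few_subsets k r)\<^sup>2 * (2 * 2 ^ k)"
  unfolding table_prog_def field_ops_simps sum_list_subsets sum_list_table_summands
proof (rule sum_few_subsets_le)
  fix P Q
  let ?S = "{S. S \<subseteq> {..<k} \<and> 0 \<in> S}"
  have "finite ?S" by (rule finite_subset[of _ "Pow {..<k}"]) auto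
  then have "(\<Sum>Z\<in>Pow {..<k}. \<Sum>S | S \<in> ?S \<and> S \<inter> (P \<union> Q) = Z. 1) = (\<Sum>S\<in>?S. 1 :: nat)"
    by (rule sum.group) auto
  also have "\<dots> \<le> card (Pow {..<k})" by (simp only: card_eq_sum[symmetric]) (rule card_mono; auto)
  finally have "(\<Sum>Z\<in>Pow {..<k}. \<Sum>S | S \<subseteq> {..<k} \<and> 0 \<in> S \<and> S \<inter> (P \<union> Q) = Z. 1 :: nat) \<le> 2 ^ k"
    by (simp add: card_Pow)
  then show "(\<Sum>Z\<in>Pow {..<k}. 2 * (\<Sum>S | S \<subseteq> {..<k} \<and> 0 \<in> S \<and> S \<inter> (P \<union> Q) = Z. 1 :: nat)) \<le> 2 * 2 ^ k"
    by (simp only: sum_distrib_left[symmetric] mult_le_mono2)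
qed

text \<open>P \<union> Q has at most 2 r elements, hence at most 4^r subsets.\<close>

lemma sum_subsets_Un_le:
  assumes "P \<subseteq> {..<k::nat}" "Q \<subseteq> {..<k}" "card P < r" "card Q < r"
  shows "(\<Sum>Z\<in>Pow {..<k}. if Z \<subseteq> P \<union> Q then c else 0) \<le> 4 ^ r * (c::nat)"
proof -
  have fin: "finite (P \<union> Q)" using assms(1,2) by (meson finite_UnI finite_lessThan finite_subset)
  have "(\<Sum>Z\<in>Pow {..<k}. if Z \<subseteq> P \<union> Q then c else 0) = (\<Sum>Z\<in>Pow (P \<union> Q). c)"
    by (rule sum.mono_neutral_cong_right) (use assms in auto)
  also have "\<dots> = 2 ^ card (P \<union> Q) * c" using fin by (simp add: card_Pow)
  also have "\<dots> \<le> 2 ^ (2 * r) * c"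
    using card_Un_le[of P Q] assms by (intro mult_le_mono1 power_increasing) auto
  finally show ?thesis by (simp add: power_mult)
qed

lemma field_ops_prod: "field_ops (prod_prog k r) \<le> (few_subsets k r)\<^sup>2 * (4 ^ r * (r * (2 * r)))"
  unfolding prod_prog_def field_ops_simps sum_list_subsets sum_list_upt
proof (rule sum_few_subsets_le)
  fix P Q assume *: "P \<subseteq> {..<k}" "Q \<subseteq> {..<k}" "card P < r" "card Q < r"
  have "(\<Sum>s<r. 2 * (\<Sum>t\<leftarrow>prod_summands P Q Z s. 1)) \<le> r * (2 * r)" for Z
  proof -
    have "(\<Sum>s<r. 2 * (\<Sum>t\<leftarrow>prod_summands P Q Z s. 1)) \<le> (\<Sum>s<r. 2 * r)"
      by (intro sum_mono) (simp only: prod_summands_def loop_sums, simp)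
    then show ?thesis by simp
  qed
  then have "(\<Sum>Z\<in>Pow {..<k}. if Z \<subseteq> P \<union> Q then \<Sum>s<r. 2 * (\<Sum>t\<leftarrow>prod_summands P Q Z s. 1) else 0) \<le>
      (\<Sum>Z\<in>Pow {..<k}. if Z \<subseteq> P \<union> Q then r * (2 * r) else 0)"
    by (intro sum_mono) simp
  also have "\<dots> \<le> 4 ^ r * (r * (2 * r))" by (rule sum_subsets_Un_le[OF *])
  finally show "(\<Sum>Z\<in>Pow {..<k}. if Z \<subseteq> P \<union> Q then \<Sum>s<r. 2 * (\<Sum>t\<leftarrow>prod_summands P Q Z s. 1) else 0) \<le>
      4 ^ r * (r * (2 * r))" .
qed

lemma field_ops_out: "field_ops (out_prog k r) \<le> r * (2 * ((few_subsets k r)\<^sup>2 * 4 ^ r))"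
proof -
  have "(\<Sum>t\<leftarrow>out_summands k r s. 1 :: nat) \<le> (few_subsets k r)\<^sup>2 * 4 ^ r" for s
    unfolding sum_list_out_summands
    using sum_subsets_Un_le[where c = 1] by (intro sum_few_subsets_le) simp
  then have "(\<Sum>s<r. 2 * (\<Sum>t\<leftarrow>out_summands k r s. 1 :: nat)) \<le> (\<Sum>s<r. 2 * ((few_subsets k r)\<^sup>2 * 4 ^ r))"
    by (intro sum_mono mult_le_mono2)
  then show ?thesis unfolding out_prog_def field_ops_simps sum_list_upt by simp
qed

lemma field_ops_path: "field_ops (path_prog k r) \<le> 2 ^ k * (k * (r * (2 * (k * r + 1))))"
proof -
  have "(\<Sum>t\<leftarrow>path_summands k X a s. 1 :: nat) \<le> k * r + 1" if X: "X \<subseteq> {..<k}" and s: "s < r" for X a s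
  proof (cases "X = {}")
    case True
    then show ?thesis by (simp add: path_summands_def)
  next
    case False
    have "(\<Sum>t\<leftarrow>path_summands k X a s. 1 :: nat) = card X * Suc s"
      by (simp add: sum_list_path_summands[OF X False])
    also have "\<dots> \<le> k * r"
      using card_mono[OF _ X] s by (intro mult_le_mono) auto
    finally show ?thesis by simp
  qed
  then have "(\<Sum>X\<in>Pow {..<k}. \<Sum>a<k. \<Sum>s<r. 2 * (\<Sum>t\<leftarrow>path_summands k X a s. 1 :: nat)) \<le>
      (\<Sum>X\<in>Pow {..<k}. \<Sum>a<k. \<Sum>s<r. 2 * (k * r + 1))"
    by (intro sum_mono mult_le_mono2) auto
  also have "\<dots> = 2 ^ k * (k * (r * (2 * (k * r + 1))))"
    by (simp add: card_Pow)
  finally show ?thesis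
    unfolding path_prog_def field_ops_simps sum_list_subsets sum_list_upt .
qed

lemma field_ops_path_out: "field_ops (path_out_prog k r) \<le> r * 2"
proof -
  have "(\<Sum>s<r. 2 * (\<Sum>t\<leftarrow>(if 0 < k then [(True, One, Path (set_encode ({..<k} - {0})) 0 s)] else []). 1 :: nat)) \<le> (\<Sum>s<r. 2)"
    by (intro sum_mono) simp
  then show ?thesis unfolding path_out_prog_def field_ops_concat field_ops_assign sum_list_upt by simp
qed

section \<open>Estimates for the binomial sum and the total costs\<close>

lemma binom_le_pos: "0 < binom_le k r"
proof -
  have "(k choose 0) \<le> binom_le k r" unfolding binom_le_def by (rule member_le_sum) auto
  then show ?thesis by simp
qed

text \<open>The minors of A account for 4 k + 8. The table accounts for 2: one factor
  \<open>few_subsets k r\<close> is bounded by the binomial sum and the other by 2^k.\<close>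

lemma field_ops_pre: "field_ops (pre k r) \<le> (4 * k + 10) * (binom_le k r * 4 ^ k)"
proof (cases "2 * r \<le> k")
  case True
  have four: "(4::nat) ^ k = 2 ^ k * 2 ^ k" by (simp flip: power_mult_distrib)
  have "(few_subsets k (Suc k))\<^sup>2 * (1 * (4 * (Suc k * 1 + 1))) \<le> 4 ^ k * (4 * k + 8)"
    unfolding four power2_eq_square using few_subsets_le_power[of k "Suc k"]
    by (intro mult_le_mono) auto
  also have "\<dots> \<le> (4 * k + 8) * (binom_le k r * 4 ^ k)"
    using binom_le_pos[of k r] by simp
  finally have 1: "field_ops (minors_prog k r False (Suc k) 1) \<le> (4 * k + 8) * (binom_le k r * 4 ^ k)"
    using field_ops_minors[of k r False "Suc k" 1] by linarith
  have "(few_subsets k r)\<^sup>2 * (2 * 2 ^ k) \<le> (binom_le k r * 2 ^ k) * (2 * 2 ^ k)"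
    unfolding power2_eq_square using few_subsets_le_power[of k r] few_subsets_le_binom[of k r]
    by (intro mult_le_mono) auto
  also have "\<dots> = 2 * (binom_le k r * 4 ^ k)" by (simp add: four mult_ac)
  finally have 2: "field_ops (table_prog k r) \<le> 2 * (binom_le k r * 4 ^ k)"
    using field_ops_table[of k r] by linarith
  have "field_ops (pre k r) = field_ops (minors_prog k r False (Suc k) 1) + field_ops (table_prog k r)"
    using True by (simp add: pre_def field_ops_append field_ops_Cons field_ops_load_matrix)
  also have "\<dots> \<le> (4 * k + 8) * (binom_le k r * 4 ^ k) + 2 * (binom_le k r * 4 ^ k)"
    using 1 2 by linarith
  finally show ?thesis by (simp add: algebra_simps)
qed (simp add: pre_def field_ops_Nil)

text \<open>The lower bound 4^r / (2 r) for the central binomial coefficient, followed by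
  monotonicity in the upper index.\<close>

lemma four_power_le:
  assumes "0 < r" "2 * r \<le> k" shows "4 ^ r \<le> 2 * r * binom_le k r"
proof -
  have "4 ^ r / (2 * real r) \<le> real (2 * r choose r)"
    using central_binomial_lower_bound[OF assms(1)] .
  then have "real (4 ^ r) \<le> real (2 * r * (2 * r choose r))"
    using assms(1) by (simp add: field_simps)
  then have "4 ^ r \<le> 2 * r * (2 * r choose r)" by (simp only: of_nat_le_iff)
  also have "(2 * r choose r) \<le> (k choose r)" using assms(2) by (rule binomial_right_mono)
  also have "(k choose r) \<le> binom_le k r" unfolding binom_le_def by (rule member_le_sum) auto
  finally show ?thesis by simp
qed

text \<open>Makes powers of r polylogarithmic in the bound. Since \<open>2 * r \<le> 2 ^ r\<close>,
  one factor 2^r cancels from 4^r = 2^r 2^r in \<open>four_power_le\<close>.\<close>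

lemma two_power_le_binom_le_small:
  assumes "0 < r" "2 * r \<le> k" shows "2 ^ r \<le> binom_le k r"
proof -
  obtain n where n: "r = Suc n" using assms(1) by (cases r) auto
  have "Suc n \<le> 2 ^ n" by (simp only: Suc_le_eq less_exp)
  then have "2 * r \<le> 2 ^ r" by (simp add: n)
  have "2 ^ r * 2 ^ r = (4::nat) ^ r" by (simp flip: power_mult_distrib)
  also have "\<dots> \<le> 2 * r * binom_le k r" by (rule four_power_le[OF assms])
  also have "\<dots> \<le> 2 ^ r * binom_le k r" using \<open>2 * r \<le> 2 ^ r\<close> by (rule mult_le_mono1)
  finally show ?thesis by simp
qed

text \<open>Reflection i to k - i sends the indices above r to indices below k - r, which is less
  than r; so the missing part of the row is no larger than the part counted.\<close>

lemma two_power_le_binom_le_large: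
  assumes "k < 2 * r" shows "2 ^ k \<le> 2 * binom_le k r"
proof (cases "r \<le> k")
  case True
  have "(\<Sum>i\<in>{..k} - {..r}. k choose i) = (\<Sum>i<k - r. k choose i)"
    by (rule sum.reindex_bij_witness[of _ "\<lambda>i. k - i" "\<lambda>i. k - i"])
      (auto simp: binomial_symmetric[symmetric])
  also have "\<dots> \<le> binom_le k r"
    unfolding binom_le_def using assms by (intro sum_mono2) auto
  finally have "(\<Sum>i\<in>{..k} - {..r}. k choose i) \<le> binom_le k r" .
  moreover have "(\<Sum>i\<le>k. k choose i) = (\<Sum>i\<in>{..k} - {..r}. k choose i) + (\<Sum>i\<le>r. k choose i)"
    using True by (intro sum.subset_diff) auto
  ultimately show ?thesis by (simp add: choose_row_sum binom_le_def)
next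
  case False
  then have "(\<Sum>i\<le>k. k choose i) \<le> binom_le k r"
    unfolding binom_le_def by (intro sum_mono2) auto
  then show ?thesis by (simp add: choose_row_sum)
qed

text \<open>Minors, products and outputs contribute 8 + 2 + 2 = 12 times r^3; replacing 4^r by 2 r
  times the binomial sum gives 24 r^4 and the third power.\<close>

lemma field_ops_query_small:
  assumes r: "0 < r" "2 * r \<le> k"
  shows "field_ops (query k r) \<le> 24 * r ^ 4 * binom_le k r ^ 3"
proof -
  let ?N = "(few_subsets k r)\<^sup>2"
  have "field_ops (minors_prog k r True r r) \<le> ?N * (r * (4 * (r * r + 1)))" by (rule field_ops_minors)
  also have "r * (4 * (r * r + 1)) \<le> 8 * r ^ 3"
  proof -
    have "1 \<le> r * r" using r(1) by simp
    moreover have "4 * (n + 1) \<le> 8 * n" if "1 \<le> n" for n :: nat using that by presburger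
    ultimately have "4 * (r * r + 1) \<le> 8 * (r * r)" by blast
    then have "r * (4 * (r * r + 1)) \<le> r * (8 * (r * r))" by (rule mult_le_mono2)
    then show ?thesis by (simp add: power3_eq_cube mult_ac)
  qed
  also have "8 * r ^ 3 \<le> 4 ^ r * (8 * r ^ 3)" by simp
  finally have 1: "field_ops (minors_prog k r True r r) \<le> ?N * 4 ^ r * (8 * r ^ 3)" by (simp add: mult.assoc)
  have pow: "r \<le> r ^ 3" "r * r \<le> r ^ 3" using r(1) by (auto simp: power3_eq_cube)
  have "field_ops (prod_prog k r) \<le> ?N * 4 ^ r * (2 * (r * r))"
    using field_ops_prod[of k r] by (simp add: mult_ac)
  also have "\<dots> \<le> ?N * 4 ^ r * (2 * r ^ 3)" using pow by (intro mult_le_mono2)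
  finally have 2: "field_ops (prod_prog k r) \<le> ?N * 4 ^ r * (2 * r ^ 3)" .
  have "field_ops (out_prog k r) \<le> ?N * 4 ^ r * (2 * r)"
    using field_ops_out[of k r] by (simp add: mult_ac)
  also have "\<dots> \<le> ?N * 4 ^ r * (2 * r ^ 3)" using pow by (intro mult_le_mono2)
  finally have 3: "field_ops (out_prog k r) \<le> ?N * 4 ^ r * (2 * r ^ 3)" .
  have "field_ops (query k r) = field_ops (minors_prog k r True r r) + field_ops (prod_prog k r) + field_ops (out_prog k r)"
    using r by (simp add: query_def field_ops_append field_ops_load_query)
  also have "\<dots> \<le> ?N * 4 ^ r * (12 * r ^ 3)"
    using 1 2 3 by (simp add: algebra_simps)
  also have "\<dots> \<le> (binom_le k r)\<^sup>2 * (2 * r * binom_le k r) * (12 * r ^ 3)"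
    using few_subsets_le_binom[of k r] four_power_le[OF r]
    by (intro mult_le_mono1 mult_le_mono power_mono) auto
  also have "\<dots> = 24 * r ^ 4 * binom_le k r ^ 3"
    by (simp add: power2_eq_square power3_eq_cube power4_eq_xxxx mult_ac)
  finally show ?thesis .
qed

lemma field_ops_query_large:
  assumes r: "0 < r" "k < 2 * r"
  shows "field_ops (query k r) \<le> 2 ^ k * (2 * ((k + 1) * r)\<^sup>2)"
proof -
  have "field_ops (query k r) = field_ops (path_prog k r) + field_ops (path_out_prog k r)"
    using r by (simp add: query_def field_ops_append field_ops_Cons field_ops_load_query)
  also have "\<dots> \<le> 2 ^ k * (k * (r * (2 * (k * r + 1)))) + r * 2"
    using field_ops_path[of k r] field_ops_path_out[of k r] by linarith
  also have "r * 2 \<le> 2 ^ k * (2 * r)" by simp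
  also have "2 ^ k * (k * (r * (2 * (k * r + 1)))) + 2 ^ k * (2 * r) = 2 ^ k * (2 * ((k * r) * (k * r) + k * r + r))"
    by (simp add: algebra_simps)
  also have "\<dots> \<le> 2 ^ k * (2 * ((k + 1) * r)\<^sup>2)"
  proof (intro mult_le_mono2)
    have "((k + 1) * r)\<^sup>2 = (k * r) * (k * r) + 2 * (k * (r * r)) + r * r"
      by (simp add: power2_eq_square algebra_simps)
    moreover have "k * r \<le> k * (r * r)" "r \<le> r * r" using r(1) by auto
    ultimately show "(k * r) * (k * r) + k * r + r \<le> ((k + 1) * r)\<^sup>2" by linarith
  qed
  finally show ?thesis by simp
qed

section \<open>From explicit bounds to soft-O\<close>

text \<open>The crude estimate e \<le> 4 = 2^2 gives e^n \<le> y^2, hence the factor 2.\<close>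

lemma nat_le_ln:
  assumes "(2::real) ^ n \<le> y" shows "real n \<le> 2 * ln y"
proof -
  have "exp (real n) = exp 1 ^ n" by (simp flip: exp_of_nat_mult)
  also have "\<dots> \<le> 4 ^ n" using exp_le by (intro power_mono) auto
  also have "\<dots> = (2 ^ n)\<^sup>2" by (simp add: power2_eq_square flip: power_mult_distrib)
  also have "\<dots> \<le> y\<^sup>2" using assms by (intro power_mono) auto
  finally have "exp (real n) \<le> y\<^sup>2" .
  moreover have "0 < y" using assms less_le_trans[of 0 "2 ^ n" y] by simp
  ultimately show ?thesis
    by (metis ln_exp ln_le_cancel_iff exp_gt_zero ln_realpow of_nat_numeral zero_less_power)
qed

lemma one_le_ln: assumes "3 \<le> (y::real)" shows "1 \<le> ln y"
  using assms exp_le by (subst ln_ge_iff) auto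

text \<open>For a principal filter "eventually" means at every point of S, so the bound has to hold
  without exceptions.\<close>

lemma soft_O_I:
  assumes "\<And>x. x \<in> S \<Longrightarrow> \<bar>g x\<bar> \<le> c * (f x * ln (2 + f x) ^ d)" and "0 \<le> c"
  shows "g \<in> soft_O (principal S) f"
proof -
  have "g \<in> O[principal S](\<lambda>x. f x * ln (2 + f x) ^ d)"
  proof (rule bigoI[of _ c])
    have "norm (g x) \<le> c * norm (f x * ln (2 + f x) ^ d)" if "x \<in> S" for x
      using assms(1)[OF that] assms(2) by (smt (verit) mult_left_mono real_norm_def)
    then show "\<forall>\<^sub>F x in principal S. norm (g x) \<le> c * norm (f x * ln (2 + f x) ^ d)"
      by (simp add: eventually_principal)
  qed
  then show ?thesis unfolding soft_O_def by blast
qed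

lemma pre_soft_O:
  "(\<lambda>(k, r). real (field_ops (pre k r))) \<in> soft_O (principal {(k, r). 0 < r})
     (\<lambda>(k, r). real (binom_le k r * 4 ^ k))"
\<comment> \<open>With L the logarithm, k \<le> 2 L and 1 \<le> L give 4 k + 10 \<le> 8 L + 10
  L.\<close>
proof (rule soft_O_I[where c = 18 and d = 1])
  fix x :: "nat \<times> nat"
  obtain k r where x: "x = (k, r)" by (cases x)
  define f where "f = real (binom_le k r * 4 ^ k)"
  have "1 \<le> binom_le k r" using binom_le_pos[of k r] by simp
  then have "4 ^ k \<le> binom_le k r * 4 ^ k" by simp
  then have f: "4 ^ k \<le> f" unfolding f_def by (metis of_nat_le_iff of_nat_numeral of_nat_power)
  have "(2::real) ^ k \<le> 4 ^ k" by (intro power_mono) auto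
  then have "real k \<le> 2 * ln (2 + f)" using f by (intro nat_le_ln) linarith
  moreover have "1 \<le> ln (2 + f)"
    using f one_le_power[of "4::real" k] by (intro one_le_ln) linarith
  ultimately have k: "4 * real k + 10 \<le> 18 * ln (2 + f)" by linarith
  have "real (field_ops (pre k r)) \<le> real ((4 * k + 10) * (binom_le k r * 4 ^ k))"
    using field_ops_pre[of k r] by (simp only: of_nat_le_iff)
  also have "\<dots> = (4 * real k + 10) * f" by (simp add: f_def)
  also have "\<dots> \<le> (18 * ln (2 + f)) * f" using k by (rule mult_right_mono) (simp add: f_def)
  finally show "\<bar>case x of (k, r) \<Rightarrow> real (field_ops (pre k r))\<bar> \<le>
      18 * ((case x of (k, r) \<Rightarrow> real (binom_le k r * 4 ^ k)) *
        ln (2 + (case x of (k, r) \<Rightarrow> real (binom_le k r * 4 ^ k))) ^ 1)"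
    by (simp only: x prod.case f_def) (simp add: mult_ac)
qed simp

text \<open>For fixed k the binomial sum is constant once r exceeds k, whereas the polynomial
  products in the path recursion grow with r. The condition on r ties the two together; it bounds
  the factor r^2 of the case k < 2 r.\<close>

lemma query_soft_O:
  "(\<lambda>(k, r). real (field_ops (query k r))) \<in> soft_O (principal {(k, r). 0 < r \<and> r \<le> a * binom_le k r})
     (\<lambda>(k, r). real (binom_le k r ^ 3))"
\<comment> \<open>Small r: 24 times (2 L)^4 gives 384 and the exponent 4. Large r: 2^k \<le> 2 b,
  the factor 2 and k + 1 \<le> 3 L give 2 times 2 times 9 = 36.\<close>
proof (rule soft_O_I[where c = "384 + 36 * real a ^ 2" and d = 4])
  fix x :: "nat \<times> nat" assume "x \<in> {(k, r). 0 < r \<and> r \<le> a * binom_le k r}"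
  then obtain k r where x: "x = (k, r)" and r: "0 < r" "r \<le> a * binom_le k r" by auto
  define b where "b = real (binom_le k r)"
  define L where "L = ln (2 + b ^ 3)"
  have b: "1 \<le> b" using binom_le_pos[of k r] by (simp add: b_def)
  have b3: "2 * b \<le> 2 + b ^ 3"
  proof -
    \<comment> \<open>The right-hand side expands to b^3 - 2 b + 2, so this is the claim itself. It
      adapts 2^k \<le> 2 b to the argument 2 + b^3 of the logarithm.\<close>
    have "0 \<le> (b - 1)\<^sup>2 * (b + 2) + b" using b by simp
    then show ?thesis by (simp add: power2_eq_square power3_eq_cube algebra_simps)
  qed
  have L: "1 \<le> L" unfolding L_def using b one_le_power[of b 3] by (intro one_le_ln) linarith
  have "real (field_ops (query k r)) \<le> (384 + 36 * real a ^ 2) * (b ^ 3 * L ^ 4)"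
  proof (cases "2 * r \<le> k")
    case True
    have "real (2 ^ r) \<le> b"
      unfolding b_def using two_power_le_binom_le_small[OF r(1) True] by (simp only: of_nat_le_iff)
    then have "real r \<le> 2 * L" unfolding L_def using b b3 by (intro nat_le_ln) simp
    then have "real r ^ 4 \<le> (2 * L) ^ 4" by (intro power_mono) auto
    then have r4: "real r ^ 4 \<le> 16 * L ^ 4" by (simp add: power_mult_distrib)
    have "real (field_ops (query k r)) \<le> real (24 * r ^ 4 * binom_le k r ^ 3)"
      using field_ops_query_small[OF r(1) True] by (simp only: of_nat_le_iff)
    also have "\<dots> = 24 * real r ^ 4 * b ^ 3" by (simp add: b_def)
    also have "\<dots> \<le> 24 * (16 * L ^ 4) * b ^ 3"
      using r4 b by (intro mult_right_mono mult_left_mono) auto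
    also have "\<dots> \<le> (384 + 36 * real a ^ 2) * (b ^ 3 * L ^ 4)"
      using b L by (simp add: algebra_simps)
    finally show ?thesis .
  next
    case False
    then have rk: "k < 2 * r" by simp
    have two: "(2::real) ^ k \<le> 2 * b"
    proof -
      have "real (2 ^ k) \<le> real (2 * binom_le k r)"
        using two_power_le_binom_le_large[OF rk] by (simp only: of_nat_le_iff)
      then show ?thesis by (simp add: b_def)
    qed
    then have "real k \<le> 2 * L" unfolding L_def using b3 by (intro nat_le_ln) linarith
    then have k: "real k + 1 \<le> 3 * L" using L by linarith
    have ra: "real r \<le> real a * b"
      using r(2) unfolding b_def by (metis of_nat_le_iff of_nat_mult)
    have "(real k + 1) * real r \<le> (3 * L) * (real a * b)"
      using k ra L by (intro mult_mono) auto
    then have "((real k + 1) * real r)\<^sup>2 \<le> ((3 * L) * (real a * b))\<^sup>2"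
      by (intro power_mono) auto
    then have sq: "((real k + 1) * real r)\<^sup>2 \<le> 9 * L ^ 2 * real a ^ 2 * b ^ 2"
      by (simp add: power_mult_distrib mult_ac)
    have "real (field_ops (query k r)) \<le> real (2 ^ k * (2 * ((k + 1) * r)\<^sup>2))"
      using field_ops_query_large[OF r(1) rk] by (simp only: of_nat_le_iff)
    also have "\<dots> = 2 ^ k * (2 * ((real k + 1) * real r)\<^sup>2)"
      by (simp only: of_nat_mult of_nat_power of_nat_add of_nat_numeral of_nat_1)
    also have "\<dots> \<le> (2 * b) * (2 * (9 * L ^ 2 * real a ^ 2 * b ^ 2))"
      using two sq b by (intro mult_mono mult_left_mono) auto
    also have "\<dots> = 36 * real a ^ 2 * (b ^ 3 * L ^ 2)"
      by (simp add: power2_eq_square power3_eq_cube mult_ac)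
    also have "\<dots> \<le> 36 * real a ^ 2 * (b ^ 3 * L ^ 4)"
      using L b by (intro mult_left_mono power_increasing) auto
    also have "\<dots> \<le> (384 + 36 * real a ^ 2) * (b ^ 3 * L ^ 4)"
      using b L by (intro mult_right_mono) auto
    finally show ?thesis .
  qed
  then show "\<bar>case x of (k, r) \<Rightarrow> real (field_ops (query k r))\<bar> \<le>
      (384 + 36 * real a ^ 2) * ((case x of (k, r) \<Rightarrow> real (binom_le k r ^ 3)) *
        ln (2 + (case x of (k, r) \<Rightarrow> real (binom_le k r ^ 3))) ^ 4)"
    by (simp add: x b_def L_def)
qed simp

text \<open>One pair of programs serves all a: enlarging a changes only the hidden constant, while
  the exponent 4 of the logarithm in the query bound stays fixed.\<close>

theorem theorem6:
  shows "\<exists>pre query :: nat \<Rightarrow> nat \<Rightarrow> instr list.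
    uniform_family pre \<and> uniform_family query \<and>
    (\<forall>k r. 0 < r \<longrightarrow>
      (\<forall>A :: 'a::field mat. A \<in> carrier_mat k k \<longrightarrow>
        answers_queries k r A (pre k r) (query k r))) \<and>
    (\<lambda>(k, r). real (field_ops (pre k r)))
      \<in> soft_O (principal {(k, r). 0 < r})
          (\<lambda>(k, r). real (binom_le k r * 4 ^ k)) \<and>
    (\<forall>a::nat. (\<lambda>(k, r). real (field_ops (query k r)))
      \<in> soft_O (principal {(k, r). 0 < r \<and> r \<le> a * binom_le k r})
          (\<lambda>(k, r). real (binom_le k r ^ 3)))"
  by (rule exI[of _ pre], rule exI[of _ query])
    (intro conjI allI impI uniform_family_pre uniform_family_query answers_queries_pre_query
      pre_soft_O query_soft_O)

end
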